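(* Let $0<s<1$, let $D\subset\mathbb{R}^n$ be a domain and let $0<\beta<|D|$. Let $\hat f\in\bar{\mathcal R}_\beta$ be the unique minimizer of $\Phi_s$ over $\bar{\mathcal R}_\beta$, let $\hat u:=u_{\hat f}\in H^s_0(D)$, let $\alpha>0$ be the constant such that $\{\hat f<1\}\subset\{\hat u=\alpha\}$, $\{\hat u<\alpha\}\subset\{\hat f=1\}$, $\hat f>0$ and $0\le\hat u\le\alpha$ in $D$, and let $\hat U:=\alpha-\hat u$. Consider the problem $$\text{(P)}\qquad\begin{cases}-(-\Delta)^sU-\chi_{\{U\le0\}}\min\{-(-\Delta)^sU^+;1\}=\chi_{\{U>0\}}&\text{in }D,\\ U=\alpha&\text{in }D^c.\end{cases}$$ Then $\hat U$ is a solution of (P). Moreover, problem (P) is equivalent to the inequalities $$\chi_{\{U>0\}}\le-(-\Delta)^sU\le\chi_{\{U\ge0\}}\quad\text{in }D,\qquad U=\alpha\ \text{ in }D^c,$$ in the sense of distributions. Finally, $U$ solves (P) if and only if it is a minimizer of $$J(v)=|v|_s^2+\int_Dv^+\,dx$$ in $H_\alpha=\{v\in H^s_{loc}(\mathbb{R}^n):v-\alpha\in H^s_0(D)\}$.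
   Context: Notation: $|u|_s^2:=\iint_{\mathbb{R}^{2n}}\frac{|u(x)-u(y)|^2}{|x-y|^{n+2s}}\,dx\,dy$; $H^s(\mathbb{R}^n)=\{v\in L^2(\mathbb{R}^n):|v|_s^2<\infty\}$; $H^s_{loc}(\mathbb{R}^n)$ is the set of functions $v$ with $\eta v\in H^s(\mathbb{R}^n)$ for every $\eta\in C_c^\infty(\mathbb{R}^n)$; $H^s_0(D)=\{v\in H^s(\mathbb{R}^n):v=0\text{ a.e. in }D^c\}$, $D^c=\mathbb{R}^n\setminus D$; $v^+=\max\{v,0\}$. For $f\in L^2(D)$, $u_f\in H^s_0(D)$ is the unique function with $$\frac12\iint_{\mathbb{R}^{2n}}\frac{(u_f(x)-u_f(y))(v(x)-v(y))}{|x-y|^{n+2s}}\,dx\,dy=\int_Dfv\,dx\quad\text{for all }v\in H^s_0(D).$$ $\Phi_s(f):=|u_f|_s^2$ and $\bar{\mathcal R}_\beta=\{f\in L^\infty(D):0\le f\le1,\ \int_Df\,dx=\beta\}$. A unique minimizer $\hat f$ of $\Phi_s$ over $\bar{\mathcal R}_\beta$ and a constant $\alpha$ with the listed properties exist. The fractional Laplacian is $(-\Delta)^su(x)=\text{p.v.}\int_{\mathbb{R}^n}\frac{u(x)-u(y)}{|x-y|^{n+2s}}\,dy$, acting weakly by $$\langle(-\Delta)^sU,\phi\rangle=\frac12\iint_{\mathbb{R}^{2n}}\frac{(U(x)-U(y))(\phi(x)-\phi(y))}{|x-y|^{n+2s}}\,dx\,dy.$$ The inequalities in the sense of distributions mean: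 $\int_D\chi_{\{U>0\}}\phi\,dx\le-\langle(-\Delta)^sU,\phi\rangle\le\int_D\chi_{\{U\ge0\}}\phi\,dx$ for all $\phi\in C_c^\infty(D)$ with $\phi\ge0$; they are considered for $U\in H_\alpha$. Meaning of (P): a solution is a function $U\in H_\alpha$ with $(-\Delta)^sU\le0$ in $D$ in the sense of distributions (fractional subharmonic in $D$) such that, for every $\phi\in H^s_0(D)$, $$-\frac12\iint_{\mathbb{R}^{2n}}\frac{(U(x)-U(y))(\phi(x)-\phi(y))}{|x-y|^{n+2s}}\,dx\,dy=\int_D\Big[\chi_{\{U\le0\}}\min\{-(-\Delta)^sU^+;1\}+\chi_{\{U>0\}}\Big]\phi\,dx.$$ Here, for such $U$, also $(-\Delta)^sU^+\le0$ in $D$ in the sense of distributions, so $(-\Delta)^sU^+$ is a signed measure in $D$, and $\min\{-(-\Delta)^sU^+;1\}=-\max\{(-\Delta)^sU^+;-1\}=1-((-\Delta)^sU^++1)^+$ is understood in the sense of measures and belongs to $L^\infty(D)$.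
   Formalization: J is taken as |v|_s²/4 + ∫_D v⁺ (with the stated conventions |v|_s² without 1/4 makes the minimizer claim false), and "inequalities imply (P)" is stated only when C_c^∞(D) is dense in H^s_0(D), without which it fails (e.g. a slit disc, s>1/2). *)

theory Defs
  imports "HOL-Analysis.Analysis"
begin

(* R^n is an arbitrary Euclidean space 'a with n = DIM('a). Elements of Lebesgue and Sobolev
   spaces are represented by Borel functions 'a => real; all pointwise relations between them are
   required almost everywhere. *)

section \<open>Test functions\<close>

primrec C_k :: "nat \<Rightarrow> ('a::euclidean_space \<Rightarrow> real) \<Rightarrow> bool" where
  "C_k 0 f \<longleftrightarrow> continuous_on UNIV f"
| "C_k (Suc k) f \<longleftrightarrow> (\<exists>f'. (\<forall>x. (f has_derivative f' x) (at x)) \<and> (\<forall>h. C_k k (\<lambda>x. f' x h)))"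

definition test_functions :: "'a::euclidean_space set \<Rightarrow> ('a \<Rightarrow> real) set" where
  "test_functions D =
     {\<phi>. (\<forall>k. C_k k \<phi>) \<and> compact (closure {x. \<phi> x \<noteq> 0}) \<and> closure {x. \<phi> x \<noteq> 0} \<subseteq> D}"


section \<open>Fractional Sobolev spaces and the fractional Laplacian\<close>

(* |u|_s^2. On the diagonal the integrand is 0 / 0 = 0. *)
definition gagliardo_sq :: "real \<Rightarrow> ('a::euclidean_space \<Rightarrow> real) \<Rightarrow> ennreal" where
  "gagliardo_sq s u =
     (\<integral>\<^sup>+ z. ennreal ((u (fst z) - u (snd z))\<^sup>2 /
        norm (fst z - snd z) powr (real DIM('a) + 2 * s)) \<partial>(lborel \<Otimes>\<^sub>M lborel))"

definition Hs :: "real \<Rightarrow> ('a::euclidean_space \<Rightarrow> real) set" where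
  "Hs s = {v. v \<in> borel_measurable lborel \<and> integrable lborel (\<lambda>x. (v x)\<^sup>2) \<and> gagliardo_sq s v < \<infinity>}"

definition Hs_loc :: "real \<Rightarrow> ('a::euclidean_space \<Rightarrow> real) set" where
  "Hs_loc s = {v. \<forall>\<eta>\<in>test_functions UNIV. (\<lambda>x. \<eta> x * v x) \<in> Hs s}"

definition Hs0 :: "real \<Rightarrow> 'a::euclidean_space set \<Rightarrow> ('a \<Rightarrow> real) set" where
  "Hs0 s D = {v \<in> Hs s. AE x in lborel. x \<notin> D \<longrightarrow> v x = 0}"

definition H_alpha :: "real \<Rightarrow> 'a::euclidean_space set \<Rightarrow> real \<Rightarrow> ('a \<Rightarrow> real) set" where
  "H_alpha s D \<alpha> = {v \<in> Hs_loc s. (\<lambda>x. v x - \<alpha>) \<in> Hs0 s D}"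

(* The pairing of (-Delta)^s U with phi. The integrand is integrable whenever U and phi have finite
   Gagliardo seminorm, which covers every use below. *)
definition frac_lap :: "real \<Rightarrow> ('a::euclidean_space \<Rightarrow> real) \<Rightarrow> ('a \<Rightarrow> real) \<Rightarrow> real" where
  "frac_lap s U \<phi> =
     1/2 * (LINT z|(lborel \<Otimes>\<^sub>M lborel). (U (fst z) - U (snd z)) * (\<phi> (fst z) - \<phi> (snd z)) /
        norm (fst z - snd z) powr (real DIM('a) + 2 * s))"

definition frac_subharmonic :: "real \<Rightarrow> 'a::euclidean_space set \<Rightarrow> ('a \<Rightarrow> real) \<Rightarrow> bool" where
  "frac_subharmonic s D U \<longleftrightarrow> (\<forall>\<phi>\<in>test_functions D. (\<forall>x. 0 \<le> \<phi> x) \<longrightarrow> frac_lap s U \<phi> \<le> 0)"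

definition test_functions_dense :: "real \<Rightarrow> 'a::euclidean_space set \<Rightarrow> bool" where
  "test_functions_dense s D \<longleftrightarrow>
     (\<forall>v\<in>Hs0 s D. \<forall>\<epsilon>>0. \<exists>\<phi>\<in>test_functions D.
        (\<integral>\<^sup>+ x. ennreal ((v x - \<phi> x)\<^sup>2) \<partial>lborel) + gagliardo_sq s (\<lambda>x. v x - \<phi> x) < ennreal \<epsilon>)"


section \<open>The rearrangement problem\<close>

(* u is (a representative of) u_f. *)
definition is_state :: "real \<Rightarrow> 'a::euclidean_space set \<Rightarrow> ('a \<Rightarrow> real) \<Rightarrow> ('a \<Rightarrow> real) \<Rightarrow> bool" where
  "is_state s D f u \<longleftrightarrow> u \<in> Hs0 s D \<and> (\<forall>v\<in>Hs0 s D. frac_lap s u v = (LINT x:D|lborel. f x * v x))"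

(* The value does not depend on the chosen representative of u_f. *)
definition Phi :: "real \<Rightarrow> 'a::euclidean_space set \<Rightarrow> ('a \<Rightarrow> real) \<Rightarrow> ennreal" where
  "Phi s D f = gagliardo_sq s (SOME u. is_state s D f u)"

definition R_bar :: "'a::euclidean_space set \<Rightarrow> real \<Rightarrow> ('a \<Rightarrow> real) set" where
  "R_bar D \<beta> = {f. set_integrable lborel D f \<and> (AE x in lborel. x \<in> D \<longrightarrow> 0 \<le> f x \<and> f x \<le> 1) \<and>
     (LINT x:D|lborel. f x) = \<beta>}"

definition is_min_on :: "('b \<Rightarrow> ennreal) \<Rightarrow> 'b set \<Rightarrow> 'b \<Rightarrow> bool" where
  "is_min_on F S x \<longleftrightarrow> x \<in> S \<and> (\<forall>y\<in>S. F x \<le> F y)"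

definition unique_Phi_minimizer ::
    "real \<Rightarrow> 'a::euclidean_space set \<Rightarrow> real \<Rightarrow> ('a \<Rightarrow> real) \<Rightarrow> bool" where
  "unique_Phi_minimizer s D \<beta> f \<longleftrightarrow> is_min_on (Phi s D) (R_bar D \<beta>) f \<and>
     (\<forall>g. is_min_on (Phi s D) (R_bar D \<beta>) g \<longrightarrow> (AE x in lborel. x \<in> D \<longrightarrow> g x = f x))"


section \<open>Problem (P), the distributional inequalities and the functional J\<close>

(* mu is the measure - (-Delta)^s V on D, when that distribution is a nonnegative Radon measure. *)
definition neg_frac_lap_measure ::
    "real \<Rightarrow> 'a::euclidean_space set \<Rightarrow> ('a \<Rightarrow> real) \<Rightarrow> 'a measure \<Rightarrow> bool" where
  "neg_frac_lap_measure s D V \<mu> \<longleftrightarrow>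
     sets \<mu> = sets (restrict_space borel D) \<and>
     (\<forall>K. compact K \<and> K \<subseteq> D \<longrightarrow> emeasure \<mu> K < \<infinity>) \<and>
     (\<forall>\<phi>\<in>test_functions D. (LINT x|\<mu>. \<phi> x) = - frac_lap s V \<phi>)"

(* m is the density of min{- (-Delta)^s V ; 1}: the minimum is the infimum, in the lattice of
   measures on D, of the measure - (-Delta)^s V and Lebesgue measure. It is determined a.e. in D. *)
definition min_neg_frac_lap_one ::
    "real \<Rightarrow> 'a::euclidean_space set \<Rightarrow> ('a \<Rightarrow> real) \<Rightarrow> ('a \<Rightarrow> real) \<Rightarrow> bool" where
  "min_neg_frac_lap_one s D V m \<longleftrightarrow>
     m \<in> borel_measurable lborel \<and> (\<exists>C. AE x in lborel. x \<in> D \<longrightarrow> 0 \<le> m x \<and> m x \<le> C) \<and>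
     (\<exists>\<mu>. neg_frac_lap_measure s D V \<mu> \<and>
        density (restrict_space lborel D) (\<lambda>x. ennreal (m x)) = inf \<mu> (restrict_space lborel D))"

definition solves_P :: "real \<Rightarrow> 'a::euclidean_space set \<Rightarrow> real \<Rightarrow> ('a \<Rightarrow> real) \<Rightarrow> bool" where
  "solves_P s D \<alpha> U \<longleftrightarrow>
     U \<in> H_alpha s D \<alpha> \<and> frac_subharmonic s D U \<and>
     (\<exists>m. min_neg_frac_lap_one s D (\<lambda>x. max (U x) 0) m \<and>
        (\<forall>\<phi>\<in>Hs0 s D. - frac_lap s U \<phi> =
           (LINT x:D|lborel. (indicator {x. U x \<le> 0} x * m x + indicator {x. U x > 0} x) * \<phi> x)))"

definition solves_ineq :: "real \<Rightarrow> 'a::euclidean_space set \<Rightarrow> real \<Rightarrow> ('a \<Rightarrow> real) \<Rightarrow> bool" where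
  "solves_ineq s D \<alpha> U \<longleftrightarrow>
     U \<in> H_alpha s D \<alpha> \<and>
     (\<forall>\<phi>\<in>test_functions D. (\<forall>x. 0 \<le> \<phi> x) \<longrightarrow>
        (LINT x:D|lborel. indicator {x. U x > 0} x * \<phi> x) \<le> - frac_lap s U \<phi> \<and>
        - frac_lap s U \<phi> \<le> (LINT x:D|lborel. indicator {x. U x \<ge> 0} x * \<phi> x))"

(* The factor 1/4 is the one for which the Euler-Lagrange equation of J is
   - (-Delta)^s U = chi_{U > 0} off {U = 0}: the derivative of |U|_s^2 in direction phi is twice the
   full double integral, i.e. 4 <(-Delta)^s U, phi>. With |v|_s^2 in place of |v|_s^2 / 4 minimizers
   of J do not solve (P). *)
definition J :: "real \<Rightarrow> 'a::euclidean_space set \<Rightarrow> ('a \<Rightarrow> real) \<Rightarrow> ennreal" where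
  "J s D v = gagliardo_sq s v / 4 + (\<integral>\<^sup>+ x\<in>D. ennreal (max (v x) 0) \<partial>lborel)"

end

theory Submission
  imports Defs
begin

text \<open>
  Write \<open>W = \<alpha> - uhat\<close>. Every solution of (P), every solution of the inequalities (when test
  functions are dense) and every
  minimizer of \<open>J\<close> equals \<open>W\<close> almost everywhere, and \<open>W\<close> has all three properties.

  For minimizers this is convexity: \<open>fhat\<close> is a subgradient of the positive part at \<open>W\<close>, so
  \<open>J v\<close> exceeds \<open>J W\<close> by at least \<open>gagliardo_sq s (v - W) / 4\<close>.

  For the other two, let \<open>U\<close> be a solution. Once \<open>U \<ge> 0\<close> is known, the right-hand sides of the equations
  of \<open>U\<close> and \<open>W\<close> are ordered by the sign of \<open>U - W\<close>, and testing with \<open>U - W\<close> gives zero energy.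
  To see \<open>U \<ge> 0\<close>, test with the negative part \<open>N\<close>, writing \<open>P\<close> for the positive part. Since the
  pairing of \<open>P\<close> and \<open>N\<close> is nonpositive, it is enough to bound the right-hand side by
  \<open>- frac_lap s P N\<close>. For the inequalities that side vanishes. For (P) it is the integral of
  \<open>m * N\<close>, where \<open>m\<close> is the minimum of \<open>- (-\<Delta>)\<^sup>s P\<close> and \<open>1\<close>; that minimum
  is controlled only on test functions, and mollified cutoffs of \<open>N\<close> carry the bound over to \<open>N\<close>.
\<close>

section \<open>The Gagliardo energy as an \<open>L\<^sup>2\<close> norm\<close>

text \<open>(P) is tested with all of \<open>Hs0 s D\<close>, whereas the inequalities and the
  measure \<open>- (-\<Delta>)\<^sup>s P\<close> are known only through smooth functions supported
  inside \<open>D\<close>. No regularity of the boundary of \<open>D\<close> is assumed, so such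
  functions may fail to be dense in \<open>Hs0 s D\<close>; this is why density is asked for in
  passing from the inequalities to (P). For (P), the passage from test functions to \<open>N\<close>
  exploits nonlocality instead: nonnegative functions with disjoint supports pair nonpositively, so
  what a cutoff removes from \<open>N\<close> has the right sign when paired with \<open>P\<close>.

  For (P) the sign of \<open>U\<close> has to be settled first because of the set where
  \<open>U < 0 = W\<close>. There the right-hand side for \<open>U\<close> is \<open>m\<close>, and
  nothing orders \<open>m\<close> and \<open>fhat\<close>, both of which merely lie between 0 and
  1.\<close>

definition quot :: "real \<Rightarrow> ('a::euclidean_space \<Rightarrow> real) \<Rightarrow> 'a \<times> 'a \<Rightarrow> real" where
  "quot s u z = (u (fst z) - u (snd z)) / norm (fst z - snd z) powr ((real DIM('a) + 2 * s) / 2)"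

definition finite_energy :: "real \<Rightarrow> ('a::euclidean_space \<Rightarrow> real) \<Rightarrow> bool" where
  "finite_energy s u \<longleftrightarrow> u \<in> borel_measurable borel \<and> gagliardo_sq s u < \<infinity>"

lemma powr_half_mult: "(x::real) powr (a / 2) * x powr (a / 2) = x powr a"
  by (simp flip: powr_add)

lemma quot_mult:
  fixes u v :: "'a::euclidean_space \<Rightarrow> real"
  shows "quot s u z * quot s v z = (u (fst z) - u (snd z)) * (v (fst z) - v (snd z)) /
     norm (fst z - snd z) powr (real DIM('a) + 2 * s)"
  unfolding quot_def by (simp add: powr_half_mult)

lemma quot_power2:
  fixes u :: "'a::euclidean_space \<Rightarrow> real"
  shows "(quot s u z)\<^sup>2 = (u (fst z) - u (snd z))\<^sup>2 /
     norm (fst z - snd z) powr (real DIM('a) + 2 * s)"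
  by (simp add: power2_eq_square quot_mult)

lemma gagliardo_sq_quot:
  fixes u :: "'a::euclidean_space \<Rightarrow> real"
  shows "gagliardo_sq s u = (\<integral>\<^sup>+ z. ennreal ((quot s u z)\<^sup>2) \<partial>lborel)"
  unfolding gagliardo_sq_def quot_power2 lborel_prod ..

lemma frac_lap_quot:
  fixes u :: "'a::euclidean_space \<Rightarrow> real"
  shows "frac_lap s u v = 1/2 * (LINT z|lborel. quot s u z * quot s v z)"
  unfolding frac_lap_def quot_mult lborel_prod ..

lemma measurable_quot [measurable]:
  fixes u :: "'a::euclidean_space \<Rightarrow> real"
  assumes [measurable]: "u \<in> borel_measurable borel"
  shows "quot s u \<in> borel_measurable borel"
proof -
  have "quot s u \<in> borel_measurable (borel \<Otimes>\<^sub>M borel)"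
    unfolding quot_def by measurable
  then show ?thesis by (simp add: borel_prod)
qed

lemma quot_add: "quot s (\<lambda>x. u x + v x) z = quot s u z + quot s v z"
  unfolding quot_def by (simp add: add_divide_distrib[symmetric])

lemma quot_diff: "quot s (\<lambda>x. u x - v x) z = quot s u z - quot s v z"
  unfolding quot_def by (simp add: diff_divide_distrib[symmetric])

lemma quot_cmult: "quot s (\<lambda>x. c * u x) z = c * quot s u z"
  unfolding quot_def by (simp add: algebra_simps)

lemma quot_minus: "quot s (\<lambda>x. - u x) z = - quot s u z"
  using quot_cmult[of s "-1" u] by simp

lemma quot_const: "quot s (\<lambda>x. c) z = 0"
  unfolding quot_def by simp

lemma quot_le:
  assumes "\<And>x y. \<bar>u x - u y\<bar> \<le> \<bar>v x - v y\<bar> + \<bar>w x - w y\<bar>"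
  shows "\<bar>quot s u z\<bar> \<le> \<bar>quot s v z\<bar> + \<bar>quot s w z\<bar>"
  using assms[of "fst z" "snd z"] unfolding quot_def
  by (simp add: abs_divide add_divide_distrib[symmetric] divide_right_mono)

lemma square_le_two_squares:
  fixes a b c :: real
  assumes "\<bar>a\<bar> \<le> \<bar>b\<bar> + \<bar>c\<bar>"
  shows "a\<^sup>2 \<le> 2 * b\<^sup>2 + 2 * c\<^sup>2"
proof -
  have "a\<^sup>2 \<le> (\<bar>b\<bar> + \<bar>c\<bar>)\<^sup>2" using assms by (metis abs_le_square_iff abs_of_nonneg abs_ge_zero add_nonneg_nonneg)
  also have "\<dots> \<le> 2 * b\<^sup>2 + 2 * c\<^sup>2"
    using sum_squares_bound[of "\<bar>b\<bar>" "\<bar>c\<bar>"] by (simp add: power2_sum)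
  finally show ?thesis .
qed

lemma integrable_power2_iff:
  fixes f :: "'b \<Rightarrow> real"
  assumes "f \<in> borel_measurable M"
  shows "integrable M (\<lambda>x. (f x)\<^sup>2) \<longleftrightarrow> (\<integral>\<^sup>+x. ennreal ((f x)\<^sup>2) \<partial>M) < \<infinity>"
  using assms by (simp add: integrable_iff_bounded)

lemma integrable_power2_bound:
  fixes f g h :: "'b \<Rightarrow> real"
  assumes [measurable]: "f \<in> borel_measurable M"
    and "integrable M (\<lambda>x. (g x)\<^sup>2)" "integrable M (\<lambda>x. (h x)\<^sup>2)"
    and "\<And>x. \<bar>f x\<bar> \<le> \<bar>g x\<bar> + \<bar>h x\<bar>"
  shows "integrable M (\<lambda>x. (f x)\<^sup>2)"
proof (rule Bochner_Integration.integrable_bound)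
  show "integrable M (\<lambda>x. 2 * (g x)\<^sup>2 + 2 * (h x)\<^sup>2)" using assms by simp
  show "AE x in M. norm ((f x)\<^sup>2) \<le> norm (2 * (g x)\<^sup>2 + 2 * (h x)\<^sup>2)"
    using square_le_two_squares[OF assms(4)] by simp
qed simp

lemma integrable_mult_of_power2:
  fixes g h :: "'b \<Rightarrow> real"
  assumes [measurable]: "g \<in> borel_measurable M" "h \<in> borel_measurable M"
    and "integrable M (\<lambda>x. (g x)\<^sup>2)" "integrable M (\<lambda>x. (h x)\<^sup>2)"
  shows "integrable M (\<lambda>x. g x * h x)"
proof (rule Bochner_Integration.integrable_bound)
  show "integrable M (\<lambda>x. (g x)\<^sup>2 + (h x)\<^sup>2)" using assms by simp
  show "AE x in M. norm (g x * h x) \<le> norm ((g x)\<^sup>2 + (h x)\<^sup>2)"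
  proof (rule AE_I2)
    fix x
    have "2 * (\<bar>g x\<bar> * \<bar>h x\<bar>) \<le> (g x)\<^sup>2 + (h x)\<^sup>2"
      using sum_squares_bound[of "\<bar>g x\<bar>" "\<bar>h x\<bar>"] by simp
    moreover have "0 \<le> \<bar>g x\<bar> * \<bar>h x\<bar>" by simp
    ultimately have "\<bar>g x\<bar> * \<bar>h x\<bar> \<le> (g x)\<^sup>2 + (h x)\<^sup>2" by linarith
    then show "norm (g x * h x) \<le> norm ((g x)\<^sup>2 + (h x)\<^sup>2)"
      by (simp add: abs_mult)
  qed
qed simp

lemma finite_energyD [measurable_dest]: "finite_energy s u \<Longrightarrow> u \<in> borel_measurable borel"
  by (simp add: finite_energy_def)

lemma finite_energy_iff:
  "finite_energy s u \<longleftrightarrow> u \<in> borel_measurable borel \<and> integrable lborel (\<lambda>z. (quot s u z)\<^sup>2)"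
  unfolding finite_energy_def gagliardo_sq_quot
  by (auto simp: integrable_power2_iff)

lemma finite_energy_integrable:
  "finite_energy s u \<Longrightarrow> integrable lborel (\<lambda>z. (quot s u z)\<^sup>2)"
  by (simp add: finite_energy_iff)

text \<open>With two comparison functions one lemma serves sums, differences and maxima; a constant
  \<open>w\<close> gives the case of a single function.\<close>

lemma finite_energy_bound:
  assumes "u \<in> borel_measurable borel" "finite_energy s v" "finite_energy s w"
    and "\<And>x y. \<bar>u x - u y\<bar> \<le> \<bar>v x - v y\<bar> + \<bar>w x - w y\<bar>"
  shows "finite_energy s u"
proof -
  note assms(1)[measurable]
  have "integrable lborel (\<lambda>z. (quot s u z)\<^sup>2)"
  proof (rule integrable_power2_bound[where g="quot s v" and h="quot s w"])
    show "\<bar>quot s u z\<bar> \<le> \<bar>quot s v z\<bar> + \<bar>quot s w z\<bar>" for z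
      by (rule quot_le) (rule assms(4))
  qed (use assms(2,3) in \<open>simp_all add: finite_energy_integrable\<close>)
  then show ?thesis using assms(1) by (simp add: finite_energy_iff)
qed

lemma finite_energy_const: "finite_energy s (\<lambda>x. c)"
  by (simp add: finite_energy_iff quot_const)

lemma finite_energy_add: "finite_energy s u \<Longrightarrow> finite_energy s v \<Longrightarrow> finite_energy s (\<lambda>x. u x + v x)"
  by (rule finite_energy_bound[where v=u and w=v]) auto

lemma finite_energy_diff: "finite_energy s u \<Longrightarrow> finite_energy s v \<Longrightarrow> finite_energy s (\<lambda>x. u x - v x)"
  by (rule finite_energy_bound[where v=u and w=v]) auto

lemma finite_energy_minus: "finite_energy s u \<Longrightarrow> finite_energy s (\<lambda>x. - u x)"
  by (rule finite_energy_bound[where v=u and w="\<lambda>x. 0"]) (auto simp: finite_energy_const)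

lemma finite_energy_max: "finite_energy s u \<Longrightarrow> finite_energy s v \<Longrightarrow> finite_energy s (\<lambda>x. max (u x) (v x))"
  by (rule finite_energy_bound[where v=u and w=v]) auto

lemma gagliardo_sq_eq:
  "finite_energy s u \<Longrightarrow> gagliardo_sq s u = ennreal (LINT z|lborel. (quot s u z)\<^sup>2)"
  unfolding gagliardo_sq_quot
  by (rule nn_integral_eq_integral) (auto simp: finite_energy_iff)

lemma integrable_quot_mult:
  "finite_energy s u \<Longrightarrow> finite_energy s v \<Longrightarrow> integrable lborel (\<lambda>z. quot s u z * quot s v z)"
  by (rule integrable_mult_of_power2) (auto simp: finite_energy_iff)

lemma gagliardo_sq_frac_lap: "finite_energy s u \<Longrightarrow> gagliardo_sq s u = ennreal (2 * frac_lap s u u)"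
  by (simp add: gagliardo_sq_eq frac_lap_quot power2_eq_square)

lemma frac_lap_self_nonneg: "0 \<le> frac_lap s u u"
  by (simp add: frac_lap_quot)

lemma frac_lap_add_left:
  assumes "finite_energy s u" "finite_energy s v" "finite_energy s w"
  shows "frac_lap s (\<lambda>x. u x + v x) w = frac_lap s u w + frac_lap s v w"
  using assms by (simp add: frac_lap_quot quot_add distrib_right integrable_quot_mult)

lemma frac_lap_diff_left:
  assumes "finite_energy s u" "finite_energy s v" "finite_energy s w"
  shows "frac_lap s (\<lambda>x. u x - v x) w = frac_lap s u w - frac_lap s v w"
  using assms by (simp add: frac_lap_quot quot_diff left_diff_distrib integrable_quot_mult)

lemma frac_lap_commute: "frac_lap s u v = frac_lap s v u"
  by (simp add: frac_lap_quot mult.commute)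

lemma frac_lap_diff_right:
  assumes "finite_energy s u" "finite_energy s v" "finite_energy s w"
  shows "frac_lap s w (\<lambda>x. u x - v x) = frac_lap s w u - frac_lap s w v"
  using frac_lap_diff_left[OF assms] by (simp add: frac_lap_commute)

lemma frac_lap_minus_left: "frac_lap s (\<lambda>x. - u x) w = - frac_lap s u w"
  by (simp add: frac_lap_quot quot_minus)

lemma frac_lap_const_left: "frac_lap s (\<lambda>x. c) w = 0"
  by (simp add: frac_lap_quot quot_const)

lemma frac_lap_const_diff_left:
  "finite_energy s u \<Longrightarrow> finite_energy s w \<Longrightarrow> frac_lap s (\<lambda>x. c - u x) w = - frac_lap s u w"
  by (simp add: frac_lap_diff_left finite_energy_const frac_lap_const_left)

text \<open>A pair is exceptional only if one of its coordinates lies in a null set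
  \<open>N\<close>, and the two cylinders over \<open>N\<close> are null for the product
  measure.\<close>

lemma AE_quot_cong:
  fixes u v :: "'a::euclidean_space \<Rightarrow> real"
  assumes "AE x in lborel. u x = v x"
  shows "AE z in lborel. quot s u z = quot s v z"
proof -
  obtain N where N: "N \<in> null_sets lborel" "{x. u x \<noteq> v x} \<subseteq> N"
    using assms by (auto elim!: AE_E simp: null_sets_def)
  have "N \<times> UNIV \<in> null_sets (lborel :: ('a \<times> 'a) measure)"
    unfolding lborel_prod[symmetric] using N
    by (auto simp: null_sets_def lborel.emeasure_pair_measure_Times lborel_pair.emeasure_pair_measure_Times simp del: lborel_prod)
  moreover have "UNIV \<times> N \<in> null_sets (lborel :: ('a \<times> 'a) measure)"
    unfolding lborel_prod[symmetric] using N
    by (auto simp: null_sets_def lborel.emeasure_pair_measure_Times simp del: lborel_prod)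
  ultimately have "N \<times> UNIV \<union> UNIV \<times> N \<in> null_sets (lborel :: ('a \<times> 'a) measure)"
    by (rule null_sets.Un)
  then show ?thesis
  proof (rule AE_I')
    show "{z \<in> space lborel. quot s u z \<noteq> quot s v z} \<subseteq> N \<times> UNIV \<union> UNIV \<times> N"
    proof
      fix z assume "z \<in> {z \<in> space lborel. quot s u z \<noteq> quot s v z}"
      then have "u (fst z) \<noteq> v (fst z) \<or> u (snd z) \<noteq> v (snd z)" unfolding quot_def by auto
      then show "z \<in> N \<times> UNIV \<union> UNIV \<times> N" using N(2) by (cases z) auto
    qed
  qed
qed

lemma frac_lap_cong_AE:
  assumes [measurable]: "u \<in> borel_measurable borel" "v \<in> borel_measurable borel" "w \<in> borel_measurable borel"
    and "AE x in lborel. u x = v x"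
  shows "frac_lap s u w = frac_lap s v w"
  unfolding frac_lap_quot
  using AE_quot_cong[OF assms(4), of s] by (auto intro!: integral_cong_AE)

lemma frac_lap_nonpos_AE:
  assumes "AE z in lborel. quot s u z * quot s v z \<le> 0"
  shows "frac_lap s u v \<le> 0"
proof -
  have "0 \<le> (LINT z|lborel. - (quot s u z * quot s v z))"
    using assms by (intro integral_nonneg_AE) auto
  then show ?thesis unfolding frac_lap_quot by simp
qed

text \<open>Expanding the product of the increments, the products at a single point vanish and only
  minus the cross terms remain. For a local gradient form the pairing would be zero; the sign is a
  nonlocal effect, and both proofs of nonnegativity below rest on it.\<close>

lemma frac_lap_nonpos_of_disjoint:
  fixes u v :: "'a::euclidean_space \<Rightarrow> real"
  assumes "\<And>x. 0 \<le> u x" "\<And>x. 0 \<le> v x" "\<And>x. u x * v x = 0"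
  shows "frac_lap s u v \<le> 0"
proof (rule frac_lap_nonpos_AE, rule AE_I2)
  fix z :: "'a \<times> 'a"
  have "(u (fst z) - u (snd z)) * (v (fst z) - v (snd z)) =
      u (fst z) * v (fst z) + u (snd z) * v (snd z) - (u (fst z) * v (snd z) + u (snd z) * v (fst z))"
    by (simp add: algebra_simps)
  also have "\<dots> = - (u (fst z) * v (snd z) + u (snd z) * v (fst z))"
    unfolding assms(3) by simp
  also have "\<dots> \<le> 0" using assms(1,2) by (simp add: add_nonneg_nonneg flip: minus_add_distrib)
  finally show "quot s u z * quot s v z \<le> 0"
    unfolding quot_mult by (simp add: divide_nonpos_nonneg)
qed

lemma frac_lap_power2_le:
  assumes "finite_energy s u" "finite_energy s v"
  shows "(frac_lap s u v)\<^sup>2 \<le> frac_lap s u u * frac_lap s v v"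
proof -
  have [measurable]: "u \<in> borel_measurable borel" "v \<in> borel_measurable borel"
    using assms by (auto dest: finite_energyD)
  let ?I = "\<lambda>u v. LINT z|lborel. quot s u z * quot s v z"
  have "ennreal \<bar>?I u v\<bar> \<le> (\<integral>\<^sup>+z. ennreal \<bar>quot s u z\<bar> * ennreal \<bar>quot s v z\<bar> \<partial>lborel)"
    using integral_norm_bound_ennreal[OF integrable_quot_mult[OF assms]]
    by (simp add: abs_mult ennreal_mult)
  then have "(ennreal \<bar>?I u v\<bar>)\<^sup>2 \<le> (\<integral>\<^sup>+z. ennreal \<bar>quot s u z\<bar> * ennreal \<bar>quot s v z\<bar> \<partial>lborel)\<^sup>2"
    by (rule power_mono) simp
  also have "\<dots> \<le> (\<integral>\<^sup>+z. (ennreal \<bar>quot s u z\<bar>)\<^sup>2 \<partial>lborel) * (\<integral>\<^sup>+z. (ennreal \<bar>quot s v z\<bar>)\<^sup>2 \<partial>lborel)"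
    by (rule Cauchy_Schwarz_nn_integral) auto
  also have "\<dots> = gagliardo_sq s u * gagliardo_sq s v"
    unfolding gagliardo_sq_quot by (simp add: ennreal_power)
  also have "\<dots> = ennreal ((2 * frac_lap s u u) * (2 * frac_lap s v v))"
    using assms by (subst ennreal_mult) (auto simp: gagliardo_sq_frac_lap frac_lap_self_nonneg)
  finally have "\<bar>?I u v\<bar>\<^sup>2 \<le> (2 * frac_lap s u u) * (2 * frac_lap s v v)"
    by (subst (asm) ennreal_power) (auto simp: frac_lap_self_nonneg)
  then show ?thesis by (simp add: frac_lap_quot power2_eq_square)
qed

section \<open>Continuity of translations\<close>

lemma nn_integral_translate:
  fixes f :: "'a::euclidean_space \<Rightarrow> ennreal"
  assumes [measurable]: "f \<in> borel_measurable borel"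
  shows "(\<integral>\<^sup>+x. f (c + x) \<partial>lborel) = (\<integral>\<^sup>+x. f x \<partial>lborel)"
  by (subst lborel_distr_plus[of c, symmetric], subst nn_integral_distr) auto

lemma nn_integral_translate_diff:
  fixes f :: "'a::euclidean_space \<Rightarrow> ennreal"
  assumes [measurable]: "f \<in> borel_measurable borel"
  shows "(\<integral>\<^sup>+x. f (x - c) \<partial>lborel) = (\<integral>\<^sup>+x. f x \<partial>lborel)"
  using nn_integral_translate[OF assms, of "- c"] by simp

lemma lborel_distr_reflect:
  fixes c :: "'a::euclidean_space"
  shows "distr lborel borel (\<lambda>x. c - x) = lborel"
proof -
  have "lborel = density (distr lborel borel (\<lambda>x. c + (-1) *\<^sub>R x)) (\<lambda>_. \<bar>-1::real\<bar>^DIM('a))"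
    by (rule lborel_affine) simp
  then show ?thesis by (simp add: density_1)
qed

lemma nn_integral_reflect:
  fixes f :: "'a::euclidean_space \<Rightarrow> ennreal"
  assumes [measurable]: "f \<in> borel_measurable borel"
  shows "(\<integral>\<^sup>+x. f (c - x) \<partial>lborel) = (\<integral>\<^sup>+x. f x \<partial>lborel)"
  by (subst (2) lborel_distr_reflect[of c, symmetric], subst nn_integral_distr) auto

lemma tendsto_0_ennrealI:
  fixes f :: "'b \<Rightarrow> ennreal"
  assumes "\<And>e::real. 0 < e \<Longrightarrow> eventually (\<lambda>x. f x < ennreal e) F"
  shows "(f \<longlongrightarrow> 0) F"
proof (rule order_tendstoI)
  fix a :: ennreal assume "0 < a"
  then obtain c where c: "0 < c" "c < a" using dense by blast
  then obtain e where "c = ennreal e" "0 \<le> e" by (cases c) auto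
  with c have "0 < e" "ennreal e < a" by auto
  then show "eventually (\<lambda>x. f x < a) F"
    using assms[of e] by (auto elim!: eventually_mono)
qed simp

text \<open>Continuity is phrased along sequences because the case of an open set is settled by
  dominated convergence.\<close>

definition L1_translation :: "('a::euclidean_space \<Rightarrow> real) \<Rightarrow> bool" where
  "L1_translation f \<longleftrightarrow>
     (\<forall>h. h \<longlonglongrightarrow> 0 \<longrightarrow> (\<lambda>n::nat. \<integral>\<^sup>+x. ennreal \<bar>f (x - h n) - f x\<bar> \<partial>lborel) \<longlonglongrightarrow> 0)"

text \<open>Three-term estimate: by translation invariance the distance between the translates of
  \<open>f\<close> and \<open>g\<close> equals the distance between \<open>f\<close> and
  \<open>g\<close>.\<close>

lemma L1_translation_closure:
  fixes f :: "'a::euclidean_space \<Rightarrow> real"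
  assumes f [measurable]: "f \<in> borel_measurable borel"
    and approx: "\<And>e::real. 0 < e \<Longrightarrow> \<exists>g \<in> borel_measurable borel. L1_translation g \<and>
      (\<integral>\<^sup>+x. ennreal \<bar>f x - g x\<bar> \<partial>lborel) \<le> ennreal e"
  shows "L1_translation f"
  unfolding L1_translation_def
proof (intro allI impI tendsto_0_ennrealI)
  fix h :: "nat \<Rightarrow> 'a" and e :: real assume h: "h \<longlonglongrightarrow> 0" and e: "0 < e"
  obtain g where g [measurable]: "g \<in> borel_measurable borel" and Pg: "L1_translation g"
    and fg: "(\<integral>\<^sup>+x. ennreal \<bar>f x - g x\<bar> \<partial>lborel) \<le> ennreal (e / 4)"
    using approx[of "e / 4"] e by auto
  have "eventually (\<lambda>n. (\<integral>\<^sup>+x. ennreal \<bar>g (x - h n) - g x\<bar> \<partial>lborel) < ennreal (e / 4)) sequentially"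
    using Pg h e by (intro order_tendstoD(2)[of _ 0]) (auto simp: L1_translation_def)
  then show "eventually (\<lambda>n. (\<integral>\<^sup>+x. ennreal \<bar>f (x - h n) - f x\<bar> \<partial>lborel) < ennreal e) sequentially"
  proof eventually_elim
    case (elim n)
    have "(\<integral>\<^sup>+x. ennreal \<bar>f (x - h n) - f x\<bar> \<partial>lborel) \<le>
        (\<integral>\<^sup>+x. (ennreal \<bar>f (x - h n) - g (x - h n)\<bar> + ennreal \<bar>g (x - h n) - g x\<bar>) +
          ennreal \<bar>f x - g x\<bar> \<partial>lborel)"
      by (intro nn_integral_mono) (simp flip: ennreal_plus)
    also have "\<dots> = (\<integral>\<^sup>+x. ennreal \<bar>f (x - h n) - g (x - h n)\<bar> \<partial>lborel) +
        (\<integral>\<^sup>+x. ennreal \<bar>g (x - h n) - g x\<bar> \<partial>lborel) + (\<integral>\<^sup>+x. ennreal \<bar>f x - g x\<bar> \<partial>lborel)"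
      by (simp add: nn_integral_add)
    also have "\<dots> = (\<integral>\<^sup>+x. ennreal \<bar>f x - g x\<bar> \<partial>lborel) +
        (\<integral>\<^sup>+x. ennreal \<bar>g (x - h n) - g x\<bar> \<partial>lborel) + (\<integral>\<^sup>+x. ennreal \<bar>f x - g x\<bar> \<partial>lborel)"
      by (subst nn_integral_translate_diff[of "\<lambda>x. ennreal \<bar>f x - g x\<bar>"]) auto
    also have "\<dots> \<le> ennreal (e / 4) + ennreal (e / 4) + ennreal (e / 4)"
      using fg elim by (intro add_mono) auto
    also have "\<dots> < ennreal e" using e by (simp add: ennreal_less_iff flip: ennreal_plus)
    finally show ?case .
  qed
qed

text \<open>The indicator and its translate have the same integral, so the integral of their
  distance is twice that of the positive part of the difference. That part vanishes off
  \<open>U\<close>, and at a point of \<open>U\<close> it is eventually zero because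
  \<open>U\<close> is open. Thus nothing has to be said about the boundary of \<open>U\<close>,
  which may have positive measure.\<close>

lemma L1_translation_open:
  fixes U :: "'a::euclidean_space set" and c :: real
  assumes U: "open U" "emeasure lborel U < \<infinity>"
  shows "L1_translation (\<lambda>x. indicator U x * c)"
  unfolding L1_translation_def
proof (intro allI impI)
  fix h :: "nat \<Rightarrow> 'a" assume h: "h \<longlonglongrightarrow> 0"
  let ?i = "indicator U :: 'a \<Rightarrow> real"
  have [measurable]: "U \<in> sets borel" using U(1) by simp
  have int: "integrable lborel ?i" using U by simp
  have int': "integrable lborel (\<lambda>x. ?i (x - a))" for a
    using int by (auto simp: integrable_iff_bounded nn_integral_translate_diff[of "\<lambda>x. ennreal (?i x)"] simp del: ennreal_indicator nn_integral_indicator)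
  have intm: "integrable lborel (\<lambda>x. max (?i x - ?i (x - a)) 0)" for a
    by (rule Bochner_Integration.integrable_bound[OF int]) (auto split: split_indicator)
  have eq: "(\<integral>\<^sup>+x. ennreal \<bar>?i (x - a) * c - ?i x * c\<bar> \<partial>lborel) =
      ennreal (\<bar>c\<bar> * (2 * (LINT x|lborel. max (?i x - ?i (x - a)) 0)))" for a
  proof -
    have I: "(LINT x|lborel. ?i (x - a)) = (LINT x|lborel. ?i x)"
    proof -
      have "ennreal (LINT x|lborel. ?i (x - a)) = ennreal (LINT x|lborel. ?i x)"
        using nn_integral_translate_diff[of "\<lambda>x. ennreal (?i x)" a] int int'
        by (simp add: nn_integral_eq_integral del: ennreal_indicator nn_integral_indicator)
      then show ?thesis by (simp add: ennreal_inj integral_nonneg)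
    qed
    have "\<bar>?i (x - a) * c - ?i x * c\<bar> =
        \<bar>c\<bar> * (2 * max (?i x - ?i (x - a)) 0 + ?i (x - a) - ?i x)" for x
      by (auto split: split_indicator)
    then have "(\<integral>\<^sup>+x. ennreal \<bar>?i (x - a) * c - ?i x * c\<bar> \<partial>lborel) =
      (\<integral>\<^sup>+x. ennreal (\<bar>c\<bar> * (2 * max (?i x - ?i (x - a)) 0 + ?i (x - a) - ?i x)) \<partial>lborel)"
      by presburger
    also have "\<dots> = ennreal (LINT x|lborel. \<bar>c\<bar> * (2 * max (?i x - ?i (x - a)) 0 + ?i (x - a) - ?i x))"
    proof (rule nn_integral_eq_integral)
      show "integrable lborel (\<lambda>x. \<bar>c\<bar> * (2 * max (?i x - ?i (x - a)) 0 + ?i (x - a) - ?i x))"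
        using int int'[of a] intm[of a] by simp
      show "AE x in lborel. 0 \<le> \<bar>c\<bar> * (2 * max (?i x - ?i (x - a)) 0 + ?i (x - a) - ?i x)"
        by (auto split: split_indicator)
    qed
    also have "(LINT x|lborel. \<bar>c\<bar> * (2 * max (?i x - ?i (x - a)) 0 + ?i (x - a) - ?i x)) =
      \<bar>c\<bar> * (2 * (LINT x|lborel. max (?i x - ?i (x - a)) 0))"
      using int int'[of a] intm[of a] I by simp
    finally show ?thesis .
  qed
  have "(\<lambda>n. LINT x|lborel. max (?i x - ?i (x - h n)) 0) \<longlonglongrightarrow> (LINT x|(lborel::'a measure). (0::real))"
  proof (rule integral_dominated_convergence[where w="?i"])
    show "AE x in lborel. (\<lambda>n. max (?i x - ?i (x - h n)) 0) \<longlonglongrightarrow> 0"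
    proof (rule AE_I2)
      fix x
      show "(\<lambda>n. max (?i x - ?i (x - h n)) 0) \<longlonglongrightarrow> 0"
      proof (cases "x \<in> U")
        case True
        have "(\<lambda>n. x - h n) \<longlonglongrightarrow> x - 0" by (intro tendsto_intros h)
        then have "eventually (\<lambda>n. x - h n \<in> U) sequentially"
          using True U(1) by (intro topological_tendstoD[of _ x]) auto
        then have "eventually (\<lambda>n. max (?i x - ?i (x - h n)) 0 = 0) sequentially"
          by eventually_elim (use True in simp)
        then show ?thesis by (rule tendsto_eventually)
      next
        case False
        then have "(\<lambda>n. max (?i x - ?i (x - h n)) 0) = (\<lambda>n. 0)"
          by (auto split: split_indicator)
        then show ?thesis by simp
      qed
    qed
  qed (use int in \<open>auto split: split_indicator\<close>)
  then have "(\<lambda>n. ennreal (\<bar>c\<bar> * (2 * (LINT x|lborel. max (?i x - ?i (x - h n)) 0)))) \<longlonglongrightarrow> ennreal (\<bar>c\<bar> * (2 * 0))"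
    by (intro tendsto_ennrealI tendsto_intros) simp
  then show "(\<lambda>n. \<integral>\<^sup>+x. ennreal \<bar>?i (x - h n) * c - ?i x * c\<bar> \<partial>lborel) \<longlonglongrightarrow> 0"
    unfolding eq by simp
qed

text \<open>Outer regularity replaces a measurable set by an open one; sums and limits are handled
  by the triangle inequality and by \<open>L1_translation_closure\<close>.\<close>

lemma L1_translation_integrable:
  fixes f :: "'a::euclidean_space \<Rightarrow> real"
  assumes "integrable lborel f"
  shows "L1_translation f"
  using assms
proof (induction rule: integrable_induct)
  case (base A c)
  then have A [measurable]: "A \<in> sets borel" by simp
  show ?case
  proof (rule L1_translation_closure)
    fix e :: real assume e: "0 < e"
    \<comment> \<open>The added 1 keeps the quotient meaningful for \<open>c = 0\<close> while still
      giving \<open>\<bar>c\<bar> * d \<le> e\<close>.\<close>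
    define d where "d = e / (\<bar>c\<bar> + 1)"
    have d: "0 < d" "\<bar>c\<bar> * d \<le> e" using e by (auto simp: d_def divide_simps algebra_simps)
    obtain U where U: "open U" "A \<subseteq> U" "emeasure lborel (U - A) < ennreal d"
      using outer_regular_lborel[OF A d(1)] by metis
    have [measurable]: "U \<in> sets borel" using U(1) by simp
    have "emeasure lborel U = emeasure lborel A + emeasure lborel (U - A)"
      using U(2) by (subst plus_emeasure) (auto simp: Un_absorb1)
    also have "\<dots> < \<infinity>" using U(3) base(2) by (auto simp: less_top[symmetric])
    finally have "L1_translation (\<lambda>x. indicator U x * c)" using U(1) by (intro L1_translation_open)
    moreover have "(\<integral>\<^sup>+x. ennreal \<bar>indicator A x *\<^sub>R c - indicator U x * c\<bar> \<partial>lborel) \<le> ennreal e"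
    proof -
      have "(\<integral>\<^sup>+x. ennreal \<bar>indicator A x *\<^sub>R c - indicator U x * c\<bar> \<partial>lborel) =
          (\<integral>\<^sup>+x. ennreal \<bar>c\<bar> * indicator (U - A) x \<partial>lborel)"
        using U(2) by (intro nn_integral_cong) (auto split: split_indicator)
      also have "\<dots> = ennreal \<bar>c\<bar> * emeasure lborel (U - A)"
        by (simp add: nn_integral_cmult)
      also have "\<dots> \<le> ennreal \<bar>c\<bar> * ennreal d" using U(3) by (intro mult_left_mono) auto
      also have "\<dots> \<le> ennreal e" using d by (simp add: ennreal_leI flip: ennreal_mult')
      finally show ?thesis .
    qed
    ultimately show "\<exists>g\<in>borel_measurable borel. L1_translation g \<and>
        (\<integral>\<^sup>+x. ennreal \<bar>indicator A x *\<^sub>R c - g x\<bar> \<partial>lborel) \<le> ennreal e"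
      by (intro bexI[of _ "\<lambda>x. indicator U x * c"]) auto
  qed simp
next
  case (add f g)
  then have [measurable]: "f \<in> borel_measurable borel" "g \<in> borel_measurable borel" by auto
  show ?case unfolding L1_translation_def
  proof (intro allI impI)
    fix h :: "nat \<Rightarrow> 'a" assume h: "h \<longlonglongrightarrow> 0"
    let ?N = "\<lambda>f n. \<integral>\<^sup>+x. ennreal \<bar>f (x - h n) - f x\<bar> \<partial>lborel"
    have "(\<lambda>n. ?N f n + ?N g n) \<longlonglongrightarrow> 0 + 0"
      using add.IH h by (intro tendsto_add) (auto simp: L1_translation_def)
    moreover have "?N (\<lambda>x. f x + g x) n \<le> ?N f n + ?N g n" for n
    proof -
      have "?N (\<lambda>x. f x + g x) n \<le>
        (\<integral>\<^sup>+x. ennreal \<bar>f (x - h n) - f x\<bar> + ennreal \<bar>g (x - h n) - g x\<bar> \<partial>lborel)"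
        by (intro nn_integral_mono) (simp flip: ennreal_plus)
      also have "\<dots> = ?N f n + ?N g n" by (rule nn_integral_add) auto
      finally show ?thesis .
    qed
    ultimately show "?N (\<lambda>x. f x + g x) \<longlonglongrightarrow> 0"
      by (intro tendsto_sandwich[of "\<lambda>_. 0" "?N (\<lambda>x. f x + g x)" sequentially "\<lambda>n. ?N f n + ?N g n"]) auto
  qed
next
  case (lim f s)
  then have [measurable]: "f \<in> borel_measurable borel" "\<And>i. s i \<in> borel_measurable borel" by auto
  have L: "(\<lambda>i. \<integral>\<^sup>+x. norm (f x - s i x) \<partial>lborel) \<longlonglongrightarrow> 0"
  proof (rule nn_integral_dominated_convergence_norm[where w="\<lambda>x. 2 * norm (f x)"])
    show "(\<integral>\<^sup>+x. ennreal (2 * norm (f x)) \<partial>lborel) < \<infinity>"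
      using lim.hyps(4) by (simp add: integrable_iff_bounded ennreal_mult nn_integral_cmult ennreal_mult_less_top)
  qed (use lim in auto)
  show ?case
  proof (rule L1_translation_closure)
    fix e :: real assume "0 < e"
    then have "eventually (\<lambda>i. (\<integral>\<^sup>+x. norm (f x - s i x) \<partial>lborel) < ennreal e) sequentially"
      using L by (intro order_tendstoD(2)[of _ 0]) auto
    then obtain i where "(\<integral>\<^sup>+x. norm (f x - s i x) \<partial>lborel) < ennreal e"
      by (auto simp: eventually_sequentially)
    then show "\<exists>g\<in>borel_measurable borel. L1_translation g \<and>
        (\<integral>\<^sup>+x. ennreal \<bar>f x - g x\<bar> \<partial>lborel) \<le> ennreal e"
      using lim.IH by (intro bexI[of _ "s i"]) auto
  qed simp
qed

text \<open>The map sending t to t * |t| turns square integrable functions into integrable ones, so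
  with this inequality continuity of translations in L2 follows from that in L1. For equal signs it
  holds since |a - b| is at most |a + b|, for opposite signs since the square of a - b is at most
  twice the sum of the squares.\<close>

lemma power2_diff_le_signed_squares: "(a - b)\<^sup>2 \<le> 2 * \<bar>a * \<bar>a\<bar> - b * \<bar>b\<bar>\<bar>" for a b :: real
proof -
  have *: "(a - b)\<^sup>2 \<le> 2 * \<bar>a * \<bar>a\<bar> - b * \<bar>b\<bar>\<bar>" if "b \<le> a" for a b :: real
  proof (cases "0 \<le> b")
    case True
    then have "(a - b) * (a - b) \<le> (a - b) * (a + b)" using that by (intro mult_left_mono) auto
    moreover have "0 \<le> (a - b) * (a + b)" using True that by simp
    ultimately show ?thesis using True that by (simp add: power2_eq_square algebra_simps)
  next
    case b: False
    show ?thesis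
    proof (cases "a \<le> 0")
      case True
      have "(a - b) * (a - b) \<le> (a - b) * (- a - b)" using that True b by (intro mult_left_mono) auto
      moreover have "0 \<le> (a - b) * (- a - b)" using True that b by (intro mult_nonneg_nonneg) auto
      ultimately show ?thesis using True that b by (simp add: power2_eq_square algebra_simps)
    next
      case False
      have "0 \<le> (a + b)\<^sup>2" by simp
      then have "(a - b)\<^sup>2 \<le> 2 * (a\<^sup>2 + b\<^sup>2)" by (simp add: power2_eq_square algebra_simps)
      then show ?thesis using False b by (simp add: power2_eq_square)
    qed
  qed
  show ?thesis
    using *[of a b] *[of b a] by (cases "b \<le> a") (auto simp: power2_commute abs_minus_commute)
qed

lemma L2_translation:
  fixes f :: "'a::euclidean_space \<Rightarrow> real"
  assumes [measurable]: "f \<in> borel_measurable borel" and "integrable lborel (\<lambda>x. (f x)\<^sup>2)"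
    and e: "0 < (e::real)"
  shows "\<exists>d>0. \<forall>h. norm h < d \<longrightarrow> (\<integral>\<^sup>+x. ennreal ((f (x - h) - f x)\<^sup>2) \<partial>lborel) \<le> ennreal e"
proof (rule ccontr)
  assume "\<not> ?thesis"
  then have "\<exists>h. norm h < inverse (real (Suc n)) \<and>
      \<not> (\<integral>\<^sup>+x. ennreal ((f (x - h) - f x)\<^sup>2) \<partial>lborel) \<le> ennreal e" for n
    by (metis inverse_positive_iff_positive of_nat_0_less_iff zero_less_Suc)
  then obtain h where h: "\<And>n. norm (h n) < inverse (real (Suc n))"
    and N: "\<And>n. \<not> (\<integral>\<^sup>+x. ennreal ((f (x - h n) - f x)\<^sup>2) \<partial>lborel) \<le> ennreal e"
    by metis
  have "h \<longlonglongrightarrow> 0"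
    by (rule Lim_null_comparison[OF _ LIMSEQ_inverse_real_of_nat]) (rule always_eventually, rule allI, rule less_imp_le, rule h)
  moreover define g where "g x = f x * \<bar>f x\<bar>" for x
  have [measurable]: "g \<in> borel_measurable borel" unfolding g_def by measurable
  have "integrable lborel g"
    by (rule Bochner_Integration.integrable_bound[OF assms(2)]) (auto simp: g_def abs_mult power2_eq_square)
  then have "L1_translation g" by (rule L1_translation_integrable)
  ultimately have "(\<lambda>n. \<integral>\<^sup>+x. ennreal \<bar>g (x - h n) - g x\<bar> \<partial>lborel) \<longlonglongrightarrow> 0"
    unfolding L1_translation_def by blast
  then have "eventually (\<lambda>n. (\<integral>\<^sup>+x. ennreal \<bar>g (x - h n) - g x\<bar> \<partial>lborel) < ennreal (e / 2)) sequentially"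
    using e by (intro order_tendstoD(2)[of _ 0]) auto
  then obtain n where n: "(\<integral>\<^sup>+x. ennreal \<bar>g (x - h n) - g x\<bar> \<partial>lborel) < ennreal (e / 2)"
    by (auto simp: eventually_sequentially)
  have "(\<integral>\<^sup>+x. ennreal ((f (x - h n) - f x)\<^sup>2) \<partial>lborel) \<le>
      (\<integral>\<^sup>+x. ennreal 2 * ennreal \<bar>g (x - h n) - g x\<bar> \<partial>lborel)"
  proof (rule nn_integral_mono)
    fix x
    show "ennreal ((f (x - h n) - f x)\<^sup>2) \<le> ennreal 2 * ennreal \<bar>g (x - h n) - g x\<bar>"
      using power2_diff_le_signed_squares[of "f (x - h n)" "f x"]
      by (subst ennreal_mult[symmetric]) (auto simp: g_def intro!: ennreal_leI)
  qed
  also have "\<dots> = ennreal 2 * (\<integral>\<^sup>+x. ennreal \<bar>g (x - h n) - g x\<bar> \<partial>lborel)"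
    by (rule nn_integral_cmult) simp
  also have "\<dots> \<le> ennreal 2 * ennreal (e / 2)" using n by (intro mult_left_mono) auto
  also have "\<dots> = ennreal e" using e by (subst ennreal_mult[symmetric]) auto
  finally show False using N[of n] by blast
qed

section \<open>The kernel and Lipschitz multipliers\<close>

text \<open>The numerator is, up to a constant, the bound on the squared increment over
  \<open>h\<close> of a bounded Lipschitz function. Dividing by the Gagliardo weight gives a kernel
  that is integrable on the whole space. At \<open>h = 0\<close> the value is 0 / 0 = 0.\<close>

definition truncated_kernel :: "real \<Rightarrow> 'a::euclidean_space \<Rightarrow> real" where
  "truncated_kernel s h = min 1 ((norm h)\<^sup>2) / norm h powr (real DIM('a) + 2 * s)"

lemma measurable_truncated_kernel [measurable]: "truncated_kernel s \<in> borel_measurable borel"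
  unfolding truncated_kernel_def by measurable

lemma truncated_kernel_nonneg: "0 \<le> truncated_kernel s h"
  by (simp add: truncated_kernel_def)

text \<open>With n = DIM('a), the shell lies in a ball whose volume is of order r to the power n;
  against the denominator of order r to the power n + 2 s this leaves
  \<open>r powr (- 2 * s)\<close>.\<close>

lemma truncated_kernel_shell:
  fixes r s :: real
  assumes r: "0 < r" and s: "0 < s"
  shows "(\<integral>\<^sup>+(h::'a::euclidean_space). ennreal (truncated_kernel s h) * indicator {h. r \<le> norm h \<and> norm h \<le> 2 * r} h \<partial>lborel)
    \<le> ennreal (unit_ball_vol (real DIM('a)) * 2 ^ DIM('a) * min 1 (4 * r\<^sup>2) * r powr (- 2 * s))"
proof -
  let ?c = "min 1 (4 * r\<^sup>2) / r powr (real DIM('a) + 2 * s)"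
  have "(\<integral>\<^sup>+(h::'a). ennreal (truncated_kernel s h) * indicator {h. r \<le> norm h \<and> norm h \<le> 2 * r} h \<partial>lborel) \<le>
      (\<integral>\<^sup>+(h::'a). ennreal ?c * indicator (cball 0 (2 * r)) h \<partial>lborel)"
  proof (rule nn_integral_mono)
    fix h :: 'a
    show "ennreal (truncated_kernel s h) * indicator {h. r \<le> norm h \<and> norm h \<le> 2 * r} h \<le>
        ennreal ?c * indicator (cball 0 (2 * r)) h"
    proof (cases "r \<le> norm h \<and> norm h \<le> 2 * r")
      case True
      have "(norm h)\<^sup>2 \<le> (2 * r)\<^sup>2" using True by (intro power_mono) auto
      then have "min 1 ((norm h)\<^sup>2) \<le> min 1 (4 * r\<^sup>2)" by (simp add: power_mult_distrib)
      moreover have "r powr (real DIM('a) + 2 * s) \<le> norm h powr (real DIM('a) + 2 * s)"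
        using True r s by (intro powr_mono2) auto
      ultimately have "truncated_kernel s h \<le> ?c"
        unfolding truncated_kernel_def using r by (intro frac_le) auto
      then show ?thesis using True by (auto intro: ennreal_leI)
    qed auto
  qed
  also have "\<dots> = ennreal ?c * ennreal (unit_ball_vol (real DIM('a)) * (2 * r) ^ DIM('a))"
    using r by (subst nn_integral_cmult_indicator) (simp_all add: emeasure_cball)
  also have "\<dots> = ennreal (?c * (unit_ball_vol (real DIM('a)) * (2 * r) ^ DIM('a)))"
    using r by (subst ennreal_mult) auto
  also have "?c * (unit_ball_vol (real DIM('a)) * (2 * r) ^ DIM('a)) =
      unit_ball_vol (real DIM('a)) * 2 ^ DIM('a) * min 1 (4 * r\<^sup>2) * (r ^ DIM('a) / r powr (real DIM('a) + 2 * s))"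
    by (simp add: power_mult_distrib)
  also have "r ^ DIM('a) / r powr (real DIM('a) + 2 * s) = r powr (- 2 * s)"
    using r by (simp add: powr_diff[symmetric] flip: powr_realpow)
  finally show ?thesis .
qed

lemma ex_power2_interval:
  fixes x :: real
  assumes "1 \<le> x"
  shows "\<exists>j::nat. 2 ^ j \<le> x \<and> x \<le> 2 * 2 ^ j"
proof -
  obtain n :: nat where n: "x < 2 ^ n" using real_arch_pow[of 2 x] by auto
  define j where "j = (LEAST n. x < (2::real) ^ n)"
  have j: "x < 2 ^ j" unfolding j_def by (rule LeastI[of _ n]) (rule n)
  then obtain i where i: "j = Suc i" using assms by (cases j) auto
  then have "\<not> x < 2 ^ i" using not_less_Least[of i "\<lambda>n. x < (2::real) ^ n"] unfolding j_def by auto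
  with i j show ?thesis by (intro exI[of _ i]) auto
qed

lemma nn_integral_shells_finite:
  fixes f :: "'a \<Rightarrow> ennreal" and q C :: real
  assumes "\<And>j::nat. (\<lambda>x. f x * indicator (A j) x) \<in> borel_measurable M"
    and "\<And>j. (\<integral>\<^sup>+x. f x * indicator (A j) x \<partial>M) \<le> ennreal (C * q ^ j)"
    and "0 \<le> C" "0 \<le> q" "q < 1"
  shows "(\<integral>\<^sup>+x. (\<Sum>j. f x * indicator (A j) x) \<partial>M) < \<infinity>"
proof -
  have "(\<integral>\<^sup>+x. (\<Sum>j. f x * indicator (A j) x) \<partial>M) = (\<Sum>j. \<integral>\<^sup>+x. f x * indicator (A j) x \<partial>M)"
    using assms(1) by (rule nn_integral_suminf)
  also have "\<dots> \<le> (\<Sum>j. ennreal (C * q ^ j))" using assms(2) by (intro suminf_le) auto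
  also have "\<dots> = ennreal (\<Sum>j. C * q ^ j)"
    using assms by (intro suminf_ennreal2 summable_mult summable_geometric) auto
  also have "\<dots> < \<infinity>" by simp
  finally show ?thesis .
qed

text \<open>The space without the origin is covered by dyadic shells. Outside the unit ball the
  shell integrals decay geometrically with ratio \<open>2 powr (- 2 * s)\<close>, which needs
  \<open>0 < s\<close>; inside, the numerator contributes the square of the radius and the ratio is
  \<open>(1/2) powr (2 - 2 * s)\<close>, which needs \<open>s < 1\<close>.\<close>

lemma truncated_kernel_integrable:
  assumes s: "0 < s" "s < 1"
  shows "(\<integral>\<^sup>+(h::'a::euclidean_space). ennreal (truncated_kernel s h) \<partial>lborel) < \<infinity>"
proof -
  let ?A = "\<lambda>r. {h::'a. r \<le> norm h \<and> norm h \<le> 2 * r}"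
  let ?V = "unit_ball_vol (real DIM('a)) * 2 ^ DIM('a)"
  let ?k = "\<lambda>h::'a. ennreal (truncated_kernel s h)"
  have V: "0 \<le> ?V" by simp
  have "(\<integral>\<^sup>+h. (\<Sum>j. ?k h * indicator (?A (2 ^ j)) h) \<partial>lborel) < \<infinity>"
  proof (rule nn_integral_shells_finite[where C="?V" and q="2 powr (- 2 * s)"])
    show "(\<integral>\<^sup>+h. ?k h * indicator (?A (2 ^ j)) h \<partial>lborel) \<le> ennreal (?V * (2 powr (- 2 * s)) ^ j)" for j :: nat
    proof -
      have "(1::real) \<le> (2 ^ j)\<^sup>2" by (intro one_le_power) simp
      then have "min 1 (4 * (2 ^ j)\<^sup>2) = (1::real)" by (intro min_absorb1) linarith
      note min_eq = this
      have powr_eq: "(2 ^ j) powr (- 2 * s) = (2 powr (- 2 * s)) ^ j"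
        by (simp add: powr_powr powr_realpow[symmetric] mult.commute)
      have "0 < (2::real) ^ j" by simp
      from truncated_kernel_shell[OF this s(1), where 'a='a]
      show ?thesis unfolding min_eq powr_eq by (simp only: mult_1_right)
    qed
    show "2 powr (- 2 * s) < 1" using s powr_less_mono[of "- 2 * s" 0 2] by simp
  qed (use V in auto)
  moreover have "(\<integral>\<^sup>+h. (\<Sum>j. ?k h * indicator (?A (1 / (2 * 2 ^ j))) h) \<partial>lborel) < \<infinity>"
  \<comment> \<open>The radius of the inner shell is \<open>(1/2) ^ Suc j\<close>, which accounts
    for the extra power of the ratio in the constant; the 4 comes from the numerator bound
    \<open>4 * r\<^sup>2\<close>.\<close>
  proof (rule nn_integral_shells_finite[where C="?V * 4 * (1/2) powr (2 - 2 * s)" and q="(1/2) powr (2 - 2 * s)"])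
    show "(\<integral>\<^sup>+h. ?k h * indicator (?A (1 / (2 * 2 ^ j))) h \<partial>lborel) \<le>
        ennreal (?V * 4 * (1/2) powr (2 - 2 * s) * ((1/2) powr (2 - 2 * s)) ^ j)" for j :: nat
    proof -
      let ?r = "(1/2::real) ^ Suc j"
      have r: "1 / (2 * 2 ^ j) = ?r" by (simp add: power_divide)
      have "?r\<^sup>2 * ?r powr (- 2 * s) = ?r powr (2 - 2 * s)"
        by (simp add: powr_diff powr_minus divide_simps powr_realpow del: power_Suc)
      also have "\<dots> = ((1/2) powr (2 - 2 * s)) ^ Suc j"
        by (simp add: powr_powr powr_realpow[symmetric] mult.commute del: power_Suc)
      finally have e: "?r\<^sup>2 * ?r powr (- 2 * s) = ((1/2) powr (2 - 2 * s)) ^ Suc j" .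
      have "?V * min 1 (4 * ?r\<^sup>2) * ?r powr (- 2 * s) \<le> ?V * (4 * ?r\<^sup>2) * ?r powr (- 2 * s)"
        by (intro mult_right_mono mult_left_mono) auto
      also have "\<dots> = ?V * 4 * (?r\<^sup>2 * ?r powr (- 2 * s))" by (simp del: power_Suc)
      finally have "?V * min 1 (4 * ?r\<^sup>2) * ?r powr (- 2 * s) \<le> ?V * 4 * (1/2) powr (2 - 2 * s) * ((1/2) powr (2 - 2 * s)) ^ j"
        unfolding e by simp
      moreover have "0 < ?r" by simp
      ultimately show ?thesis unfolding r
        using order_trans[OF truncated_kernel_shell[of ?r s, where 'a='a] ennreal_leI] s(1) by blast
    qed
    show "(1/2) powr (2 - 2 * s) < 1" using s powr01_less_one[of "1/2" "2 - 2 * s"] by simp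
  qed (use V in auto)
  ultimately have "(\<integral>\<^sup>+h. (\<Sum>j. ?k h * indicator (?A (2 ^ j)) h) \<partial>lborel) +
      (\<integral>\<^sup>+h. (\<Sum>j. ?k h * indicator (?A (1 / (2 * 2 ^ j))) h) \<partial>lborel) < \<infinity>" by simp
  also have "(\<integral>\<^sup>+h. (\<Sum>j. ?k h * indicator (?A (2 ^ j)) h) \<partial>lborel) +
      (\<integral>\<^sup>+h. (\<Sum>j. ?k h * indicator (?A (1 / (2 * 2 ^ j))) h) \<partial>lborel) =
      (\<integral>\<^sup>+h. (\<Sum>j. ?k h * indicator (?A (2 ^ j)) h) + (\<Sum>j. ?k h * indicator (?A (1 / (2 * 2 ^ j))) h) \<partial>lborel)"
    by (subst nn_integral_add) auto
  finally have fin: "\<dots> < \<infinity>" .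
  have "?k h \<le> (\<Sum>j. ?k h * indicator (?A (2 ^ j)) h) + (\<Sum>j. ?k h * indicator (?A (1 / (2 * 2 ^ j))) h)" for h
  proof -
    consider "h = 0" | "1 \<le> norm h" | "h \<noteq> 0" "norm h \<le> 1" by linarith
    then show ?thesis
    proof cases
      case 1
      then show ?thesis by (simp add: truncated_kernel_def)
    next
      case 2
      then obtain j where "h \<in> ?A (2 ^ j)" using ex_power2_interval by blast
      then have "?k h = (\<Sum>i\<in>{j}. ?k h * indicator (?A (2 ^ i)) h)" by simp
      also have "\<dots> \<le> (\<Sum>i. ?k h * indicator (?A (2 ^ i)) h)" by (intro sum_le_suminf) auto
      finally show ?thesis by (simp add: add_increasing2)
    next
      case 3
      then have "1 \<le> 1 / norm h" by simp
      then obtain j where "2 ^ j \<le> 1 / norm h" "1 / norm h \<le> 2 * 2 ^ j" using ex_power2_interval by blast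
      then have "h \<in> ?A (1 / (2 * 2 ^ j))" using 3 by (auto simp: field_simps)
      then have "?k h = (\<Sum>i\<in>{j}. ?k h * indicator (?A (1 / (2 * 2 ^ i))) h)" by simp
      also have "\<dots> \<le> (\<Sum>i. ?k h * indicator (?A (1 / (2 * 2 ^ i))) h)" by (intro sum_le_suminf) auto
      finally show ?thesis by (simp add: add_increasing)
    qed
  qed
  then show ?thesis using fin by (rule le_less_trans[OF nn_integral_mono])
qed

lemma nn_integral_weighted_kernel:
  fixes a :: "'a::euclidean_space \<Rightarrow> real"
  assumes s: "0 < s" "s < 1" and a: "integrable lborel a" "\<And>x. 0 \<le> a x"
  shows "(\<integral>\<^sup>+z. ennreal (truncated_kernel s (fst z - snd z) * a (fst z)) \<partial>lborel) < \<infinity>"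
    and "(\<integral>\<^sup>+z. ennreal (truncated_kernel s (fst z - snd z) * a (snd z)) \<partial>lborel) < \<infinity>"
proof -
  have [measurable]: "a \<in> borel_measurable borel" using a by auto
  let ?K = "\<integral>\<^sup>+(h::'a). ennreal (truncated_kernel s h) \<partial>lborel"
  have fin: "?K * (\<integral>\<^sup>+x. ennreal (a x) \<partial>lborel) < \<infinity>"
    using truncated_kernel_integrable[OF s, where 'a='a] a by (simp add: ennreal_mult_less_top integrable_iff_bounded)
  have "(\<integral>\<^sup>+z. ennreal (truncated_kernel s (fst z - snd z) * a (fst z)) \<partial>lborel) =
      (\<integral>\<^sup>+x. \<integral>\<^sup>+y. ennreal (truncated_kernel s (x - y) * a x) \<partial>lborel \<partial>lborel)"
    unfolding lborel_prod[symmetric] by (subst lborel.nn_integral_fst[symmetric]) auto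
  also have "\<dots> = (\<integral>\<^sup>+x. ?K * ennreal (a x) \<partial>lborel)"
    by (simp add: ennreal_mult truncated_kernel_nonneg a nn_integral_multc
        nn_integral_reflect[of "\<lambda>h. ennreal (truncated_kernel s h)"])
  also have "\<dots> = ?K * (\<integral>\<^sup>+x. ennreal (a x) \<partial>lborel)" by (rule nn_integral_cmult) simp
  finally show "(\<integral>\<^sup>+z. ennreal (truncated_kernel s (fst z - snd z) * a (fst z)) \<partial>lborel) < \<infinity>"
    using fin by simp
  have "(\<integral>\<^sup>+z. ennreal (truncated_kernel s (fst z - snd z) * a (snd z)) \<partial>lborel) =
      (\<integral>\<^sup>+y. \<integral>\<^sup>+x. ennreal (truncated_kernel s (x - y) * a y) \<partial>lborel \<partial>lborel)"
    unfolding lborel_prod[symmetric] by (subst lborel_pair.nn_integral_snd[symmetric]) auto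
  also have "\<dots> = (\<integral>\<^sup>+x. ?K * ennreal (a x) \<partial>lborel)"
    by (simp add: ennreal_mult truncated_kernel_nonneg a nn_integral_multc
        nn_integral_translate_diff[of "\<lambda>h. ennreal (truncated_kernel s h)"])
  also have "\<dots> = ?K * (\<integral>\<^sup>+x. ennreal (a x) \<partial>lborel)" by (rule nn_integral_cmult) simp
  finally show "(\<integral>\<^sup>+z. ennreal (truncated_kernel s (fst z - snd z) * a (snd z)) \<partial>lborel) < \<infinity>"
    using fin by simp
qed

text \<open>The hypothesis has the shape of a product rule: increments of a bounded Lipschitz
  factor, weighted by \<open>a\<close>, plus increments of a function \<open>v\<close> already of
  finite energy. By Tonelli the weighted part costs the integral of the truncated kernel times the
  integral of \<open>a\<close>.\<close>

lemma finite_energy_weighted: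
  fixes u :: "'a::euclidean_space \<Rightarrow> real"
  assumes s: "0 < s" "s < 1" and a: "integrable lborel a" "\<And>x. 0 \<le> a x"
    and u [measurable]: "u \<in> borel_measurable borel" and v: "finite_energy s v"
    and le: "\<And>x y. (u x - u y)\<^sup>2 \<le> min 1 ((norm (x - y))\<^sup>2) * (a x + a y) + (v x - v y)\<^sup>2"
  shows "finite_energy s u"
proof -
  have [measurable]: "a \<in> borel_measurable borel" "v \<in> borel_measurable borel"
    using a v by (auto dest: finite_energyD)
  have [measurable]: "(\<lambda>z. ennreal (truncated_kernel s (fst z - snd z) * a (fst z))) \<in> borel_measurable (borel :: ('a \<times> 'a) measure)"
      "(\<lambda>z. ennreal (truncated_kernel s (fst z - snd z) * a (snd z))) \<in> borel_measurable (borel :: ('a \<times> 'a) measure)"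
    unfolding borel_prod[symmetric] by measurable
  have "gagliardo_sq s u \<le> (\<integral>\<^sup>+z. ennreal (truncated_kernel s (fst z - snd z) * a (fst z)) +
      ennreal (truncated_kernel s (fst z - snd z) * a (snd z)) + ennreal ((quot s v z)\<^sup>2) \<partial>lborel)"
    unfolding gagliardo_sq_quot
  proof (rule nn_integral_mono)
    fix z :: "'a \<times> 'a"
    let ?p = "norm (fst z - snd z) powr (real DIM('a) + 2 * s)"
    have "(quot s u z)\<^sup>2 \<le> (min 1 ((norm (fst z - snd z))\<^sup>2) * (a (fst z) + a (snd z)) + (v (fst z) - v (snd z))\<^sup>2) / ?p"
      unfolding quot_power2 using le by (intro divide_right_mono) auto
    also have "\<dots> = truncated_kernel s (fst z - snd z) * a (fst z) +
        truncated_kernel s (fst z - snd z) * a (snd z) + (quot s v z)\<^sup>2"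
      unfolding quot_power2 truncated_kernel_def by (simp add: add_divide_distrib distrib_left)
    finally show "ennreal ((quot s u z)\<^sup>2) \<le> ennreal (truncated_kernel s (fst z - snd z) * a (fst z)) +
      ennreal (truncated_kernel s (fst z - snd z) * a (snd z)) + ennreal ((quot s v z)\<^sup>2)"
      using a(2) by (simp add: ennreal_leI truncated_kernel_nonneg flip: ennreal_plus)
  qed
  also have "\<dots> = (\<integral>\<^sup>+z. ennreal (truncated_kernel s (fst z - snd z) * a (fst z)) \<partial>lborel) +
      (\<integral>\<^sup>+z. ennreal (truncated_kernel s (fst z - snd z) * a (snd z)) \<partial>lborel) + gagliardo_sq s v"
    unfolding gagliardo_sq_quot by (simp add: nn_integral_add)
  also have "\<dots> < \<infinity>"
    using nn_integral_weighted_kernel[OF s a] v by (simp add: finite_energy_def)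
  finally show ?thesis by (simp add: finite_energy_def)
qed

section \<open>Membership in the Sobolev spaces\<close>

lemma Hs_iff: "v \<in> Hs s \<longleftrightarrow> finite_energy s v \<and> integrable lborel (\<lambda>x. (v x)\<^sup>2)"
  by (auto simp: Hs_def finite_energy_def)

lemma Hs_finite_energy: "v \<in> Hs s \<Longrightarrow> finite_energy s v" by (simp add: Hs_iff)

lemma Hs_measurable [measurable_dest]: "v \<in> Hs s \<Longrightarrow> v \<in> borel_measurable borel"
  unfolding Hs_iff finite_energy_def by blast

lemma Hs_integrable_power2: "v \<in> Hs s \<Longrightarrow> integrable lborel (\<lambda>x. (v x)\<^sup>2)"
  by (simp add: Hs_iff)

lemma Hs_bound:
  assumes [measurable]: "u \<in> borel_measurable borel" and v: "v \<in> Hs s" "finite_energy s w"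
    and "\<And>x. \<bar>u x\<bar> \<le> \<bar>v x\<bar>"
    and "\<And>x y. \<bar>u x - u y\<bar> \<le> \<bar>v x - v y\<bar> + \<bar>w x - w y\<bar>"
  shows "u \<in> Hs s"
proof -
  have "finite_energy s u"
    by (rule finite_energy_bound[OF _ Hs_finite_energy[OF v(1)] v(2)]) (use assms in auto)
  moreover have "integrable lborel (\<lambda>x. (u x)\<^sup>2)"
    by (rule Bochner_Integration.integrable_bound[OF Hs_integrable_power2[OF v(1)]])
      (use assms(4) in \<open>auto simp: abs_le_square_iff\<close>)
  ultimately show ?thesis by (simp add: Hs_iff)
qed

lemma Hs_pos_part:
  assumes "v \<in> Hs s" shows "(\<lambda>x. max (v x) 0) \<in> Hs s"
proof -
  note Hs_measurable[OF assms, measurable]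
  show ?thesis by (rule Hs_bound[OF _ assms finite_energy_const[of s 0]]) auto
qed

lemma Hs_minus:
  assumes "v \<in> Hs s" shows "(\<lambda>x. - v x) \<in> Hs s"
proof -
  note Hs_measurable[OF assms, measurable]
  show ?thesis by (rule Hs_bound[OF _ assms finite_energy_const[of s 0]]) auto
qed

lemma Hs_add:
  assumes "u \<in> Hs s" "v \<in> Hs s" shows "(\<lambda>x. u x + v x) \<in> Hs s"
proof -
  note Hs_measurable[OF assms(1), measurable] Hs_measurable[OF assms(2), measurable]
  have "integrable lborel (\<lambda>x. (u x + v x)\<^sup>2)"
    by (rule integrable_power2_bound[where g=u and h=v]) (use assms in \<open>auto simp: Hs_iff\<close>)
  then show ?thesis using assms by (simp add: Hs_iff finite_energy_add)
qed

lemma Hs_diff: "u \<in> Hs s \<Longrightarrow> v \<in> Hs s \<Longrightarrow> (\<lambda>x. u x - v x) \<in> Hs s"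
  using Hs_add[of u s "\<lambda>x. - v x"] Hs_minus[of v s] by simp

lemma Hs0_D: "v \<in> Hs0 s D \<Longrightarrow> v \<in> Hs s" "v \<in> Hs0 s D \<Longrightarrow> AE x in lborel. x \<notin> D \<longrightarrow> v x = 0"
  by (auto simp: Hs0_def)

lemma Hs0_pos_part: "v \<in> Hs0 s D \<Longrightarrow> (\<lambda>x. max (v x) 0) \<in> Hs0 s D"
  unfolding Hs0_def by (auto intro: Hs_pos_part)

lemma Hs0_minus: "v \<in> Hs0 s D \<Longrightarrow> (\<lambda>x. - v x) \<in> Hs0 s D"
  unfolding Hs0_def by (auto intro: Hs_minus)

lemma Hs0_diff: "u \<in> Hs0 s D \<Longrightarrow> v \<in> Hs0 s D \<Longrightarrow> (\<lambda>x. u x - v x) \<in> Hs0 s D"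
  unfolding Hs0_def by (auto intro: Hs_diff)

lemma measurable_lipschitz:
  fixes \<eta> :: "'a::euclidean_space \<Rightarrow> real"
  assumes "\<And>x y. \<bar>\<eta> x - \<eta> y\<bar> \<le> L * norm (x - y)"
  shows "\<eta> \<in> borel_measurable borel"
proof -
  have "L-lipschitz_on UNIV \<eta>" if "0 \<le> L"
    using assms that by (auto simp: lipschitz_on_def dist_norm)
  moreover have "0 \<le> L"
  proof -
    obtain b :: 'a where "b \<in> Basis" using nonempty_Basis by blast
    then show ?thesis using order_trans[OF abs_ge_zero assms[of b 0]] by simp
  qed
  ultimately show ?thesis
    by (intro borel_measurable_continuous_onI) (rule lipschitz_on_continuous_on)
qed

lemma lipschitz_bounded_min:
  fixes \<eta> :: "'a::euclidean_space \<Rightarrow> real"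
  assumes lip: "\<And>x y. \<bar>\<eta> x - \<eta> y\<bar> \<le> L * norm (x - y)" and bd: "\<And>x. \<bar>\<eta> x\<bar> \<le> M"
  shows "(\<eta> x - \<eta> y)\<^sup>2 \<le> (L\<^sup>2 + 4 * M\<^sup>2) * min 1 ((norm (x - y))\<^sup>2)"
proof (cases "1 \<le> (norm (x - y))\<^sup>2")
  case True
  have "\<bar>\<eta> x - \<eta> y\<bar> \<le> 2 * M" using bd[of x] bd[of y] by linarith
  then have "\<bar>\<eta> x - \<eta> y\<bar>\<^sup>2 \<le> (2 * M)\<^sup>2" by (rule power_mono) simp
  then show ?thesis using True by (simp add: power_mult_distrib add_increasing)
next
  case False
  have "\<bar>\<eta> x - \<eta> y\<bar>\<^sup>2 \<le> (L * norm (x - y))\<^sup>2" by (rule power_mono[OF lip]) simp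
  then show ?thesis using False by (simp add: power_mult_distrib distrib_right add_increasing2)
qed

lemma Hs_lipschitz_mult:
  fixes u :: "'a::euclidean_space \<Rightarrow> real"
  assumes s: "0 < s" "s < 1" and u: "u \<in> Hs s"
    and lip: "\<And>x y. \<bar>\<eta> x - \<eta> y\<bar> \<le> L * norm (x - y)" and bd: "\<And>x. \<bar>\<eta> x\<bar> \<le> M"
  shows "(\<lambda>x. \<eta> x * u x) \<in> Hs s"
proof -
  note Hs_measurable[OF u, measurable] measurable_lipschitz[OF lip, measurable]
  have M: "0 \<le> M" using order_trans[OF abs_ge_zero bd] .
  let ?C = "L\<^sup>2 + 4 * M\<^sup>2"
  have iu: "integrable lborel (\<lambda>x. (u x)\<^sup>2)" using u by (rule Hs_integrable_power2)
  have "finite_energy s (\<lambda>x. \<eta> x * u x)"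
  \<comment> \<open>The increment of the product is split as
    \<open>\<eta> y * (u x - u y) + u x * (\<eta> x - \<eta> y)\<close>, and squaring a sum of two
    terms costs the factor 2. The choice \<open>v = 2 * M * u\<close> provides the square of 2 M
    where twice the square of M is required, which avoids a square root of 2.\<close>
  proof (rule finite_energy_weighted[OF s, where a="\<lambda>x. 2 * ?C * (u x)\<^sup>2" and v="\<lambda>x. 2 * M * u x"])
    show "finite_energy s (\<lambda>x. 2 * M * u x)"
      using Hs_finite_energy[OF u] by (simp add: finite_energy_iff quot_cmult power_mult_distrib)
    fix x y
    have "\<bar>\<eta> x * u x - \<eta> y * u y\<bar> = \<bar>\<eta> y * (u x - u y) + u x * (\<eta> x - \<eta> y)\<bar>" by (simp add: algebra_simps)
    also have "\<dots> \<le> \<bar>\<eta> y * (u x - u y)\<bar> + \<bar>u x * (\<eta> x - \<eta> y)\<bar>" by (rule abs_triangle_ineq)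
    finally have "(\<eta> x * u x - \<eta> y * u y)\<^sup>2 \<le> 2 * (\<eta> y * (u x - u y))\<^sup>2 + 2 * (u x * (\<eta> x - \<eta> y))\<^sup>2"
      by (rule square_le_two_squares)
    moreover have "2 * (\<eta> y * (u x - u y))\<^sup>2 \<le> (2 * M * u x - 2 * M * u y)\<^sup>2"
    proof -
      have "(\<eta> y)\<^sup>2 \<le> M\<^sup>2" using bd[of y] M by (simp add: abs_le_square_iff[symmetric])
      then have "(\<eta> y)\<^sup>2 * (u x - u y)\<^sup>2 \<le> M\<^sup>2 * (u x - u y)\<^sup>2" by (rule mult_right_mono) simp
      moreover have "(2 * M * u x - 2 * M * u y)\<^sup>2 = 4 * (M\<^sup>2 * (u x - u y)\<^sup>2)"
        by (simp add: power2_eq_square algebra_simps)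
      moreover have "0 \<le> M\<^sup>2 * (u x - u y)\<^sup>2" by simp
      ultimately show ?thesis unfolding power_mult_distrib[of "\<eta> y"] by linarith
    qed
    moreover have "2 * (u x * (\<eta> x - \<eta> y))\<^sup>2 \<le>
        min 1 ((norm (x - y))\<^sup>2) * (2 * ?C * (u x)\<^sup>2 + 2 * ?C * (u y)\<^sup>2)"
    proof -
      have "(u x)\<^sup>2 * (\<eta> x - \<eta> y)\<^sup>2 \<le> (u x)\<^sup>2 * (?C * min 1 ((norm (x - y))\<^sup>2))"
        by (intro mult_left_mono lipschitz_bounded_min[OF lip bd]) simp
      moreover have "0 \<le> (u y)\<^sup>2 * (?C * min 1 ((norm (x - y))\<^sup>2))" by simp
      moreover have "min 1 ((norm (x - y))\<^sup>2) * (2 * ?C * (u x)\<^sup>2 + 2 * ?C * (u y)\<^sup>2) =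
          2 * ((u x)\<^sup>2 * (?C * min 1 ((norm (x - y))\<^sup>2))) + 2 * ((u y)\<^sup>2 * (?C * min 1 ((norm (x - y))\<^sup>2)))"
        by (simp only: distrib_left distrib_right mult_ac)
      ultimately show ?thesis unfolding power_mult_distrib[of "u x"] by linarith
    qed
    ultimately show "(\<eta> x * u x - \<eta> y * u y)\<^sup>2 \<le>
        min 1 ((norm (x - y))\<^sup>2) * (2 * ?C * (u x)\<^sup>2 + 2 * ?C * (u y)\<^sup>2) + (2 * M * u x - 2 * M * u y)\<^sup>2"
      by linarith
  qed (use iu in auto)
  moreover have "integrable lborel (\<lambda>x. (\<eta> x * u x)\<^sup>2)"
  proof (rule integrable_power2_bound[where g="\<lambda>x. M * u x" and h="\<lambda>x. 0"])
    show "\<bar>\<eta> x * u x\<bar> \<le> \<bar>M * u x\<bar> + \<bar>0\<bar>" for x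
      using bd[of x] M by (simp add: abs_mult mult_right_mono)
  qed (use iu in \<open>auto simp: power_mult_distrib\<close>)
  ultimately show ?thesis by (simp add: Hs_iff)
qed

lemma Hs_lipschitz_compact_support:
  fixes \<eta> :: "'a::euclidean_space \<Rightarrow> real"
  assumes s: "0 < s" "s < 1"
    and lip: "\<And>x y. \<bar>\<eta> x - \<eta> y\<bar> \<le> L * norm (x - y)"
    and bd: "\<And>x. \<bar>\<eta> x\<bar> \<le> M" and zero: "\<And>x. R < norm x \<Longrightarrow> \<eta> x = 0"
  shows "\<eta> \<in> Hs s"
proof -
  note measurable_lipschitz[OF lip, measurable]
  let ?i = "indicator (cball 0 R) :: 'a \<Rightarrow> real"
  let ?C = "L\<^sup>2 + 4 * M\<^sup>2"
  have i: "integrable lborel ?i"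
    using emeasure_bounded_finite[OF bounded_cball[of "0::'a" R]] by (intro integrable_real_indicator) auto
  have "finite_energy s \<eta>"
  \<comment> \<open>An increment of \<open>\<eta>\<close> is nonzero only if one of its two points
    lies in the ball, so the sum of the two indicators is then at least 1.\<close>
  proof (rule finite_energy_weighted[OF s, where a="\<lambda>x. ?C * ?i x" and v="\<lambda>x. 0"])
    fix x y
    show "(\<eta> x - \<eta> y)\<^sup>2 \<le> min 1 ((norm (x - y))\<^sup>2) * (?C * ?i x + ?C * ?i y) + (0 - 0)\<^sup>2"
    proof (cases "norm x \<le> R \<or> norm y \<le> R")
      case True
      then have "1 \<le> ?i x + ?i y" by (auto split: split_indicator)
      then have "(?C * min 1 ((norm (x - y))\<^sup>2)) * 1 \<le> (?C * min 1 ((norm (x - y))\<^sup>2)) * (?i x + ?i y)"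
        by (rule mult_left_mono) simp
      then show ?thesis using lipschitz_bounded_min[OF lip bd, of x y] by (simp add: algebra_simps)
    next
      case False
      then show ?thesis using zero by (simp add: indicator_def)
    qed
  qed (use i in \<open>auto simp: finite_energy_const\<close>)
  moreover have "integrable lborel (\<lambda>x. (\<eta> x)\<^sup>2)"
  proof (rule Bochner_Integration.integrable_bound[of _ "\<lambda>x. M\<^sup>2 * ?i x"])
    have "(\<eta> x)\<^sup>2 \<le> M\<^sup>2 * ?i x" for x
      using zero[of x] bd[of x] abs_le_square_iff[of "\<eta> x" M] by (auto split: split_indicator)
    then show "AE x in lborel. norm ((\<eta> x)\<^sup>2) \<le> norm (M\<^sup>2 * ?i x)" by (intro AE_I2) auto
  qed (use i in auto)
  ultimately show ?thesis by (simp add: Hs_iff)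
qed

section \<open>Smooth functions\<close>

lemma has_derivative_zero_outside:
  fixes f :: "'a::euclidean_space \<Rightarrow> real"
  assumes der: "(f has_derivative f') (at x)" and zero: "\<And>x. R < norm x \<Longrightarrow> f x = 0" and x: "R < norm x"
  shows "f' = (\<lambda>h. 0)"
proof -
  have "open {x::'a. R < norm x}" by (intro open_Collect_less continuous_intros)
  then have "(f has_derivative (\<lambda>h. 0)) (at x)"
    by (rule has_derivative_transform_within_open[OF has_derivative_const[of 0]]) (use x zero in auto)
  with der show ?thesis by (rule has_derivative_unique)
qed

lemma continuous_compact_support_bounded:
  fixes f :: "'a::euclidean_space \<Rightarrow> real"
  assumes cont: "continuous_on UNIV f" and zero: "\<And>x. R < norm x \<Longrightarrow> f x = 0"
  shows "\<exists>B\<ge>0. \<forall>x. \<bar>f x\<bar> \<le> B"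
proof -
  have "compact (f ` cball 0 R)"
    using cont by (intro compact_continuous_image) (auto intro: continuous_on_subset)
  then obtain B where "\<forall>x\<in>cball 0 R. \<bar>f x\<bar> \<le> B"
    by (auto dest!: compact_imp_bounded simp: bounded_iff)
  then have B: "\<bar>f x\<bar> \<le> B" if "norm x \<le> R" for x using that by simp
  have "\<bar>f x\<bar> \<le> max B 0" for x
    using B[of x] zero[of x] by (cases "norm x \<le> R") auto
  then show ?thesis by (intro exI[of _ "max B 0"]) auto
qed

text \<open>The same \<open>L\<close> controls the derivative and the increments, so the remainder
  of a difference quotient is dominated by \<open>2 * L\<close> when differentiating under the
  integral.\<close>

lemma compact_support_derivative_bound:
  fixes f :: "'a::euclidean_space \<Rightarrow> real"
  assumes der: "\<And>x. (f has_derivative f' x) (at x)" and cont: "\<And>h. continuous_on UNIV (\<lambda>x. f' x h)"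
    and zero: "\<And>x. R < norm x \<Longrightarrow> f x = 0"
  shows "\<exists>L. (\<forall>x h. \<bar>f' x h\<bar> \<le> L * norm h) \<and> (\<forall>x y. \<bar>f x - f y\<bar> \<le> L * norm (x - y))"
proof -
  have "\<exists>B\<ge>0. \<forall>x. \<bar>f' x b\<bar> \<le> B" for b
  proof (rule continuous_compact_support_bounded[OF cont])
    show "f' x b = 0" if "R < norm x" for x
      using has_derivative_zero_outside[of f "f' x" x R, OF der zero] that by simp
  qed
  then have "\<forall>b. \<exists>B. 0 \<le> B \<and> (\<forall>x. \<bar>f' x b\<bar> \<le> B)" by blast
  from choice[OF this] obtain B where B: "\<And>b. 0 \<le> B b" "\<And>b x. \<bar>f' x b\<bar> \<le> B b" by blast
  define L where "L = (\<Sum>b\<in>Basis. B b)"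
  have L: "0 \<le> L" unfolding L_def using B by (intro sum_nonneg) auto
  have bound: "\<bar>f' x h\<bar> \<le> L * norm h" for x h
  proof -
    interpret linear "f' x" by (rule has_derivative_linear[OF der])
    have "f' x h = f' x (\<Sum>b\<in>Basis. (h \<bullet> b) *\<^sub>R b)" by (simp add: euclidean_representation)
    also have "\<dots> = (\<Sum>b\<in>Basis. (h \<bullet> b) * f' x b)" by (simp add: sum scale)
    also have "\<bar>\<dots>\<bar> \<le> (\<Sum>b\<in>Basis. \<bar>h \<bullet> b\<bar> * \<bar>f' x b\<bar>)"
      by (rule order_trans[OF sum_abs]) (simp add: abs_mult)
    also have "\<dots> \<le> (\<Sum>b\<in>Basis. norm h * B b)"
      using B by (intro sum_mono mult_mono) (auto simp: Basis_le_norm)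
    finally show ?thesis by (simp add: L_def sum_distrib_left mult.commute)
  qed
  moreover have "\<bar>f x - f y\<bar> \<le> L * norm (x - y)" for x y
  proof -
    have "onorm (f' z) \<le> L" for z by (rule onorm_bound[OF L]) (simp add: bound)
    then have "norm (f x - f y) \<le> L * norm (x - y)"
      by (intro differentiable_bound[of UNIV f f']) (auto intro: has_derivative_at_withinI der)
    then show ?thesis by simp
  qed
  ultimately show ?thesis by (intro exI[of _ L] conjI allI)
qed

lemma test_function_props:
  assumes \<phi>: "\<phi> \<in> test_functions D"
  shows "\<exists>L M R. (\<forall>x y. \<bar>\<phi> x - \<phi> y\<bar> \<le> L * norm (x - y)) \<and> (\<forall>x. \<bar>\<phi> x\<bar> \<le> M) \<and>
    (\<forall>x. R < norm x \<longrightarrow> \<phi> x = 0)"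
proof -
  have "bounded (closure {x. \<phi> x \<noteq> 0})" using \<phi> unfolding test_functions_def by (blast intro: compact_imp_bounded)
  then obtain R where "\<forall>x\<in>closure {x. \<phi> x \<noteq> 0}. norm x \<le> R" by (auto simp: bounded_iff)
  then have R: "\<phi> x = 0" if "R < norm x" for x using closure_subset[of "{x. \<phi> x \<noteq> 0}"] that by force
  have "C_k (Suc 0) \<phi>" using \<phi> unfolding test_functions_def by blast
  then obtain f' where f': "\<And>x. (\<phi> has_derivative f' x) (at x)" "\<And>h. continuous_on UNIV (\<lambda>x. f' x h)"
    by auto
  then obtain L where L: "\<forall>x y. \<bar>\<phi> x - \<phi> y\<bar> \<le> L * norm (x - y)"
    using compact_support_derivative_bound[of \<phi> f' R, OF f'] R by auto
  have "C_k 0 \<phi>" using \<phi> unfolding test_functions_def by blast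
  then obtain M where "\<forall>x. \<bar>\<phi> x\<bar> \<le> M"
    using continuous_compact_support_bounded[of \<phi> R] R by auto
  with L R show ?thesis by (intro exI[of _ L] exI[of _ M] exI[of _ R]) auto
qed

lemma test_function_Hs:
  assumes "0 < s" "s < 1" "\<phi> \<in> test_functions D" shows "\<phi> \<in> Hs s"
proof -
  obtain L M R where "\<And>x y. \<bar>\<phi> x - \<phi> y\<bar> \<le> L * norm (x - y)" "\<And>x. \<bar>\<phi> x\<bar> \<le> M"
      "\<And>x. R < norm x \<Longrightarrow> \<phi> x = 0"
    using test_function_props[OF assms(3)] by auto
  then show ?thesis by (rule Hs_lipschitz_compact_support[OF assms(1,2)])
qed

lemma test_function_zero: "\<phi> \<in> test_functions D \<Longrightarrow> x \<notin> D \<Longrightarrow> \<phi> x = 0"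
  using closure_subset[of "{x. \<phi> x \<noteq> 0}"] by (auto simp: test_functions_def)

lemma test_function_Hs0:
  assumes "0 < s" "s < 1" "\<phi> \<in> test_functions D" shows "\<phi> \<in> Hs0 s D"
  using test_function_Hs[OF assms] test_function_zero[OF assms(3)] by (auto simp: Hs0_def)

section \<open>Closure properties of the classes C_k\<close>

lemma C_k_Suc_D: "C_k (Suc k) f \<Longrightarrow> C_k k f"
proof (induction k arbitrary: f)
  case 0
  then obtain f' where "\<And>x. (f has_derivative f' x) (at x)" by auto
  then show ?case by (auto intro!: continuous_at_imp_continuous_on has_derivative_continuous)
next
  case (Suc k)
  then obtain f' where f': "\<forall>x. (f has_derivative f' x) (at x)" "\<forall>h. C_k (Suc k) (\<lambda>x. f' x h)"
    by (subst (asm) C_k.simps(2)) blast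
  then have "\<forall>h. C_k k (\<lambda>x. f' x h)" using Suc.IH by blast
  with f' show ?case by (subst C_k.simps(2)) blast
qed

lemma C_k_SucI:
  assumes "\<And>x. (f has_derivative f' x) (at x)" "\<And>h. C_k k (\<lambda>x. f' x h)"
  shows "C_k (Suc k) f"
  using assms by auto

lemma C_k_const: "C_k k (\<lambda>x. c)"
proof (induction k arbitrary: c)
  case (Suc k)
  show ?case by (rule C_k_SucI[where f'="\<lambda>x h. 0"]) (auto simp: Suc)
qed simp

lemma C_k_add: "C_k k f \<Longrightarrow> C_k k g \<Longrightarrow> C_k k (\<lambda>x. f x + g x)"
proof (induction k arbitrary: f g)
  case (Suc k)
  from Suc.prems obtain f' where f: "\<And>x. (f has_derivative f' x) (at x)" "\<And>h. C_k k (\<lambda>x. f' x h)" by auto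
  from Suc.prems obtain g' where g: "\<And>x. (g has_derivative g' x) (at x)" "\<And>h. C_k k (\<lambda>x. g' x h)" by auto
  show ?case
    by (rule C_k_SucI[where f'="\<lambda>x h. f' x h + g' x h"]) (auto intro!: has_derivative_add f g Suc.IH)
qed (auto intro: continuous_on_add)

lemma C_k_mult: "C_k k f \<Longrightarrow> C_k k g \<Longrightarrow> C_k k (\<lambda>x. f x * g x)"
proof (induction k arbitrary: f g)
  case (Suc k)
  from Suc.prems obtain f' where f: "\<And>x. (f has_derivative f' x) (at x)" "\<And>h. C_k k (\<lambda>x. f' x h)" by auto
  from Suc.prems obtain g' where g: "\<And>x. (g has_derivative g' x) (at x)" "\<And>h. C_k k (\<lambda>x. g' x h)" by auto
  show ?case
  proof (rule C_k_SucI)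
    show "((\<lambda>x. f x * g x) has_derivative (\<lambda>h. f x * g' x h + f' x h * g x)) (at x)" for x
      by (intro has_derivative_mult f g)
    show "C_k k (\<lambda>x. f x * g' x h + f' x h * g x)" for h
      using C_k_Suc_D[OF Suc.prems(1)] C_k_Suc_D[OF Suc.prems(2)] f(2) g(2)
      by (intro C_k_add Suc.IH)
  qed
qed (auto intro: continuous_on_mult)

lemma C_k_inner: "C_k k (\<lambda>x. x \<bullet> h)"
proof (cases k)
  case (Suc m)
  show ?thesis unfolding Suc
    by (rule C_k_SucI[where f'="\<lambda>x k. k \<bullet> h"])
      (auto intro!: bounded_linear_imp_has_derivative bounded_linear_inner_left C_k_const)
qed (auto intro: continuous_intros)

lemma C_k_inner_self: "C_k k (\<lambda>x. x \<bullet> x)"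
proof (cases k)
  case (Suc m)
  show ?thesis unfolding Suc
  proof (rule C_k_SucI)
    show "((\<lambda>x. x \<bullet> x) has_derivative (\<lambda>h. x \<bullet> h + h \<bullet> x)) (at x)" for x :: 'a
      by (rule has_derivative_inner) (rule has_derivative_ident)+
    show "C_k m (\<lambda>x. x \<bullet> h + h \<bullet> x)" for h :: 'a
      using C_k_add[OF C_k_inner C_k_inner, of m h h] by (simp add: inner_commute)
  qed
qed (auto intro: continuous_intros)

text \<open>The outer function comes with the sequence of all its derivatives: the chain rule turns
  \<open>F j\<close> into \<open>F (Suc j)\<close>, so the induction on \<open>k\<close> stays
  within the family once \<open>j\<close> is arbitrary.\<close>

lemma C_k_compose:
  fixes F :: "nat \<Rightarrow> real \<Rightarrow> real"
  assumes F: "\<And>j t. (F j has_real_derivative F (Suc j) t) (at t)" and q: "\<And>k. C_k k q"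
  shows "C_k k (\<lambda>x. F j (q x))"
proof (induction k arbitrary: j)
  case 0
  have "continuous_on UNIV (F j)" using F by (auto intro!: DERIV_continuous_on)
  then show ?case using q[of 0] continuous_on_compose2[of UNIV "F j" UNIV q] by simp
next
  case (Suc k)
  obtain q' where q': "\<And>x. (q has_derivative q' x) (at x)" "\<And>h. C_k k (\<lambda>x. q' x h)"
    using q[of "Suc k"] by auto
  show ?case
  proof (rule C_k_SucI)
    show "((\<lambda>x. F j (q x)) has_derivative (\<lambda>h. q' x h * F (Suc j) (q x))) (at x)" for x
      by (rule DERIV_compose_FDERIV[OF F q'(1)])
    show "C_k k (\<lambda>x. q' x h * F (Suc j) (q x))" for h
      by (intro C_k_mult q'(2) Suc.IH)
  qed
qed

section \<open>Flat exponentials and mollifiers\<close>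

definition exp_flat :: "real poly \<Rightarrow> real \<Rightarrow> real" where
  "exp_flat p t = (if 0 < t then poly p (1 / t) * exp (- (1 / t)) else 0)"

lemma poly_exp_tendsto_0: "((\<lambda>y::real. poly p y * exp (- y)) \<longlongrightarrow> 0) at_top"
proof -
  \<comment> \<open>The factor \<open>y ^ k\<close> strengthens the induction: splitting off the
    constant coefficient of the polynomial raises the power by one.\<close>
  have "((\<lambda>y::real. y ^ k * poly p y * exp (- y)) \<longlongrightarrow> 0) at_top" for k
  proof (induction p arbitrary: k)
    case (pCons a p)
    have "((\<lambda>y::real. a * (y ^ k / exp y)) \<longlongrightarrow> a * 0) at_top"
      by (intro tendsto_mult tendsto_const tendsto_power_div_exp_0)
    from tendsto_add[OF this pCons.IH[of "Suc k"]]
    show ?case by (simp add: algebra_simps exp_minus divide_simps)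
  qed simp
  from this[of 0] show ?thesis by simp
qed

text \<open>This is the limit of the difference quotient at 0. For positive t, division by t
  multiplies the polynomial in 1/t by its variable, hence \<open>pCons 0 p\<close>.\<close>

lemma exp_flat_div_tendsto_0: "((\<lambda>t. exp_flat p t / t) \<longlongrightarrow> 0) (at 0)"
proof (rule filterlim_split_at_real)
  have "((\<lambda>t. poly (pCons 0 p) (inverse t) * exp (- (inverse t))) \<longlongrightarrow> 0) (at_right 0)"
    by (rule filterlim_compose[OF poly_exp_tendsto_0 filterlim_inverse_at_top_right])
  moreover have "eventually (\<lambda>t. poly (pCons 0 p) (inverse t) * exp (- (inverse t)) = exp_flat p t / t) (at_right 0)"
    using eventually_at_right_less[of 0]
    by eventually_elim (simp add: exp_flat_def divide_inverse)
  ultimately show "((\<lambda>t. exp_flat p t / t) \<longlongrightarrow> 0) (at_right 0)"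
    by (rule Lim_transform_eventually)
  have "eventually (\<lambda>t. 0 = exp_flat p t / t) (at_left 0)"
    using eventually_at_left_real[of "-1" 0] by (auto elim!: eventually_mono simp: exp_flat_def)
  then show "((\<lambda>t. exp_flat p t / t) \<longlongrightarrow> 0) (at_left 0)"
    by (rule Lim_transform_eventually[OF tendsto_const])
qed

text \<open>With y = 1/t, the derivative of p(y) exp(-y) in t is y^2 (p(y) - p'(y)) exp(-y). The
  family is thus closed under differentiation, and the extension by 0 stays differentiable at the
  origin.\<close>

lemma exp_flat_deriv:
  "(exp_flat p has_real_derivative exp_flat ([:0, 0, 1:] * (p - pderiv p)) t) (at t)"
proof -
  consider "0 < t" | "t < 0" | "t = 0" by linarith
  then show ?thesis
  proof cases
    case 1
    have "((\<lambda>t. poly p (1 / t) * exp (- (1 / t))) has_real_derivative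
        exp_flat ([:0, 0, 1:] * (p - pderiv p)) t) (at t)"
      using 1 by (auto intro!: derivative_eq_intros poly_DERIV[THEN DERIV_chain2]
          simp: exp_flat_def field_simps power2_eq_square)
    then show ?thesis
      by (rule has_field_derivative_transform_within_open[of _ _ _ "{0<..}"])
        (use 1 in \<open>auto simp: exp_flat_def\<close>)
  next
    case 2
    have "((\<lambda>t. 0) has_real_derivative exp_flat ([:0, 0, 1:] * (p - pderiv p)) t) (at t)"
      using 2 by (simp add: exp_flat_def)
    then show ?thesis
      by (rule has_field_derivative_transform_within_open[of _ _ _ "{..<0}"])
        (use 2 in \<open>auto simp: exp_flat_def\<close>)
  next
    case 3
    then show ?thesis
      using exp_flat_div_tendsto_0[of p] by (simp add: has_field_derivative_iff exp_flat_def)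
  qed
qed

lemma ex_mollifier:
  fixes d :: real
  assumes d: "0 < d"
  shows "\<exists>\<rho> :: 'a::euclidean_space \<Rightarrow> real. (\<forall>k. C_k k \<rho>) \<and> (\<forall>x. 0 \<le> \<rho> x) \<and> (\<forall>x. d \<le> norm x \<longrightarrow> \<rho> x = 0) \<and>
    integrable lborel \<rho> \<and> (LINT x|lborel. \<rho> x) = 1"
proof -
  \<comment> \<open>Iterating the map of \<open>exp_flat_deriv\<close> from the polynomial 1 lists
    all derivatives of exp(-1/t) extended by 0.\<close>
  define F where "F j = exp_flat (((\<lambda>p. [:0, 0, 1:] * (p - pderiv p)) ^^ j) 1)" for j
  have F: "(F j has_real_derivative F (Suc j) t) (at t)" for j t
    unfolding F_def by (simp add: exp_flat_deriv del: mult_pCons_left)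
  \<comment> \<open>\<open>q\<close> is a polynomial in the coordinates that is positive exactly on
    the open ball of radius \<open>d\<close>, so composing with the flat exponential gives a smooth
    bump on that ball.\<close>
  define q where "q x = 1 + (- 1 / d\<^sup>2) * (x \<bullet> x)" for x :: 'a
  have q: "C_k k q" for k
    unfolding q_def by (intro C_k_add C_k_mult C_k_const C_k_inner_self)
  define b where "b x = F 0 (q x)" for x
  have b: "C_k k b" for k unfolding b_def by (rule C_k_compose[of F q, OF F q])
  have qpos: "0 < q x \<longleftrightarrow> norm x < d" for x
  proof -
    have "0 < q x \<longleftrightarrow> (norm x)\<^sup>2 < d\<^sup>2" using d by (simp add: q_def power2_norm_eq_inner field_simps)
    also have "\<dots> \<longleftrightarrow> norm x < d" using abs_le_square_iff[of d "norm x"] d by (simp flip: linorder_not_le)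
    finally show ?thesis .
  qed
  have b0: "0 \<le> b x" for x by (simp add: b_def F_def exp_flat_def)
  have bpos: "0 < b x" if "norm x < d" for x using that qpos[of x] by (simp add: b_def F_def exp_flat_def)
  have bzero: "b x = 0" if "d \<le> norm x" for x using that qpos[of x] by (simp add: b_def F_def exp_flat_def)
  have cont: "continuous_on UNIV b" using b[of 0] by simp
  then have [measurable]: "b \<in> borel_measurable borel" by (rule borel_measurable_continuous_onI)
  have int: "integrable lborel b"
  proof -
    have "integrable lborel (\<lambda>x. indicator (cball 0 d) x *\<^sub>R b x)"
      using cont by (intro borel_integrable_compact) (auto intro: continuous_on_subset)
    moreover have "(\<lambda>x. indicator (cball 0 d) x *\<^sub>R b x) = b"
      using bzero by (auto simp: fun_eq_iff not_le split: split_indicator)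
    ultimately show ?thesis by (simp only:)
  qed
  have "(LINT x|lborel. b x) \<noteq> 0"
  proof
    assume "(LINT x|lborel. b x) = 0"
    then have "AE x in lborel. b x = 0"
      using int b0 by (subst (asm) integral_nonneg_eq_0_iff_AE) auto
    then have "AE x in lborel. x \<notin> ball (0::'a) d"
      by eventually_elim (use bpos in \<open>force simp: dist_norm\<close>)
    then have "emeasure lborel (ball (0::'a) d) = 0" by (subst (asm) AE_iff_measurable[of "ball 0 d"]) auto
    then have "measure lborel (ball (0::'a) d) = 0" by (simp add: measure_def)
    then show False using content_ball_pos[OF d, of "0::'a"] by simp
  qed
  moreover have "0 \<le> (LINT x|lborel. b x)" using b0 by (intro Bochner_Integration.integral_nonneg) auto
  ultimately have I: "0 < (LINT x|lborel. b x)" by simp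
  define \<rho> where "\<rho> x = 1 / (LINT x|lborel. b x) * b x" for x
  have "C_k k \<rho>" for k unfolding \<rho>_def by (intro C_k_mult C_k_const b)
  moreover have "0 \<le> \<rho> x" for x using I b0[of x] by (simp add: \<rho>_def)
  moreover have "\<rho> x = 0" if "d \<le> norm x" for x using bzero that by (simp add: \<rho>_def)
  moreover have "integrable lborel \<rho>" unfolding \<rho>_def using int by simp
  moreover have "(LINT x|lborel. \<rho> x) = 1" unfolding \<rho>_def using int I by simp
  ultimately show ?thesis by (intro exI[of _ \<rho>]) auto
qed

section \<open>Mollification\<close>

lemma integrable_bounded_mult:
  fixes f g :: "'b \<Rightarrow> real"
  assumes [measurable]: "f \<in> borel_measurable M" and g: "integrable M g" and f: "\<And>x. \<bar>f x\<bar> \<le> B"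
  shows "integrable M (\<lambda>x. f x * g x)"
proof (rule Bochner_Integration.integrable_bound[of M "\<lambda>x. B * g x"])
  have "0 \<le> B" using order_trans[OF abs_ge_zero f] .
  then show "AE x in M. norm (f x * g x) \<le> norm (B * g x)"
    using f by (auto simp: abs_mult intro!: mult_right_mono)
qed (use g in auto)

lemma continuous_on_convolution:
  fixes \<rho> \<phi> :: "'a::euclidean_space \<Rightarrow> real"
  assumes \<rho>: "continuous_on UNIV \<rho>" "\<And>x. R < norm x \<Longrightarrow> \<rho> x = 0" and \<phi>: "integrable lborel \<phi>"
  shows "continuous_on UNIV (\<lambda>x. LINT y|lborel. \<rho> (x - y) * \<phi> y)"
proof -
  have [measurable]: "\<rho> \<in> borel_measurable borel" "\<phi> \<in> borel_measurable borel"
    using \<rho>(1) \<phi> by (auto intro: borel_measurable_continuous_onI)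
  obtain B where B: "\<And>x. \<bar>\<rho> x\<bar> \<le> B" using continuous_compact_support_bounded[of \<rho> R] \<rho> by blast
  have B0: "0 \<le> B" using order_trans[OF abs_ge_zero B] .
  show ?thesis unfolding continuous_on_sequentially
  proof (intro allI impI ballI, elim conjE)
    fix X :: "nat \<Rightarrow> 'a" and x assume X: "X \<longlonglongrightarrow> x"
    have "(\<lambda>n. LINT y|lborel. \<rho> (X n - y) * \<phi> y) \<longlonglongrightarrow> (LINT y|lborel. \<rho> (x - y) * \<phi> y)"
    proof (rule integral_dominated_convergence[where w="\<lambda>y. B * \<bar>\<phi> y\<bar>"])
      show "AE y in lborel. (\<lambda>n. \<rho> (X n - y) * \<phi> y) \<longlonglongrightarrow> \<rho> (x - y) * \<phi> y"
      proof (rule AE_I2)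
        fix y
        have "(\<lambda>n. X n - y) \<longlonglongrightarrow> x - y" by (intro tendsto_intros X)
        then have "(\<lambda>n. \<rho> (X n - y)) \<longlonglongrightarrow> \<rho> (x - y)"
          using continuous_on_tendsto_compose[OF \<rho>(1)] by auto
        then show "(\<lambda>n. \<rho> (X n - y) * \<phi> y) \<longlonglongrightarrow> \<rho> (x - y) * \<phi> y" by (intro tendsto_intros)
      qed
    qed (use \<phi> B in \<open>auto simp: abs_mult intro!: mult_right_mono\<close>)
    then show "((\<lambda>x. LINT y|lborel. \<rho> (x - y) * \<phi> y) \<circ> X) \<longlonglongrightarrow> (LINT y|lborel. \<rho> (x - y) * \<phi> y)"
      by (simp add: o_def)
  qed
qed

text \<open>Since \<open>\<phi>\<close> is merely integrable, the derivative falls on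
  \<open>\<rho>\<close>. Along a sequence of increments the remainder quotients tend to 0 pointwise
  and are dominated by \<open>2 * L * \<bar>\<phi> y\<bar>\<close>.\<close>

lemma has_derivative_convolution:
  fixes \<rho> \<phi> :: "'a::euclidean_space \<Rightarrow> real"
  assumes der: "\<And>x. (\<rho> has_derivative \<rho>' x) (at x)" and cont: "\<And>h. continuous_on UNIV (\<lambda>x. \<rho>' x h)"
    and zero: "\<And>x. R < norm x \<Longrightarrow> \<rho> x = 0" and \<phi>: "integrable lborel \<phi>"
  shows "((\<lambda>x. LINT y|lborel. \<rho> (x - y) * \<phi> y) has_derivative
    (\<lambda>h. LINT y|lborel. \<rho>' (x - y) h * \<phi> y)) (at x)"
proof -
  have c: "continuous_on UNIV \<rho>"
    using der by (auto intro!: continuous_at_imp_continuous_on has_derivative_continuous)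
  have [measurable]: "\<rho> \<in> borel_measurable borel" "\<phi> \<in> borel_measurable borel"
      "(\<lambda>x. \<rho>' x h) \<in> borel_measurable borel" for h
    using \<phi> c cont by (auto intro: borel_measurable_continuous_onI)
  obtain B where B: "\<And>x. \<bar>\<rho> x\<bar> \<le> B" using continuous_compact_support_bounded[of \<rho> R] c zero by blast
  obtain L where L': "\<And>x h. \<bar>\<rho>' x h\<bar> \<le> L * norm h" and L: "\<And>x y. \<bar>\<rho> x - \<rho> y\<bar> \<le> L * norm (x - y)"
    using compact_support_derivative_bound[of \<rho> \<rho>' R, OF der cont zero] by auto
  have lin: "linear (\<rho>' x)" for x by (rule has_derivative_linear[OF der])
  have i: "integrable lborel (\<lambda>y. \<rho> (x - y) * \<phi> y)" for x
    by (rule integrable_bounded_mult[OF _ \<phi> B]) simp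
  have i': "integrable lborel (\<lambda>y. \<rho>' (x - y) h * \<phi> y)" for x h
    by (rule integrable_bounded_mult[OF _ \<phi> L']) simp
  show ?thesis unfolding has_derivative_at
  proof (intro conjI)
    have "linear (\<lambda>h. LINT y|lborel. \<rho>' (x - y) h * \<phi> y)"
    proof (rule linearI)
      show "(LINT y|lborel. \<rho>' (x - y) (h + k) * \<phi> y) =
          (LINT y|lborel. \<rho>' (x - y) h * \<phi> y) + (LINT y|lborel. \<rho>' (x - y) k * \<phi> y)" for h k
        using i' by (simp add: linear_add[OF lin] distrib_right)
      show "(LINT y|lborel. \<rho>' (x - y) (r *\<^sub>R h) * \<phi> y) = r *\<^sub>R (LINT y|lborel. \<rho>' (x - y) h * \<phi> y)" for r h
        by (simp add: linear_scale[OF lin] mult.assoc)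
    qed
    then show "bounded_linear (\<lambda>h. LINT y|lborel. \<rho>' (x - y) h * \<phi> y)"
      by (simp add: linear_conv_bounded_linear)
    show "((\<lambda>h. norm ((LINT y|lborel. \<rho> (x + h - y) * \<phi> y) - (LINT y|lborel. \<rho> (x - y) * \<phi> y) -
        (LINT y|lborel. \<rho>' (x - y) h * \<phi> y)) / norm h) \<longlongrightarrow> 0) (at 0)"
      unfolding tendsto_at_iff_sequentially
    proof (intro allI impI)
      fix H :: "nat \<Rightarrow> 'a" assume H0: "\<forall>n. H n \<in> UNIV - {0}" and H: "H \<longlonglongrightarrow> 0"
      let ?r = "\<lambda>h y. (\<rho> (x + h - y) - \<rho> (x - y) - \<rho>' (x - y) h) / norm h"
      have "(\<lambda>n. LINT y|lborel. ?r (H n) y * \<phi> y) \<longlonglongrightarrow> (LINT y|(lborel::'a measure). (0::real))"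
      proof (rule integral_dominated_convergence[where w="\<lambda>y. (2 * L) * \<bar>\<phi> y\<bar>"])
        show "AE y in lborel. (\<lambda>n. ?r (H n) y * \<phi> y) \<longlonglongrightarrow> 0"
        proof (rule AE_I2)
          fix y
          have "((\<lambda>h. norm (\<rho> (x - y + h) - \<rho> (x - y) - \<rho>' (x - y) h) / norm h) \<longlongrightarrow> 0) (at 0)"
            using der[of "x - y"] by (simp add: has_derivative_at)
          then have "((\<lambda>h. norm (\<rho> (x - y + h) - \<rho> (x - y) - \<rho>' (x - y) h) / norm h) \<circ> H) \<longlonglongrightarrow> 0"
            using H H0 unfolding tendsto_at_iff_sequentially by blast
          then have "(\<lambda>n. norm (?r (H n) y)) \<longlonglongrightarrow> 0" by (simp add: o_def algebra_simps)
          then have "(\<lambda>n. ?r (H n) y) \<longlonglongrightarrow> 0" by (rule tendsto_norm_zero_cancel)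
          then show "(\<lambda>n. ?r (H n) y * \<phi> y) \<longlonglongrightarrow> 0" by (rule tendsto_mult_left_zero)
        qed
        fix n
        have "\<bar>?r (H n) y\<bar> \<le> 2 * L" for y
        proof -
          have "\<bar>\<rho> (x + H n - y) - \<rho> (x - y) - \<rho>' (x - y) (H n)\<bar> \<le> L * norm (H n) + L * norm (H n)"
            using L[of "x + H n - y" "x - y"] L'[of "x - y" "H n"] by (simp add: algebra_simps)
          then show ?thesis using H0 by (simp add: divide_simps)
        qed
        then show "AE y in lborel. norm (?r (H n) y * \<phi> y) \<le> 2 * L * \<bar>\<phi> y\<bar>"
          unfolding real_norm_def abs_mult[of "?r (H n) _"] by (intro AE_I2 mult_right_mono) auto
      qed (use \<phi> in auto)
      then have lim: "(\<lambda>n. norm (LINT y|lborel. ?r (H n) y * \<phi> y)) \<longlonglongrightarrow> 0"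
        by (intro tendsto_norm_zero) simp
      have eq: "(LINT y|lborel. ?r h y * \<phi> y) = ((LINT y|lborel. \<rho> (x + h - y) * \<phi> y) -
          (LINT y|lborel. \<rho> (x - y) * \<phi> y) - (LINT y|lborel. \<rho>' (x - y) h * \<phi> y)) / norm h" for h
      proof -
        have "(LINT y|lborel. ?r h y * \<phi> y) = (LINT y|lborel.
            (\<rho> (x + h - y) * \<phi> y - \<rho> (x - y) * \<phi> y - \<rho>' (x - y) h * \<phi> y) / norm h)"
          by (simp add: algebra_simps)
        also have "\<dots> = (LINT y|lborel.
            (\<rho> (x + h - y) * \<phi> y - \<rho> (x - y) * \<phi> y - \<rho>' (x - y) h * \<phi> y)) / norm h"
          by simp
        finally show ?thesis using i i' by simp
      qed
      show "((\<lambda>h. norm ((LINT y|lborel. \<rho> (x + h - y) * \<phi> y) - (LINT y|lborel. \<rho> (x - y) * \<phi> y) -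
        (LINT y|lborel. \<rho>' (x - y) h * \<phi> y)) / norm h) \<circ> H) \<longlonglongrightarrow> 0"
        using lim unfolding eq o_def real_norm_def by (simp only: abs_divide abs_norm_cancel)
    qed
  qed
qed

lemma C_k_convolution:
  fixes \<rho> \<phi> :: "'a::euclidean_space \<Rightarrow> real"
  assumes "C_k k \<rho>" "\<And>x. R < norm x \<Longrightarrow> \<rho> x = 0" "integrable lborel \<phi>"
  shows "C_k k (\<lambda>x. LINT y|lborel. \<rho> (x - y) * \<phi> y)"
  using assms(1,2)
proof (induction k arbitrary: \<rho>)
  case 0
  then show ?case using continuous_on_convolution[of \<rho> R \<phi>] assms(3) by simp
next
  case (Suc k)
  then obtain \<rho>' where \<rho>': "\<And>x. (\<rho> has_derivative \<rho>' x) (at x)" "\<And>h. C_k k (\<lambda>x. \<rho>' x h)" by auto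
  have cont: "continuous_on UNIV (\<lambda>x. \<rho>' x h)" for h
  proof -
    have "C_k 0 f" if "C_k k f" for f :: "'a \<Rightarrow> real"
      using that by (induction k) (auto dest: C_k_Suc_D simp del: C_k.simps)
    then show ?thesis using \<rho>'(2)[of h] by simp
  qed
  show ?case
  proof (rule C_k_SucI)
    show "((\<lambda>x. LINT y|lborel. \<rho> (x - y) * \<phi> y) has_derivative
      (\<lambda>h. LINT y|lborel. \<rho>' (x - y) h * \<phi> y)) (at x)" for x
      by (rule has_derivative_convolution[OF \<rho>'(1) cont _ assms(3)]) (rule Suc.prems(2))
    show "C_k k (\<lambda>x. LINT y|lborel. \<rho>' (x - y) h * \<phi> y)" for h
    proof (rule Suc.IH[OF \<rho>'(2)])
      show "\<rho>' x h = 0" if "R < norm x" for x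
        using has_derivative_zero_outside[of \<rho> "\<rho>' x" x R, OF \<rho>'(1) Suc.prems(2)] that by simp
    qed
  qed
qed

text \<open>Cauchy-Schwarz for the square root of \<open>\<rho>\<close> and its product with
  \<open>\<bar>g\<bar>\<close>; the former has L2 norm 1.\<close>

lemma jensen_weighted:
  fixes \<rho> g :: "'a::euclidean_space \<Rightarrow> real"
  assumes \<rho>: "\<And>x. 0 \<le> \<rho> x" "integrable lborel \<rho>" "(LINT x|lborel. \<rho> x) = 1"
    and [measurable]: "g \<in> borel_measurable borel"
    and int: "integrable lborel (\<lambda>h. \<rho> h * g h)"
  shows "ennreal ((LINT h|lborel. \<rho> h * g h)\<^sup>2) \<le> (\<integral>\<^sup>+h. ennreal (\<rho> h * (g h)\<^sup>2) \<partial>lborel)"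
proof -
  have [measurable]: "\<rho> \<in> borel_measurable borel" using \<rho>(2) by auto
  have "ennreal \<bar>LINT h|lborel. \<rho> h * g h\<bar> \<le> (\<integral>\<^sup>+h. ennreal \<bar>\<rho> h * g h\<bar> \<partial>lborel)"
    using integral_norm_bound_ennreal[OF int] by simp
  also have "\<dots> = (\<integral>\<^sup>+h. ennreal (sqrt (\<rho> h)) * ennreal (sqrt (\<rho> h) * \<bar>g h\<bar>) \<partial>lborel)"
    using \<rho>(1) by (simp add: ennreal_mult[symmetric] abs_mult mult.assoc[symmetric])
  finally have "(ennreal \<bar>LINT h|lborel. \<rho> h * g h\<bar>)\<^sup>2 \<le>
      (\<integral>\<^sup>+h. ennreal (sqrt (\<rho> h)) * ennreal (sqrt (\<rho> h) * \<bar>g h\<bar>) \<partial>lborel)\<^sup>2"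
    by (rule power_mono) simp
  also have "\<dots> \<le> (\<integral>\<^sup>+h. (ennreal (sqrt (\<rho> h)))\<^sup>2 \<partial>lborel) * (\<integral>\<^sup>+h. (ennreal (sqrt (\<rho> h) * \<bar>g h\<bar>))\<^sup>2 \<partial>lborel)"
    by (rule Cauchy_Schwarz_nn_integral) auto
  also have "(\<integral>\<^sup>+h. (ennreal (sqrt (\<rho> h)))\<^sup>2 \<partial>lborel) = (\<integral>\<^sup>+h. ennreal (\<rho> h) \<partial>lborel)"
    using \<rho>(1) by (simp add: ennreal_power)
  also have "\<dots> = 1" using \<rho> by (simp add: nn_integral_eq_integral)
  also have "(\<integral>\<^sup>+h. (ennreal (sqrt (\<rho> h) * \<bar>g h\<bar>))\<^sup>2 \<partial>lborel) = (\<integral>\<^sup>+h. ennreal (\<rho> h * (g h)\<^sup>2) \<partial>lborel)"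
    using \<rho>(1) by (simp add: ennreal_power power_mult_distrib)
  finally show ?thesis by (simp add: ennreal_power)
qed

text \<open>Jensen for the weight \<open>\<rho>\<close>, then Tonelli. The separate space 'b and the
  shift map \<open>v\<close> allow two uses: \<open>\<phi>\<close> itself with the shift
  \<open>h\<close>, and its difference quotient on pairs with the diagonal shift
  \<open>(h, h)\<close>.\<close>

lemma averaged_translation_bound:
  fixes \<rho> :: "'a::euclidean_space \<Rightarrow> real" and F G :: "'b::euclidean_space \<Rightarrow> real"
  assumes \<rho>: "\<And>x. 0 \<le> \<rho> x" "integrable lborel \<rho>" "(LINT x|lborel. \<rho> x) = 1"
    and supp: "\<And>x. d \<le> norm x \<Longrightarrow> \<rho> x = 0"
    and [measurable]: "F \<in> borel_measurable borel" "v \<in> borel \<rightarrow>\<^sub>M borel"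
    and tr: "\<And>h. norm h < d \<Longrightarrow> (\<integral>\<^sup>+z. ennreal ((F (z - v h) - F z)\<^sup>2) \<partial>lborel) \<le> ennreal c"
    and int: "\<And>z. integrable lborel (\<lambda>h. \<rho> h * (F z - F (z - v h)))"
    and G: "\<And>z. G z = (LINT h|lborel. \<rho> h * (F z - F (z - v h)))"
    and c: "0 \<le> c"
  shows "(\<integral>\<^sup>+z. ennreal ((G z)\<^sup>2) \<partial>lborel) \<le> ennreal c"
proof -
  have [measurable]: "\<rho> \<in> borel_measurable borel" using \<rho>(2) by auto
  have "(\<integral>\<^sup>+z. ennreal ((G z)\<^sup>2) \<partial>lborel) \<le>
      (\<integral>\<^sup>+z. \<integral>\<^sup>+h. ennreal (\<rho> h * (F z - F (z - v h))\<^sup>2) \<partial>lborel \<partial>lborel)"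
    unfolding G by (intro nn_integral_mono jensen_weighted[OF \<rho>] int) measurable
  also have "\<dots> = (\<integral>\<^sup>+h. \<integral>\<^sup>+z. ennreal (\<rho> h * (F z - F (z - v h))\<^sup>2) \<partial>lborel \<partial>lborel)"
    by (rule lborel_pair.Fubini'[symmetric]) measurable
  also have "\<dots> \<le> (\<integral>\<^sup>+h. ennreal (\<rho> h) * ennreal c \<partial>lborel)"
  proof (rule nn_integral_mono)
    fix h
    have "(\<integral>\<^sup>+z. ennreal (\<rho> h * (F z - F (z - v h))\<^sup>2) \<partial>lborel) =
        ennreal (\<rho> h) * (\<integral>\<^sup>+z. ennreal ((F (z - v h) - F z)\<^sup>2) \<partial>lborel)"
      using \<rho>(1) by (simp add: ennreal_mult power2_commute nn_integral_cmult)
    also have "\<dots> \<le> ennreal (\<rho> h) * ennreal c"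
      using tr[of h] supp[of h] by (cases "norm h < d") (auto intro: mult_left_mono)
    finally show "(\<integral>\<^sup>+z. ennreal (\<rho> h * (F z - F (z - v h))\<^sup>2) \<partial>lborel) \<le> ennreal (\<rho> h) * ennreal c" .
  qed
  also have "\<dots> = ennreal c" using \<rho> by (simp add: nn_integral_multc nn_integral_eq_integral)
  finally show ?thesis .
qed

lemma mollified_test_function:
  fixes \<rho> \<phi> :: "'a::euclidean_space \<Rightarrow> real"
  assumes \<rho>: "\<And>k. C_k k \<rho>" "\<And>x. d \<le> norm x \<Longrightarrow> \<rho> x = 0" and \<phi>: "integrable lborel \<phi>"
    and K: "compact K" "(\<Union>x\<in>K. cball x d) \<subseteq> D" "\<And>x. x \<notin> K \<Longrightarrow> \<phi> x = 0"
  shows "(\<lambda>x. LINT y|lborel. \<rho> (x - y) * \<phi> y) \<in> test_functions D"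
proof -
  let ?\<psi> = "\<lambda>x. LINT y|lborel. \<rho> (x - y) * \<phi> y"
  let ?S = "{x + y |x y. x \<in> K \<and> y \<in> cball (0::'a) d}"
  have S: "compact ?S" using K(1) by (intro compact_sums) auto
  have supp: "{x. ?\<psi> x \<noteq> 0} \<subseteq> ?S"
  proof (clarify, rule ccontr)
    fix x assume nz: "?\<psi> x \<noteq> 0" and x: "\<nexists>a b. x = a + b \<and> a \<in> K \<and> b \<in> cball 0 d"
    have "\<rho> (x - y) * \<phi> y = 0" for y
    proof (cases "y \<in> K")
      case True
      then have "\<not> norm (x - y) \<le> d" using x by (auto dest!: spec[of _ y] spec[of _ "x - y"])
      then show ?thesis using \<rho>(2) by simp
    qed (simp add: K(3))
    then have "?\<psi> x = (LINT y|(lborel::'a measure). (0::real))"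
      by (intro Bochner_Integration.integral_cong) blast+
    then show False using nz by simp
  qed
  then have cl: "closure {x. ?\<psi> x \<noteq> 0} \<subseteq> ?S"
    by (rule closure_minimal) (rule compact_imp_closed[OF S])
  then have "compact (closure {x. ?\<psi> x \<noteq> 0})"
    using bounded_subset[OF compact_imp_bounded[OF S] supp] by simp
  moreover have "?S \<subseteq> D" using K(2) by (force simp: dist_norm)
  moreover have "C_k k ?\<psi>" for k
    by (rule C_k_convolution[where R=d]) (use \<rho> \<phi> in auto)
  ultimately show ?thesis using cl unfolding test_functions_def by blast
qed

text \<open>The Gagliardo weight depends only on the difference of the two points, so it is
  invariant under diagonal shifts. Hence the quotient of the mollified function is the average of
  diagonal translates of \<open>quot s \<phi>\<close>, and continuity of translations in L2 on the
  product space controls the seminorm of the error.\<close>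

lemma test_function_approximation:
  fixes \<phi> :: "'a::euclidean_space \<Rightarrow> real"
  assumes \<phi>: "\<phi> \<in> Hs s" "\<And>x. 0 \<le> \<phi> x" and D: "open D"
    and K: "compact K" "K \<subseteq> D" "\<And>x. x \<notin> K \<Longrightarrow> \<phi> x = 0" and e: "0 < e"
  shows "\<exists>\<psi>\<in>test_functions D. (\<forall>x. 0 \<le> \<psi> x) \<and>
    (\<integral>\<^sup>+x. ennreal ((\<phi> x - \<psi> x)\<^sup>2) \<partial>lborel) + gagliardo_sq s (\<lambda>x. \<phi> x - \<psi> x) < ennreal e"
proof -
  note Hs_measurable[OF \<phi>(1), measurable]
  have i\<phi>: "integrable lborel \<phi>"
  proof (rule Bochner_Integration.integrable_bound[of _ "\<lambda>x. indicator K x + (\<phi> x)\<^sup>2"])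
    have "integrable lborel (indicator K :: 'a \<Rightarrow> real)"
      using K(1) emeasure_compact_finite[OF K(1)] by (intro integrable_real_indicator) (auto intro: borel_compact)
    then show "integrable lborel (\<lambda>x. indicator K x + (\<phi> x)\<^sup>2)"
      using Hs_integrable_power2[OF \<phi>(1)] by simp
    have "\<bar>\<phi> x\<bar> \<le> indicator K x + (\<phi> x)\<^sup>2" for x
    proof (cases "x \<in> K")
      case True
      have "0 \<le> (\<phi> x - 1 / 2)\<^sup>2" by simp
      then show ?thesis using True \<phi>(2)[of x] by (simp add: power2_eq_square algebra_simps)
    qed (simp add: K(3))
    then show "AE x in lborel. norm (\<phi> x) \<le> norm (indicator K x + (\<phi> x)\<^sup>2)" by (intro AE_I2) simp
  qed simp
  have e4: "0 < e / 4" using e by simp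
  obtain d1 where d1: "0 < d1" "(\<Union>x\<in>K. cball x d1) \<subseteq> D"
    using compact_subset_open_imp_cball_epsilon_subset[OF K(1) D K(2)] by metis
  obtain d2 where d2: "0 < d2" "\<And>h. norm h < d2 \<Longrightarrow> (\<integral>\<^sup>+x. ennreal ((\<phi> (x - h) - \<phi> x)\<^sup>2) \<partial>lborel) \<le> ennreal (e / 4)"
    using L2_translation[OF _ Hs_integrable_power2[OF \<phi>(1)] e4] by auto
  have q: "quot s \<phi> \<in> borel_measurable borel" by simp
  obtain d3 where d3: "0 < d3" "\<And>h. norm h < d3 \<Longrightarrow> (\<integral>\<^sup>+z. ennreal ((quot s \<phi> (z - h) - quot s \<phi> z)\<^sup>2) \<partial>lborel) \<le> ennreal (e / 4)"
    using L2_translation[OF q finite_energy_integrable[OF Hs_finite_energy[OF \<phi>(1)]] e4] by auto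
  \<comment> \<open>\<open>d1\<close> keeps the enlarged support inside \<open>D\<close>,
    \<open>d2\<close> controls the L2 error, and \<open>d3\<close> controls the seminorm; it is
    halved because the norm of \<open>(h, h)\<close> is only bounded by twice that of
    \<open>h\<close>.\<close>
  define d where "d = Min {d1, d2, d3 / 2}"
  have d: "0 < d" "d \<le> d1" "d \<le> d2" "d \<le> d3 / 2" using d1 d2 d3 by (auto simp: d_def)
  obtain \<rho> :: "'a \<Rightarrow> real" where \<rho>: "\<And>k. C_k k \<rho>" "\<And>x. 0 \<le> \<rho> x" "\<And>x. d \<le> norm x \<Longrightarrow> \<rho> x = 0"
      "integrable lborel \<rho>" "(LINT x|lborel. \<rho> x) = 1"
    using ex_mollifier[OF d(1)] by auto
  have c\<rho>: "continuous_on UNIV \<rho>" using \<rho>(1)[of 0] by simp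
  then have [measurable]: "\<rho> \<in> borel_measurable borel" by (rule borel_measurable_continuous_onI)
  obtain B where B: "\<And>x. \<bar>\<rho> x\<bar> \<le> B"
    using continuous_compact_support_bounded[of \<rho> d] c\<rho> \<rho>(3) by auto
  define \<psi> where "\<psi> x = (LINT y|lborel. \<rho> (x - y) * \<phi> y)" for x
  have "(\<Union>x\<in>K. cball x d) \<subseteq> D" using d1(2) d(2) by force
  then have \<psi>T: "\<psi> \<in> test_functions D"
    unfolding \<psi>_def using \<rho>(1,3) i\<phi> K by (intro mollified_test_function) auto
  have \<psi>0: "0 \<le> \<psi> x" for x
    unfolding \<psi>_def using \<rho>(2) \<phi>(2) by (intro Bochner_Integration.integral_nonneg) simp
  have ih: "integrable lborel (\<lambda>h. \<rho> h * \<phi> (x - h))" and \<psi>h: "\<psi> x = (LINT h|lborel. \<rho> h * \<phi> (x - h))" for x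
  proof -
    have 1: "integrable lborel (\<lambda>y. \<rho> (x - y) * \<phi> y)" by (rule integrable_bounded_mult[OF _ i\<phi> B]) simp
    have "integrable (distr lborel borel (\<lambda>y. x - y)) (\<lambda>y. \<rho> (x - y) * \<phi> y)"
      using 1 by (simp only: lborel_distr_reflect)
    then show "integrable lborel (\<lambda>h. \<rho> h * \<phi> (x - h))" by (simp add: integrable_distr_eq)
    have "\<psi> x = (LINT y|distr lborel borel (\<lambda>y. x - y). \<rho> (x - y) * \<phi> y)"
      unfolding \<psi>_def by (simp only: lborel_distr_reflect)
    then show "\<psi> x = (LINT h|lborel. \<rho> h * \<phi> (x - h))" by (simp add: integral_distr)
  qed
  have id: "integrable lborel (\<lambda>h. \<rho> h * (\<phi> x - \<phi> (x - h)))" for x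
    using ih[of x] \<rho>(4) by (simp add: right_diff_distrib)
  have \<psi>d: "\<phi> x - \<psi> x = (LINT h|lborel. \<rho> h * (\<phi> x - \<phi> (x - h)))" for x
    using ih[of x] \<rho>(4,5) by (simp add: right_diff_distrib \<psi>h)
  have A: "(\<integral>\<^sup>+x. ennreal ((\<phi> x - \<psi> x)\<^sup>2) \<partial>lborel) \<le> ennreal (e / 4)"
    by (rule averaged_translation_bound[where F=\<phi> and v="\<lambda>h. h" and d=d, OF \<rho>(2,4,5,3)])
      (use d2(2) d(3) id \<psi>d e4 in auto)
  have shift: "quot s \<phi> (z - (h, h)) = (\<phi> (fst z - h) - \<phi> (snd z - h)) / norm (fst z - snd z) powr ((real DIM('a) + 2 * s) / 2)" for z h
    unfolding quot_def by simp
  have qd: "\<rho> h * (quot s \<phi> z - quot s \<phi> (z - (h, h))) =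
      (\<rho> h * (\<phi> (fst z) - \<phi> (fst z - h)) - \<rho> h * (\<phi> (snd z) - \<phi> (snd z - h))) / norm (fst z - snd z) powr ((real DIM('a) + 2 * s) / 2)" for z h
    unfolding shift unfolding quot_def by (simp add: diff_divide_distrib[symmetric] algebra_simps)
  have C: "(\<integral>\<^sup>+z. ennreal ((quot s (\<lambda>x. \<phi> x - \<psi> x) z)\<^sup>2) \<partial>lborel) \<le> ennreal (e / 4)"
  proof (rule averaged_translation_bound[where F="quot s \<phi>" and v="\<lambda>h. (h, h)" and d=d, OF \<rho>(2,4,5,3) q])
    show "(\<lambda>h::'a. (h, h)) \<in> borel \<rightarrow>\<^sub>M borel"
      by (intro borel_measurable_continuous_onI continuous_intros)
    show "(\<integral>\<^sup>+z. ennreal ((quot s \<phi> (z - (h, h)) - quot s \<phi> z)\<^sup>2) \<partial>lborel) \<le> ennreal (e / 4)" if "norm h < d" for h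
    proof (rule d3(2))
      show "norm (h, h) < d3" using norm_Pair_le[of h h] that d(4) by linarith
    qed
    show "integrable lborel (\<lambda>h. \<rho> h * (quot s \<phi> z - quot s \<phi> (z - (h, h))))" for z
      unfolding qd using id[of "fst z"] id[of "snd z"] by simp
    show "quot s (\<lambda>x. \<phi> x - \<psi> x) z = (LINT h|lborel. \<rho> h * (quot s \<phi> z - quot s \<phi> (z - (h, h))))" for z
      unfolding qd using id[of "fst z"] id[of "snd z"] by (simp add: quot_def \<psi>d)
  qed (use e4 in auto)
  have "(\<integral>\<^sup>+x. ennreal ((\<phi> x - \<psi> x)\<^sup>2) \<partial>lborel) + gagliardo_sq s (\<lambda>x. \<phi> x - \<psi> x) \<le> ennreal (e / 4) + ennreal (e / 4)"
    unfolding gagliardo_sq_quot by (rule add_mono[OF A C])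
  also have "\<dots> < ennreal e" using e by (simp add: ennreal_less_iff flip: ennreal_plus)
  finally show ?thesis using \<psi>T \<psi>0 by blast
qed

section \<open>Limits in the energy norm\<close>

lemma Hs_cmult: "u \<in> Hs s \<Longrightarrow> (\<lambda>x. c * u x) \<in> Hs s"
  by (auto simp: Hs_iff finite_energy_iff quot_cmult power_mult_distrib)

lemma Hs_set_integrable:
  fixes \<phi> :: "'a::euclidean_space \<Rightarrow> real"
  assumes D: "D \<in> sets borel" "emeasure lborel D < \<infinity>" and \<phi>: "\<phi> \<in> Hs s"
    and g: "g \<in> borel_measurable borel" "AE x in lborel. x \<in> D \<longrightarrow> \<bar>g x\<bar> \<le> 1"
  shows "set_integrable lborel D (\<lambda>x. g x * \<phi> x)"
  unfolding set_integrable_def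
proof (rule Bochner_Integration.integrable_bound[of _ "\<lambda>x. indicator D x + (\<phi> x)\<^sup>2"])
  note Hs_measurable[OF \<phi>, measurable] g(1)[measurable] D(1)[measurable]
  have "integrable lborel (indicator D :: 'a \<Rightarrow> real)"
    using D by (intro integrable_real_indicator) auto
  then show "integrable lborel (\<lambda>x. indicator D x + (\<phi> x)\<^sup>2)"
    using Hs_integrable_power2[OF \<phi>] by simp
  have sq: "\<bar>t\<bar> \<le> 1 + t\<^sup>2" for t :: real
  proof -
    have "0 \<le> (\<bar>t\<bar> - 1 / 2)\<^sup>2" by simp
    then show ?thesis by (simp add: power2_eq_square algebra_simps)
  qed
  show "AE x in lborel. norm (indicator D x *\<^sub>R (g x * \<phi> x)) \<le> norm (indicator D x + (\<phi> x)\<^sup>2)"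
    using g(2)
  proof eventually_elim
    case (elim x)
    show ?case
    proof (cases "x \<in> D")
      case True
      then have "\<bar>g x\<bar> * \<bar>\<phi> x\<bar> \<le> 1 * \<bar>\<phi> x\<bar>" using elim by (intro mult_right_mono) auto
      then show ?thesis using True sq[of "\<phi> x"] by (simp add: abs_mult)
    qed simp
  qed
  show "(\<lambda>x. indicator D x *\<^sub>R (g x * \<phi> x)) \<in> borel_measurable lborel" by measurable
qed

lemma Hs_set_integrable_self:
  fixes \<phi> :: "'a::euclidean_space \<Rightarrow> real"
  assumes "D \<in> sets borel" "emeasure lborel D < \<infinity>" "\<phi> \<in> Hs s"
  shows "set_integrable lborel D \<phi>"
  using Hs_set_integrable[OF assms, of "\<lambda>x. 1"] by simp

definition energy_tendsto :: "real \<Rightarrow> (nat \<Rightarrow> 'a::euclidean_space \<Rightarrow> real) \<Rightarrow> ('a \<Rightarrow> real) \<Rightarrow> bool" where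
  "energy_tendsto s \<psi> \<phi> \<longleftrightarrow>
     (\<lambda>j. (\<integral>\<^sup>+x. ennreal ((\<phi> x - \<psi> j x)\<^sup>2) \<partial>lborel) + gagliardo_sq s (\<lambda>x. \<phi> x - \<psi> j x)) \<longlonglongrightarrow> 0"

lemma ex_energy_tendsto:
  assumes "\<And>e. 0 < e \<Longrightarrow> \<exists>\<psi>\<in>S. P \<psi> \<and>
    (\<integral>\<^sup>+x. ennreal ((\<phi> x - \<psi> x)\<^sup>2) \<partial>lborel) + gagliardo_sq s (\<lambda>x. \<phi> x - \<psi> x) < ennreal e"
  shows "\<exists>\<psi>. (\<forall>j. \<psi> j \<in> S \<and> P (\<psi> j)) \<and> energy_tendsto s \<psi> \<phi>"
proof -
  let ?N = "\<lambda>\<psi>. (\<integral>\<^sup>+x. ennreal ((\<phi> x - \<psi> x)\<^sup>2) \<partial>lborel) + gagliardo_sq s (\<lambda>x. \<phi> x - \<psi> x)"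
  have "\<forall>j. \<exists>\<psi>. \<psi> \<in> S \<and> P \<psi> \<and> ?N \<psi> < ennreal (inverse (real (Suc j)))"
    using assms by (metis inverse_positive_iff_positive of_nat_0_less_iff zero_less_Suc)
  from choice[OF this] obtain \<psi> where \<psi>: "\<And>j. \<psi> j \<in> S \<and> P (\<psi> j) \<and> ?N (\<psi> j) < ennreal (inverse (real (Suc j)))"
    by blast
  have "(\<lambda>j. ?N (\<psi> j)) \<longlonglongrightarrow> 0"
  proof (rule tendsto_sandwich[of "\<lambda>_. 0" _ _ "\<lambda>j. ennreal (inverse (real (Suc j)))"])
    show "(\<lambda>j. ennreal (inverse (real (Suc j)))) \<longlonglongrightarrow> 0"
      using tendsto_ennrealI[OF LIMSEQ_inverse_real_of_nat] by simp
  qed (use \<psi> in \<open>auto intro!: always_eventually less_imp_le\<close>)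
  then show ?thesis using \<psi> unfolding energy_tendsto_def by blast
qed

lemma frac_lap_tendsto:
  assumes V: "finite_energy s V" and \<phi>: "\<phi> \<in> Hs s" and \<psi>: "\<And>j. \<psi> j \<in> Hs s" "energy_tendsto s \<psi> \<phi>"
  shows "(\<lambda>j. frac_lap s V (\<psi> j)) \<longlonglongrightarrow> frac_lap s V \<phi>"
proof -
  let ?d = "\<lambda>j x. \<phi> x - \<psi> j x"
  have fe: "finite_energy s (?d j)" for j
    using \<phi> \<psi> by (intro finite_energy_diff Hs_finite_energy)
  have "(\<lambda>j. ennreal (2 * frac_lap s (?d j) (?d j))) \<longlonglongrightarrow> ennreal 0"
  proof (rule tendsto_sandwich[OF _ _ tendsto_const])
    show "(\<lambda>j. (\<integral>\<^sup>+x. ennreal ((\<phi> x - \<psi> j x)\<^sup>2) \<partial>lborel) + gagliardo_sq s (\<lambda>x. \<phi> x - \<psi> j x)) \<longlonglongrightarrow> ennreal 0"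
      using \<psi>(2) by (simp add: energy_tendsto_def)
  qed (auto intro!: always_eventually simp: gagliardo_sq_frac_lap[OF fe, symmetric] add_increasing)
  then have "(\<lambda>j. 2 * frac_lap s (?d j) (?d j)) \<longlonglongrightarrow> 0"
    by (subst (asm) tendsto_ennreal_iff) (auto simp: frac_lap_self_nonneg)
  from tendsto_mult_left_zero[OF this, of "1/2"]
  have "(\<lambda>j. frac_lap s (?d j) (?d j)) \<longlonglongrightarrow> 0" by simp
  then have "(\<lambda>j. sqrt (frac_lap s V V * frac_lap s (?d j) (?d j))) \<longlonglongrightarrow> sqrt (frac_lap s V V * 0)"
    by (intro tendsto_intros)
  then have l: "(\<lambda>j. sqrt (frac_lap s V V * frac_lap s (?d j) (?d j))) \<longlonglongrightarrow> 0" by simp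
  have "(\<lambda>j. frac_lap s V \<phi> - frac_lap s V (\<psi> j)) \<longlonglongrightarrow> 0"
  proof (rule Lim_null_comparison[OF always_eventually[OF allI] l])
    fix j
    have "(frac_lap s V \<phi> - frac_lap s V (\<psi> j))\<^sup>2 \<le> frac_lap s V V * frac_lap s (?d j) (?d j)"
      using frac_lap_power2_le[OF V fe, of j] V \<phi> \<psi>(1)
      by (simp add: frac_lap_diff_right Hs_finite_energy)
    then show "norm (frac_lap s V \<phi> - frac_lap s V (\<psi> j)) \<le> sqrt (frac_lap s V V * frac_lap s (?d j) (?d j))"
      by (simp add: real_le_rsqrt)
  qed
  from tendsto_diff[OF tendsto_const[of "frac_lap s V \<phi>"] this] show ?thesis by simp
qed

text \<open>Cauchy-Schwarz against the indicator of \<open>D\<close>, which has finite measure,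
  turns L2 convergence into L1 convergence on \<open>D\<close>. The integrands \<open>a\<close> and
  \<open>b j\<close> are left general so that positive and negative parts of
  \<open>\<psi> j\<close>, multiplied by a bounded weight, are covered too.\<close>

lemma set_integral_tendsto:
  fixes \<phi> :: "'a::euclidean_space \<Rightarrow> real"
  assumes D: "D \<in> sets borel" "emeasure lborel D < \<infinity>"
    and \<phi>: "\<phi> \<in> Hs s" and \<psi>: "\<And>j. \<psi> j \<in> Hs s" "energy_tendsto s \<psi> \<phi>"
    and a: "set_integrable lborel D a" "\<And>j. set_integrable lborel D (b j)"
    and ab: "\<And>j. AE x in lborel. x \<in> D \<longrightarrow> \<bar>b j x - a x\<bar> \<le> \<bar>\<phi> x - \<psi> j x\<bar>"
  shows "(\<lambda>j. LINT x:D|lborel. b j x) \<longlonglongrightarrow> (LINT x:D|lborel. a x)"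
proof -
  let ?d = "\<lambda>j x. \<phi> x - \<psi> j x"
  let ?m = "measure lborel D"
  let ?r = "\<lambda>j. LINT x|lborel. (?d j x)\<^sup>2"
  let ?t = "\<lambda>j. LINT x:D|lborel. \<bar>?d j x\<bar>"
  note D(1)[measurable]
  have dH: "?d j \<in> Hs s" for j by (intro Hs_diff \<phi> \<psi>(1))
  have [measurable]: "?d j \<in> borel_measurable borel" for j using Hs_measurable[OF dH] .
  have m: "emeasure lborel D = ennreal ?m" using D(2) by (simp add: emeasure_eq_ennreal_measure less_top)
  have dI: "set_integrable lborel D (\<lambda>x. \<bar>?d j x\<bar>)" for j
    using Hs_set_integrable_self[OF D dH] by (rule set_integrable_abs)
  have r0: "0 \<le> ?r j" for j by (rule Bochner_Integration.integral_nonneg) simp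
  have rN: "(\<integral>\<^sup>+x. ennreal ((?d j x)\<^sup>2) \<partial>lborel) = ennreal (?r j)" for j
    by (rule nn_integral_eq_integral[OF Hs_integrable_power2[OF dH]]) simp
  have t0: "0 \<le> ?t j" for j
    unfolding set_lebesgue_integral_def by (rule Bochner_Integration.integral_nonneg) simp
  have "(\<lambda>j. ennreal (?r j)) \<longlonglongrightarrow> ennreal 0"
  proof (rule tendsto_sandwich[OF _ _ tendsto_const])
    show "(\<lambda>j. (\<integral>\<^sup>+x. ennreal ((\<phi> x - \<psi> j x)\<^sup>2) \<partial>lborel) + gagliardo_sq s (\<lambda>x. \<phi> x - \<psi> j x)) \<longlonglongrightarrow> ennreal 0"
      using \<psi>(2) by (simp add: energy_tendsto_def)
  qed (auto intro!: always_eventually simp: rN add_increasing2)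
  then have "?r \<longlonglongrightarrow> 0" by (subst (asm) tendsto_ennreal_iff) (auto simp: r0)
  then have "(\<lambda>j. sqrt (?m * ?r j)) \<longlonglongrightarrow> sqrt (?m * 0)" by (intro tendsto_intros)
  then have l: "(\<lambda>j. sqrt (?m * ?r j)) \<longlonglongrightarrow> 0" by simp
  have tr: "?t j \<le> sqrt (?m * ?r j)" for j
  proof -
    have "ennreal (?t j) = (\<integral>\<^sup>+x. ennreal (indicator D x *\<^sub>R \<bar>?d j x\<bar>) \<partial>lborel)"
      unfolding set_lebesgue_integral_def using dI[of j] unfolding set_integrable_def
      by (intro nn_integral_eq_integral[symmetric]) auto
    also have "\<dots> = (\<integral>\<^sup>+x. indicator D x * ennreal \<bar>?d j x\<bar> \<partial>lborel)"
      by (intro nn_integral_cong) (auto split: split_indicator)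
    finally have "(ennreal (?t j))\<^sup>2 = (\<integral>\<^sup>+x. indicator D x * ennreal \<bar>?d j x\<bar> \<partial>lborel)\<^sup>2" by simp
    also have "\<dots> \<le> (\<integral>\<^sup>+x. (indicator D x)\<^sup>2 \<partial>lborel) * (\<integral>\<^sup>+x. (ennreal \<bar>?d j x\<bar>)\<^sup>2 \<partial>lborel)"
      by (rule Cauchy_Schwarz_nn_integral) auto
    also have "(\<integral>\<^sup>+x. (indicator D x :: ennreal)\<^sup>2 \<partial>lborel) = (\<integral>\<^sup>+x. indicator D x \<partial>lborel)"
      by (intro nn_integral_cong) (auto split: split_indicator)
    also have "\<dots> = ennreal ?m" by (simp add: m)
    also have "(\<integral>\<^sup>+x. (ennreal \<bar>?d j x\<bar>)\<^sup>2 \<partial>lborel) = ennreal (?r j)"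
      using rN[of j] by (simp add: ennreal_power)
    finally have "ennreal ((?t j)\<^sup>2) \<le> ennreal (?m * ?r j)"
      using t0[of j] by (simp add: ennreal_power ennreal_mult' r0)
    then have "(?t j)\<^sup>2 \<le> ?m * ?r j" by (simp add: r0)
    then show ?thesis by (rule real_le_rsqrt)
  qed
  have "(\<lambda>j. (LINT x:D|lborel. b j x) - (LINT x:D|lborel. a x)) \<longlonglongrightarrow> 0"
  proof (rule Lim_null_comparison[OF always_eventually[OF allI] l])
    fix j
    have "norm ((LINT x:D|lborel. b j x) - (LINT x:D|lborel. a x)) = norm (LINT x:D|lborel. b j x - a x)"
      using a by (simp add: set_integral_diff)
    also have "\<dots> \<le> (LINT x:D|lborel. \<bar>b j x - a x\<bar>)"
      using set_integral_norm_bound[OF set_integral_diff(1)[OF a(2)[of j] a(1)]] by simp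
    also have "\<dots> \<le> ?t j"
      using a ab[of j]
      by (intro set_integral_mono_AE set_integrable_abs set_integral_diff dI) auto
    also note tr[of j]
    finally show "norm ((LINT x:D|lborel. b j x) - (LINT x:D|lborel. a x)) \<le> sqrt (?m * ?r j)" .
  qed
  from tendsto_add[OF this tendsto_const[of "LINT x:D|lborel. a x"]] show ?thesis by simp
qed

text \<open>Zero seminorm makes \<open>u\<close> agree at almost every pair of points, hence almost
  everywhere constant. On a space of infinite measure the only square integrable constant is
  0.\<close>

lemma energy_zero:
  fixes u :: "'a::euclidean_space \<Rightarrow> real"
  assumes u: "u \<in> Hs s" and zero: "frac_lap s u u \<le> 0"
  shows "AE x in lborel. u x = 0"
proof -
  note Hs_measurable[OF u, measurable]
  have "gagliardo_sq s u = 0"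
    using zero by (simp add: gagliardo_sq_frac_lap[OF Hs_finite_energy[OF u]] ennreal_neg)
  then have "AE z in lborel. quot s u z = 0"
    unfolding gagliardo_sq_quot by (subst (asm) nn_integral_0_iff_AE) auto
  then have "AE z in lborel. u (fst z) = u (snd z)"
    by eventually_elim (auto simp: quot_def)
  then have "AE z in lborel \<Otimes>\<^sub>M lborel. u (fst z) = u (snd z)" by (simp only: lborel_prod)
  from lborel_pair.AE_pair[OF this] have "AE x in lborel. AE y in lborel. u x = u y" by simp
  moreover have "ae_filter (lborel :: 'a measure) \<noteq> bot"
    by (simp add: ae_filter_eq_bot_iff emeasure_lborel_UNIV)
  ultimately obtain x where x: "AE y in lborel. u x = u y"
    using eventually_happens' by blast
  define c where "c = u x"
  have c: "AE y in lborel. u y = c" using x by eventually_elim (simp add: c_def)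
  have "(\<integral>\<^sup>+y. ennreal ((u y)\<^sup>2) \<partial>lborel) = (\<integral>\<^sup>+(y::'a). ennreal (c\<^sup>2) \<partial>lborel)"
    using c by (intro nn_integral_cong_AE) auto
  moreover have "(\<integral>\<^sup>+y. ennreal ((u y)\<^sup>2) \<partial>lborel) < \<infinity>"
    using Hs_integrable_power2[OF u] by (simp add: integrable_iff_bounded)
  ultimately have "c = 0" by (auto simp: emeasure_lborel_UNIV ennreal_mult_less_top)
  with c show ?thesis by simp
qed

text \<open>For a test function \<open>\<eta>\<close>, the product \<open>\<eta> * v\<close> is
  \<open>\<eta> * (v - \<alpha>)\<close> plus a multiple of \<open>\<eta>\<close>: the first summand
  is a Lipschitz multiple of an element of \<open>Hs s\<close>, the second is a test function up to
  a constant factor.\<close>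

lemma H_alpha_iff:
  assumes s: "0 < s" "s < 1"
  shows "v \<in> H_alpha s D \<alpha> \<longleftrightarrow> (\<lambda>x. v x - \<alpha>) \<in> Hs0 s D"
proof
  assume v: "(\<lambda>x. v x - \<alpha>) \<in> Hs0 s D"
  have "(\<lambda>x. \<eta> x * v x) \<in> Hs s" if \<eta>: "\<eta> \<in> test_functions UNIV" for \<eta>
  proof -
    obtain L M R where "\<And>x y. \<bar>\<eta> x - \<eta> y\<bar> \<le> L * norm (x - y)" "\<And>x. \<bar>\<eta> x\<bar> \<le> M"
      using test_function_props[OF \<eta>] by auto
    then have "(\<lambda>x. \<eta> x * (v x - \<alpha>)) \<in> Hs s" by (rule Hs_lipschitz_mult[OF s Hs0_D(1)[OF v]])
    from Hs_add[OF this Hs_cmult[OF test_function_Hs[OF s \<eta>], of \<alpha>]]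
    show ?thesis by (simp add: algebra_simps)
  qed
  with v show "v \<in> H_alpha s D \<alpha>" by (simp add: H_alpha_def Hs_loc_def)
qed (simp add: H_alpha_def)

lemma shift_finite_energy:
  assumes "(\<lambda>x. v x - \<alpha>) \<in> Hs s" shows "finite_energy s v"
  using finite_energy_add[OF Hs_finite_energy[OF assms] finite_energy_const[of s \<alpha>]] by simp

section \<open>Nonnegativity of solutions\<close>

lemma approximation_from_within:
  fixes \<phi> :: "'a::euclidean_space \<Rightarrow> real"
  assumes "\<phi> \<in> Hs s" "\<And>x. 0 \<le> \<phi> x" "open D" "compact K" "K \<subseteq> D" "\<And>x. x \<notin> K \<Longrightarrow> \<phi> x = 0"
  shows "\<exists>\<psi>. (\<forall>j. \<psi> j \<in> test_functions D \<and> (\<forall>x. 0 \<le> \<psi> j x)) \<and> energy_tendsto s \<psi> \<phi>"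
  by (rule ex_energy_tendsto[where P="\<lambda>\<psi>. \<forall>x. 0 \<le> \<psi> x"]) (rule test_function_approximation[OF assms])

lemma measurable_indicator_pred [measurable]:
  fixes U :: "'a::euclidean_space \<Rightarrow> real"
  assumes [measurable]: "U \<in> borel_measurable borel"
  shows "(indicator {x. 0 < U x} :: 'a \<Rightarrow> real) \<in> borel_measurable borel"
    "(indicator {x. 0 \<le> U x} :: 'a \<Rightarrow> real) \<in> borel_measurable borel"
    "(indicator {x. U x \<le> 0} :: 'a \<Rightarrow> real) \<in> borel_measurable borel"
  by (intro borel_measurable_indicator, measurable)+

text \<open>\<open>U\<close> is close to \<open>\<alpha>\<close> at infinity in the L2 sense and so
  not square integrable. Since \<open>\<alpha>\<close> is positive, however, the negative part is at
  most \<open>\<bar>U x - \<alpha>\<bar>\<close> and vanishes where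
  \<open>U x = \<alpha>\<close>.\<close>

lemma neg_part_Hs0:
  assumes \<alpha>: "0 < \<alpha>" and U: "(\<lambda>x. U x - \<alpha>) \<in> Hs0 s D"
  shows "(\<lambda>x. max (- U x) 0) \<in> Hs0 s D"
proof -
  have U': "(\<lambda>x. U x - \<alpha>) \<in> Hs s" by (rule Hs0_D(1)[OF U])
  have [measurable]: "U \<in> borel_measurable borel" by (rule finite_energyD[OF shift_finite_energy[OF U']])
  have "(\<lambda>x. max (- U x) 0) \<in> Hs s"
    by (rule Hs_bound[OF _ U' finite_energy_const[of s 0]]) (use \<alpha> in auto)
  moreover have "AE x in lborel. x \<notin> D \<longrightarrow> max (- U x) 0 = 0"
    using Hs0_D(2)[OF U] by eventually_elim (use \<alpha> in auto)
  ultimately show ?thesis by (simp add: Hs0_def)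
qed

lemma frac_lap_pos_neg:
  assumes U: "finite_energy s U"
  shows "frac_lap s U (\<lambda>x. max (- U x) 0) =
    frac_lap s (\<lambda>x. max (U x) 0) (\<lambda>x. max (- U x) 0) - frac_lap s (\<lambda>x. max (- U x) 0) (\<lambda>x. max (- U x) 0)"
proof -
  have p: "finite_energy s (\<lambda>x. max (U x) 0)" "finite_energy s (\<lambda>x. max (- U x) 0)"
    using U by (auto intro!: finite_energy_max finite_energy_minus finite_energy_const)
  have "(\<lambda>x. max (U x) 0 - max (- U x) 0) = U" by (auto simp: fun_eq_iff)
  then show ?thesis using frac_lap_diff_left[OF p p(2)] by simp
qed

text \<open>The pairing of the positive and negative parts cancels, leaving the energy of the
  negative part nonpositive. The upper bound is this pairing with a minus sign, a nonnegative
  number, rather than 0: for (P) the measure of the positive part yields exactly that bound.\<close>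

lemma nonneg_of_neg_part_test:
  assumes \<alpha>: "0 < \<alpha>" and U: "(\<lambda>x. U x - \<alpha>) \<in> Hs0 s D"
    and le: "- frac_lap s U (\<lambda>x. max (- U x) 0) \<le> - frac_lap s (\<lambda>x. max (U x) 0) (\<lambda>x. max (- U x) 0)"
  shows "AE x in lborel. 0 \<le> U x"
proof -
  have "frac_lap s (\<lambda>x. max (- U x) 0) (\<lambda>x. max (- U x) 0) \<le> 0"
    using le frac_lap_pos_neg[OF shift_finite_energy[OF Hs0_D(1)[OF U]]] by linarith
  with Hs0_D(1)[OF neg_part_Hs0[OF \<alpha> U]] have "AE x in lborel. max (- U x) 0 = 0"
    by (rule energy_zero)
  then show ?thesis by eventually_elim linarith
qed

text \<open>A 1-Lipschitz function that vanishes near the complement of \<open>D\<close> and outside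
  a ball. It only has to be Lipschitz, as smoothness is restored by mollification; multiplied by
  \<open>k\<close> it eventually exceeds any given value at each point of \<open>D\<close>, when
  \<open>D\<close> is open and not the whole space.\<close>

definition cutoff :: "'a::euclidean_space set \<Rightarrow> nat \<Rightarrow> 'a \<Rightarrow> real" where
  "cutoff D k x = max 0 (min (infdist x (- D) - 1 / real (Suc k)) (real k - norm x))"

lemma cutoff_lipschitz: "\<bar>cutoff D k x - cutoff D k y\<bar> \<le> 1 * norm (x - y)"
proof -
  have "\<bar>infdist x (- D) - infdist y (- D)\<bar> \<le> norm (x - y)"
    using infdist_triangle_abs[of x "- D" y] by (simp add: dist_norm)
  moreover have "\<bar>norm x - norm y\<bar> \<le> norm (x - y)" by (rule norm_triangle_ineq3)
  ultimately show ?thesis unfolding cutoff_def by linarith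
qed

lemma cutoff_nonneg: "0 \<le> cutoff D k x" by (simp add: cutoff_def)

lemma cutoff_support:
  fixes D :: "'a::euclidean_space set"
  assumes D: "open D"
  shows "compact {x. 1 / real (Suc k) \<le> infdist x (- D) \<and> norm x \<le> real k}" (is "compact ?K")
    and "{x. 1 / real (Suc k) \<le> infdist x (- D) \<and> norm x \<le> real k} \<subseteq> D"
    and "\<And>x. x \<notin> {x. 1 / real (Suc k) \<le> infdist x (- D) \<and> norm x \<le> real k} \<Longrightarrow> cutoff D k x = 0"
proof -
  have "closed ?K" by (intro closed_Collect_conj closed_Collect_le continuous_intros)
  moreover have "bounded ?K" by (rule bounded_subset[OF bounded_cball[of 0 "real k"]]) auto
  ultimately show "compact ?K" by (simp add: compact_eq_bounded_closed)
  show "?K \<subseteq> D"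
  proof
    fix x assume "x \<in> ?K"
    then have "0 < infdist x (- D)" by (auto intro: less_le_trans[rotated])
    then show "x \<in> D" by (metis ComplI infdist_zero less_irrefl)
  qed
qed (auto simp: cutoff_def)

lemma cutoff_Hs:
  assumes "0 < s" "s < 1" shows "cutoff D k \<in> Hs s"
proof (rule Hs_lipschitz_compact_support[OF assms, where L=1 and M="real k" and R="real k"])
  show "\<bar>cutoff D k x\<bar> \<le> real k" for x
    using norm_ge_zero[of x] unfolding cutoff_def by linarith
  show "real k < norm x \<Longrightarrow> cutoff D k x = 0" for x unfolding cutoff_def by linarith
qed (rule cutoff_lipschitz)

lemma cutoff_tendsto:
  fixes D :: "'a::euclidean_space set"
  assumes D: "open D" "D \<noteq> UNIV" "x \<in> D"
  shows "(\<lambda>k. min c (real k * cutoff D k x)) \<longlonglongrightarrow> c"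
proof -
  define \<delta> where "\<delta> = infdist x (- D)"
  have \<delta>: "0 < \<delta>"
  proof -
    have "closed (- D)" "- D \<noteq> {}" "x \<notin> - D" using D by auto
    then show ?thesis unfolding \<delta>_def using in_closed_iff_infdist_zero[of "- D" x] infdist_nonneg[of x "- D"] by linarith
  qed
  have ev: "eventually (\<lambda>k. a < real k) sequentially" for a
    using filterlim_real_sequentially by (simp add: filterlim_at_top_dense)
  \<comment> \<open>The first bound gives \<open>1 / real (Suc k) \<le> \<delta> / 2\<close>, the
    second gives \<open>1 \<le> real k - norm x\<close>, and the last two make
    \<open>real k * min (\<delta> / 2) 1\<close> at least \<open>c\<close>.\<close>
  have "eventually (\<lambda>k. 2 / \<delta> < real k \<and> norm x + 1 < real k \<and> 2 * \<bar>c\<bar> / \<delta> < real k \<and> \<bar>c\<bar> < real k) sequentially"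
    by (intro eventually_conj ev)
  then have "eventually (\<lambda>k. min c (real k * cutoff D k x) = c) sequentially"
  proof eventually_elim
    case (elim k)
    have "1 / real (Suc k) \<le> \<delta> / 2"
      using elim \<delta> by (simp add: field_simps)
    then have "min (\<delta> / 2) 1 \<le> cutoff D k x" using elim unfolding cutoff_def \<delta>_def by linarith
    then have "real k * min (\<delta> / 2) 1 \<le> real k * cutoff D k x" by (intro mult_left_mono) auto
    moreover have "c \<le> real k * min (\<delta> / 2) 1"
    proof -
      have "\<bar>c\<bar> \<le> real k * (\<delta> / 2)" using elim \<delta> by (simp add: field_simps)
      then have "c \<le> real k * (\<delta> / 2)" by linarith
      moreover have "c \<le> real k * 1" using elim by linarith
      ultimately show ?thesis by (simp add: min_def)
    qed
    ultimately show ?case by simp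
  qed
  then show ?thesis by (rule tendsto_eventually)
qed

text \<open>A compact support inside \<open>D\<close> leaves room for mollification, which preserves
  nonnegativity, so the bound passes to the limit without any density of test functions in
  \<open>Hs0 s D\<close>.\<close>

lemma le_neg_frac_lap_compact_support:
  fixes \<phi> :: "'a::euclidean_space \<Rightarrow> real"
  assumes s: "0 < s" "s < 1" and D: "open D" "emeasure lborel D < \<infinity>"
    and V: "finite_energy s V" and m: "m \<in> borel_measurable borel" "AE x in lborel. x \<in> D \<longrightarrow> \<bar>m x\<bar> \<le> 1"
    and test: "\<And>\<psi>. \<psi> \<in> test_functions D \<Longrightarrow> (\<forall>x. 0 \<le> \<psi> x) \<Longrightarrow> (LINT x:D|lborel. m x * \<psi> x) \<le> - frac_lap s V \<psi>"
    and \<phi>: "\<phi> \<in> Hs s" "\<And>x. 0 \<le> \<phi> x" and K: "compact K" "K \<subseteq> D" "\<And>x. x \<notin> K \<Longrightarrow> \<phi> x = 0"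
  shows "(LINT x:D|lborel. m x * \<phi> x) \<le> - frac_lap s V \<phi>"
proof -
  have Db: "D \<in> sets borel" using D(1) by simp
  obtain \<psi> where \<psi>: "\<And>j. \<psi> j \<in> test_functions D" "\<And>j x. 0 \<le> \<psi> j x" "energy_tendsto s \<psi> \<phi>"
    using approximation_from_within[OF \<phi> D(1) K] by blast
  have \<psi>H: "\<psi> j \<in> Hs s" for j by (rule test_function_Hs[OF s \<psi>(1)])
  have "(\<lambda>j. LINT x:D|lborel. m x * \<psi> j x) \<longlonglongrightarrow> (LINT x:D|lborel. m x * \<phi> x)"
  proof (rule set_integral_tendsto[OF Db D(2) \<phi>(1) \<psi>H \<psi>(3)])
    show "AE x in lborel. x \<in> D \<longrightarrow> \<bar>m x * \<psi> j x - m x * \<phi> x\<bar> \<le> \<bar>\<phi> x - \<psi> j x\<bar>" for j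
      using m(2)
    proof (eventually_elim, intro impI)
      fix x assume "x \<in> D \<longrightarrow> \<bar>m x\<bar> \<le> 1" "x \<in> D"
      then have "\<bar>m x\<bar> * \<bar>\<phi> x - \<psi> j x\<bar> \<le> 1 * \<bar>\<phi> x - \<psi> j x\<bar>" by (intro mult_right_mono) auto
      moreover have "\<bar>m x * \<psi> j x - m x * \<phi> x\<bar> = \<bar>m x\<bar> * \<bar>\<phi> x - \<psi> j x\<bar>"
        by (simp add: abs_mult[symmetric] right_diff_distrib abs_minus_commute)
      ultimately show "\<bar>m x * \<psi> j x - m x * \<phi> x\<bar> \<le> \<bar>\<phi> x - \<psi> j x\<bar>" by simp
    qed
    show "set_integrable lborel D (\<lambda>x. m x * \<psi> j x)" for j
      by (rule Hs_set_integrable[OF Db D(2) \<psi>H m])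
    show "set_integrable lborel D (\<lambda>x. m x * \<phi> x)"
      by (rule Hs_set_integrable[OF Db D(2) \<phi>(1) m])
  qed
  moreover have "(\<lambda>j. - frac_lap s V (\<psi> j)) \<longlonglongrightarrow> - frac_lap s V \<phi>"
    by (intro tendsto_minus frac_lap_tendsto[OF V \<phi>(1) \<psi>H \<psi>(3)])
  ultimately show ?thesis
    by (rule LIMSEQ_le) (use test \<psi>(1,2) in auto)
qed

text \<open>No density of test functions in \<open>Hs0 s D\<close> is available here. It is not needed: \<open>\<phi>\<close> is
  approximated from below by \<open>min \<phi> (k * cutoff D k)\<close>, and the error is supported where \<open>V\<close>
  vanishes, so it only increases the right-hand side.\<close>

lemma le_neg_frac_lap_disjoint:
  fixes \<phi> :: "'a::euclidean_space \<Rightarrow> real"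
  assumes s: "0 < s" "s < 1" and D: "open D" "emeasure lborel D < \<infinity>"
    and V: "finite_energy s V" and m: "m \<in> borel_measurable borel" "AE x in lborel. x \<in> D \<longrightarrow> \<bar>m x\<bar> \<le> 1"
    and test: "\<And>\<psi>. \<psi> \<in> test_functions D \<Longrightarrow> (\<forall>x. 0 \<le> \<psi> x) \<Longrightarrow> (LINT x:D|lborel. m x * \<psi> x) \<le> - frac_lap s V \<psi>"
    and \<phi>: "\<phi> \<in> Hs s" "\<And>x. 0 \<le> \<phi> x"
    and disjoint: "\<And>x. 0 \<le> V x" "\<And>x. V x * \<phi> x = 0"
  shows "(LINT x:D|lborel. m x * \<phi> x) \<le> - frac_lap s V \<phi>"
proof -
  have Db [measurable]: "D \<in> sets borel" using D(1) by simp
  note m(1)[measurable]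
  \<comment> \<open>The distance to the empty set is 0 by convention, so for \<open>D = UNIV\<close>
    every cutoff would vanish identically; finite measure excludes this case.\<close>
  have DU: "D \<noteq> UNIV" using D(2) by (auto simp: emeasure_lborel_UNIV)
  define \<phi>' where "\<phi>' k x = min (\<phi> x) (real k * cutoff D k x)" for k x
  have \<phi>0: "0 \<le> \<phi>' k x" "\<phi>' k x \<le> \<phi> x" for k x
    using \<phi>(2) cutoff_nonneg[of D k x] by (auto simp: \<phi>'_def)
  have \<phi>H: "\<phi>' k \<in> Hs s" for k
  proof (rule Hs_bound[OF _ \<phi>(1)])
    have c: "(\<lambda>x. real k * cutoff D k x) \<in> Hs s" by (rule Hs_cmult[OF cutoff_Hs[OF s]])
    then show "finite_energy s (\<lambda>x. real k * cutoff D k x)" by (rule Hs_finite_energy)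
    show "\<phi>' k \<in> borel_measurable borel"
      unfolding \<phi>'_def using Hs_measurable[OF \<phi>(1)] Hs_measurable[OF c] by measurable
    show "\<bar>\<phi>' k x\<bar> \<le> \<bar>\<phi> x\<bar>" for x using \<phi>0[of k x] by simp
  qed (auto simp: \<phi>'_def)
  have "(LINT x:D|lborel. m x * \<phi>' k x) \<le> - frac_lap s V \<phi>" for k
  proof -
    have "(LINT x:D|lborel. m x * \<phi>' k x) \<le> - frac_lap s V (\<phi>' k)"
    proof (rule le_neg_frac_lap_compact_support[OF s D V m test \<phi>H \<phi>0(1) cutoff_support(1,2)[OF D(1)]])
      show "\<phi>' k x = 0" if "x \<notin> {x. 1 / real (Suc k) \<le> infdist x (- D) \<and> norm x \<le> real k}" for x
        using cutoff_support(3)[OF D(1) that] \<phi>(2)[of x] by (simp add: \<phi>'_def)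
    qed
    moreover have "frac_lap s V (\<lambda>x. \<phi> x - \<phi>' k x) \<le> 0"
    proof (rule frac_lap_nonpos_of_disjoint)
      fix x
      show "V x * (\<phi> x - \<phi>' k x) = 0"
        using disjoint(2)[of x] \<phi>0[of k x] by auto
    qed (use disjoint \<phi>0 in auto)
    ultimately show ?thesis
      using V \<phi>H[of k] \<phi>(1) by (simp add: frac_lap_diff_right Hs_finite_energy)
  qed
  moreover have "(\<lambda>k. LINT x:D|lborel. m x * \<phi>' k x) \<longlonglongrightarrow> (LINT x:D|lborel. m x * \<phi> x)"
    unfolding set_lebesgue_integral_def
  proof (rule integral_dominated_convergence[where w="\<lambda>x. \<bar>indicator D x *\<^sub>R (m x * \<phi> x)\<bar>"])
    show "integrable lborel (\<lambda>x. \<bar>indicator D x *\<^sub>R (m x * \<phi> x)\<bar>)"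
      using Hs_set_integrable[OF Db D(2) \<phi>(1) m] unfolding set_integrable_def by (rule integrable_abs)
    show "AE x in lborel. (\<lambda>k. indicator D x *\<^sub>R (m x * \<phi>' k x)) \<longlonglongrightarrow> indicator D x *\<^sub>R (m x * \<phi> x)"
    proof (rule AE_I2)
      fix x
      show "(\<lambda>k. indicator D x *\<^sub>R (m x * \<phi>' k x)) \<longlonglongrightarrow> indicator D x *\<^sub>R (m x * \<phi> x)"
      proof (cases "x \<in> D")
        case True
        then show ?thesis
          unfolding \<phi>'_def by (intro tendsto_intros cutoff_tendsto D(1) DU)
      qed simp
    qed
    show "AE x in lborel. norm (indicator D x *\<^sub>R (m x * \<phi>' k x)) \<le> \<bar>indicator D x *\<^sub>R (m x * \<phi> x)\<bar>" for k
    proof (rule AE_I2)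
      fix x
      show "norm (indicator D x *\<^sub>R (m x * \<phi>' k x)) \<le> \<bar>indicator D x *\<^sub>R (m x * \<phi> x)\<bar>"
        using \<phi>0[of k x] by (auto simp: abs_mult intro!: mult_left_mono split: split_indicator)
    qed
  qed (use Hs_measurable[OF \<phi>(1)] Hs_measurable[OF \<phi>H] in measurable)
  ultimately show ?thesis by (intro LIMSEQ_le_const2) auto
qed

text \<open>The infimum of the measures lies below Lebesgue measure. Comparing both on the set where
  \<open>m\<close> exceeds 1 and cancelling the finite measure of that set leaves the integral of
  \<open>m - 1\<close> over it equal to 0.\<close>

lemma min_neg_frac_lap_one_le_one:
  fixes D :: "'a::euclidean_space set"
  assumes D: "D \<in> sets borel" "emeasure lborel D < \<infinity>" and m: "min_neg_frac_lap_one s D V m"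
  shows "AE x in lborel. x \<in> D \<longrightarrow> \<bar>m x\<bar> \<le> 1"
proof -
  let ?L = "restrict_space lborel D :: 'a measure"
  have [measurable]: "m \<in> borel_measurable borel" and m0: "AE x in lborel. x \<in> D \<longrightarrow> 0 \<le> m x"
    using m unfolding min_neg_frac_lap_one_def by (auto elim!: eventually_mono)
  obtain \<mu> where "density ?L (\<lambda>x. ennreal (m x)) = inf \<mu> ?L"
    using m unfolding min_neg_frac_lap_one_def by blast
  then have le: "density ?L (\<lambda>x. ennreal (m x)) \<le> ?L" by simp
  have mL [measurable]: "m \<in> borel_measurable ?L" by (intro measurable_restrict_space1) simp
  let ?A = "{x\<in>space ?L. 1 < m x}"
  have A [measurable]: "?A \<in> sets ?L" by measurable
  have eq: "emeasure (density ?L (\<lambda>x. ennreal (m x))) ?A = (\<integral>\<^sup>+x. ennreal (m x) * indicator ?A x \<partial>?L)"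
    by (subst emeasure_density) auto
  have "(\<integral>\<^sup>+x. ennreal (m x) * indicator ?A x \<partial>?L) \<le> emeasure ?L ?A"
    unfolding eq[symmetric] by (rule le_measureD3[OF le]) simp
  have fin: "emeasure ?L ?A < \<infinity>"
  proof -
    have "emeasure ?L ?A \<le> emeasure ?L D" using A sets.sets_into_space[OF A] D
      by (intro emeasure_mono) (auto simp: space_restrict_space sets_restrict_space_iff)
    also have "\<dots> = emeasure lborel D" using D by (subst emeasure_restrict_space) auto
    finally show ?thesis using D(2) by simp
  qed
  have "(\<integral>\<^sup>+x. ennreal (m x - 1) * indicator ?A x \<partial>?L) + emeasure ?L ?A =
      (\<integral>\<^sup>+x. ennreal (m x - 1) * indicator ?A x + indicator ?A x \<partial>?L)"
    by (subst nn_integral_add) auto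
  also have "\<dots> = (\<integral>\<^sup>+x. ennreal (m x) * indicator ?A x \<partial>?L)"
  proof (rule nn_integral_cong)
    fix x
    have "ennreal (m x - 1) + 1 = ennreal (m x)" if "1 < m x"
      using that ennreal_plus[of "m x - 1" 1] by simp
    then show "ennreal (m x - 1) * indicator ?A x + indicator ?A x = ennreal (m x) * indicator ?A x"
      by (auto split: split_indicator)
  qed
  also have "\<dots> \<le> emeasure ?L ?A" by fact
  finally have "(\<integral>\<^sup>+x. ennreal (m x - 1) * indicator ?A x \<partial>?L) + emeasure ?L ?A \<le> 0 + emeasure ?L ?A" by simp
  then have "(\<integral>\<^sup>+x. ennreal (m x - 1) * indicator ?A x \<partial>?L) = 0"
    using fin by (auto simp: ennreal_add_left_cancel_le add.commute)
  then have "AE x in ?L. ennreal (m x - 1) * indicator ?A x = 0"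
    by (subst (asm) nn_integral_0_iff_AE) auto
  then have "AE x in lborel. x \<in> D \<longrightarrow> ennreal (m x - 1) * indicator ?A x = 0"
    using D by (subst (asm) AE_restrict_space_iff) auto
  with m0 show ?thesis
  proof eventually_elim
    case (elim x)
    then show ?case by (auto simp: space_restrict_space indicator_def ennreal_eq_0_iff split: if_splits)
  qed
qed

text \<open>The infimum also lies below \<open>\<mu>\<close>, so integrating the nonnegative
  \<open>\<psi>\<close> against both measures gives the bound.\<close>

lemma min_neg_frac_lap_one_test:
  fixes D :: "'a::euclidean_space set"
  assumes D: "open D" and m: "min_neg_frac_lap_one s D V m"
    and \<psi>: "\<psi> \<in> test_functions D" "\<forall>x. 0 \<le> \<psi> x"
    and int: "set_integrable lborel D (\<lambda>x. m x * \<psi> x)"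
  shows "(LINT x:D|lborel. m x * \<psi> x) \<le> - frac_lap s V \<psi>"
proof -
  let ?L = "restrict_space lborel D :: 'a measure"
  have Db [measurable]: "D \<in> sets borel" using D by simp
  have [measurable]: "m \<in> borel_measurable borel" and m0: "AE x in lborel. x \<in> D \<longrightarrow> 0 \<le> m x"
    using m unfolding min_neg_frac_lap_one_def by (auto elim!: eventually_mono)
  obtain \<mu> where \<mu>: "neg_frac_lap_measure s D V \<mu>" and inf: "density ?L (\<lambda>x. ennreal (m x)) = inf \<mu> ?L"
    using m unfolding min_neg_frac_lap_one_def by blast
  have le: "density ?L (\<lambda>x. ennreal (m x)) \<le> \<mu>" unfolding inf by simp
  have s\<mu>: "sets \<mu> = sets (restrict_space borel D)"
    and K\<mu>: "\<And>K. compact K \<Longrightarrow> K \<subseteq> D \<Longrightarrow> emeasure \<mu> K < \<infinity>"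
    and t\<mu>: "(LINT x|\<mu>. \<psi> x) = - frac_lap s V \<psi>"
    using \<mu> \<psi>(1) unfolding neg_frac_lap_measure_def by auto
  have sL: "sets ?L = sets (restrict_space borel D)" by (rule sets_restrict_space_cong) simp
  have "C_k 0 \<psi>" using \<psi>(1) unfolding test_functions_def by blast
  then have [measurable]: "\<psi> \<in> borel_measurable borel" by (auto intro: borel_measurable_continuous_onI)
  have \<psi>L [measurable]: "\<psi> \<in> borel_measurable ?L" "m \<in> borel_measurable ?L"
    by (intro measurable_restrict_space1; simp)+
  have \<psi>\<mu> [measurable]: "\<psi> \<in> borel_measurable \<mu>"
    using \<psi>L(1) measurable_cong_sets[OF s\<mu>[folded sL] refl] by blast
  let ?K = "closure {x. \<psi> x \<noteq> 0}"
  have K: "compact ?K" "?K \<subseteq> D" using \<psi>(1) by (auto simp: test_functions_def)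
  obtain M where M: "\<And>x. \<bar>\<psi> x\<bar> \<le> M" using test_function_props[OF \<psi>(1)] by auto
  \<comment> \<open>Finiteness of \<open>\<mu>\<close> on compact sets makes \<open>\<psi>\<close>
    integrable. This identifies the Bochner integral, whose default value is 0, with the nonnegative
    integral in which the measures are compared.\<close>
  have "integrable \<mu> (indicator ?K :: 'a \<Rightarrow> real)"
  proof (rule integrable_real_indicator)
    show "?K \<in> sets \<mu>" unfolding s\<mu> using K by (auto simp: sets_restrict_space_iff)
    show "emeasure \<mu> ?K < \<infinity>" using K\<mu>[OF K] .
  qed
  then have "integrable \<mu> \<psi>"
  proof (rule Bochner_Integration.integrable_bound[OF integrable_mult_right[of M]])
    have "\<bar>\<psi> x\<bar> \<le> \<bar>M * indicator ?K x\<bar>" for x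
    proof (cases "x \<in> ?K")
      case False
      then have "\<psi> x = 0" using closure_subset[of "{x. \<psi> x \<noteq> 0}"] by auto
      then show ?thesis by simp
    qed (use M[of x] in simp)
    then show "AE x in \<mu>. norm (\<psi> x) \<le> norm (M * indicator ?K x)" by simp
  qed simp
  then have \<mu>eq: "(\<integral>\<^sup>+x. ennreal (\<psi> x) \<partial>\<mu>) = ennreal (LINT x|\<mu>. \<psi> x)" and \<mu>0: "0 \<le> (LINT x|\<mu>. \<psi> x)"
    using \<psi>(2) by (auto intro!: nn_integral_eq_integral Bochner_Integration.integral_nonneg)
  have "ennreal (LINT x:D|lborel. m x * \<psi> x) = (\<integral>\<^sup>+x. ennreal (indicator D x *\<^sub>R (m x * \<psi> x)) \<partial>lborel)"
    unfolding set_lebesgue_integral_def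
  proof (rule nn_integral_eq_integral[symmetric])
    show "integrable lborel (\<lambda>x. indicator D x *\<^sub>R (m x * \<psi> x))" using int by (simp add: set_integrable_def)
    show "AE x in lborel. 0 \<le> indicator D x *\<^sub>R (m x * \<psi> x)"
      using m0 by eventually_elim (use \<psi>(2) in \<open>auto split: split_indicator\<close>)
  qed
  also have "\<dots> = (\<integral>\<^sup>+x. (ennreal (m x) * ennreal (\<psi> x)) * indicator D x \<partial>lborel)"
    using m0 by (intro nn_integral_cong_AE, eventually_elim)
      (use \<psi>(2) in \<open>auto simp: ennreal_mult split: split_indicator\<close>)
  also have "\<dots> = (\<integral>\<^sup>+x. ennreal (m x) * ennreal (\<psi> x) \<partial>?L)"
    by (subst nn_integral_restrict_space) auto
  also have "\<dots> = (\<integral>\<^sup>+x. ennreal (\<psi> x) \<partial>density ?L (\<lambda>x. ennreal (m x)))"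
    by (subst nn_integral_density) auto
  also have "\<dots> \<le> (\<integral>\<^sup>+x. ennreal (\<psi> x) \<partial>\<mu>)"
    by (rule nn_integral_mono_measure[OF _ le]) (simp add: s\<mu> sL)
  finally show ?thesis using \<mu>eq \<mu>0 t\<mu> by (simp add: ennreal_le_iff)
qed

lemma solves_P_nonneg:
  fixes D :: "'a::euclidean_space set"
  assumes s: "0 < s" "s < 1" and D: "open D" "emeasure lborel D < \<infinity>" and \<alpha>: "0 < \<alpha>"
    and U: "(\<lambda>x. U x - \<alpha>) \<in> Hs0 s D" and m: "min_neg_frac_lap_one s D (\<lambda>x. max (U x) 0) m"
    and eq: "\<And>\<phi>. \<phi> \<in> Hs0 s D \<Longrightarrow> - frac_lap s U \<phi> =
           (LINT x:D|lborel. (indicator {x. U x \<le> 0} x * m x + indicator {x. U x > 0} x) * \<phi> x)"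
  shows "AE x in lborel. 0 \<le> U x"
proof (rule nonneg_of_neg_part_test[OF \<alpha> U])
  let ?n = "\<lambda>x. max (- U x) 0" and ?p = "\<lambda>x. max (U x) 0"
  have Db: "D \<in> sets borel" using D(1) by simp
  have m1: "m \<in> borel_measurable borel" "AE x in lborel. x \<in> D \<longrightarrow> \<bar>m x\<bar> \<le> 1"
    using m min_neg_frac_lap_one_le_one[OF Db D(2) m] by (auto simp: min_neg_frac_lap_one_def)
  have n: "?n \<in> Hs0 s D" by (rule neg_part_Hs0[OF \<alpha> U])
  have p: "finite_energy s ?p"
    by (intro finite_energy_max finite_energy_const shift_finite_energy[OF Hs0_D(1)[OF U]])
  \<comment> \<open>Where \<open>?n\<close> is nonzero, \<open>U\<close> is negative and the
    coefficient in the equation is \<open>m\<close>.\<close>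
  have "- frac_lap s U ?n = (LINT x:D|lborel. m x * ?n x)"
    unfolding eq[OF n] by (intro set_lebesgue_integral_cong) (auto simp: Db indicator_def max_def)
  also have "\<dots> \<le> - frac_lap s ?p ?n"
  proof (rule le_neg_frac_lap_disjoint[OF s D p m1])
    show "(LINT x:D|lborel. m x * \<psi> x) \<le> - frac_lap s ?p \<psi>" if "\<psi> \<in> test_functions D" "\<forall>x. 0 \<le> \<psi> x" for \<psi>
      by (rule min_neg_frac_lap_one_test[OF D(1) m that Hs_set_integrable[OF Db D(2) test_function_Hs[OF s that(1)] m1]])
  qed (use Hs0_D(1)[OF n] in auto)
  finally show "- frac_lap s U ?n \<le> - frac_lap s ?p ?n" .
qed

section \<open>The inequalities for all functions of the energy space\<close>

lemma max_minus_neg: "max (t::real) 0 - max (- t) 0 = t"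
  by simp

text \<open>The upper inequality is the lower one for \<open>- U\<close> with the indicator replaced
  by its negative; the general lemma bounds the weight in absolute value and so admits this
  sign.\<close>

lemma solves_ineq_compact_support:
  fixes U :: "'a::euclidean_space \<Rightarrow> real"
  assumes s: "0 < s" "s < 1" and D: "open D" "emeasure lborel D < \<infinity>"
    and U: "solves_ineq s D \<alpha> U"
    and \<phi>: "\<phi> \<in> Hs s" "\<And>x. 0 \<le> \<phi> x" and K: "compact K" "K \<subseteq> D" "\<And>x. x \<notin> K \<Longrightarrow> \<phi> x = 0"
  shows "(LINT x:D|lborel. indicator {x. U x > 0} x * \<phi> x) \<le> - frac_lap s U \<phi>"
    and "- frac_lap s U \<phi> \<le> (LINT x:D|lborel. indicator {x. U x \<ge> 0} x * \<phi> x)"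
proof -
  have UH: "(\<lambda>x. U x - \<alpha>) \<in> Hs0 s D" using U H_alpha_iff[OF s] by (auto simp: solves_ineq_def)
  have fU: "finite_energy s U" by (rule shift_finite_energy[OF Hs0_D(1)[OF UH]])
  have [measurable]: "U \<in> borel_measurable borel" by (rule finite_energyD[OF fU])
  have test: "(LINT x:D|lborel. indicator {x. U x > 0} x * \<psi> x) \<le> - frac_lap s U \<psi>"
    "- frac_lap s U \<psi> \<le> (LINT x:D|lborel. indicator {x. U x \<ge> 0} x * \<psi> x)"
    if "\<psi> \<in> test_functions D" "\<forall>x. 0 \<le> \<psi> x" for \<psi>
    using U that by (auto simp: solves_ineq_def)
  show "(LINT x:D|lborel. indicator {x. U x > 0} x * \<phi> x) \<le> - frac_lap s U \<phi>"
    by (rule le_neg_frac_lap_compact_support[OF s D fU _ _ test(1) \<phi> K]) (auto simp: indicator_def)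
  have "(LINT x:D|lborel. - indicator {x. U x \<ge> 0} x * \<phi> x) \<le> - frac_lap s (\<lambda>x. - U x) \<phi>"
  proof (rule le_neg_frac_lap_compact_support[OF s D finite_energy_minus[OF fU] _ _ _ \<phi> K])
    show "(LINT x:D|lborel. - indicator {x. U x \<ge> 0} x * \<psi> x) \<le> - frac_lap s (\<lambda>x. - U x) \<psi>"
      if "\<psi> \<in> test_functions D" "\<forall>x. 0 \<le> \<psi> x" for \<psi>
      using test(2)[OF that] by (simp add: frac_lap_minus_left set_lebesgue_integral_def)
  qed (auto simp: indicator_def)
  then show "- frac_lap s U \<phi> \<le> (LINT x:D|lborel. indicator {x. U x \<ge> 0} x * \<phi> x)"
    by (simp add: frac_lap_minus_left set_lebesgue_integral_def)
qed

text \<open>Density supplies test functions that may change sign, while the inequalities concern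
  nonnegative ones. Their positive and negative parts are no longer smooth but keep a compact
  support in \<open>D\<close>, so each inequality for \<open>\<psi> j\<close> combines one bound for
  the positive part with the opposite bound for the negative part. Convergence in energy is used for
  \<open>\<psi> j\<close> only; the two parts enter the limit through integrals over
  \<open>D\<close>, where the negative part disappears because \<open>\<phi>\<close> is
  nonnegative.\<close>

lemma solves_ineq_extend:
  fixes U :: "'a::euclidean_space \<Rightarrow> real"
  assumes s: "0 < s" "s < 1" and D: "open D" "emeasure lborel D < \<infinity>"
    and dense: "test_functions_dense s D" and U: "solves_ineq s D \<alpha> U"
    and \<phi>: "\<phi> \<in> Hs0 s D" "\<And>x. 0 \<le> \<phi> x"
  shows "(LINT x:D|lborel. indicator {x. U x > 0} x * \<phi> x) \<le> - frac_lap s U \<phi>"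
    and "- frac_lap s U \<phi> \<le> (LINT x:D|lborel. indicator {x. U x \<ge> 0} x * \<phi> x)"
proof -
  have Db: "D \<in> sets borel" using D(1) by simp
  have UH: "(\<lambda>x. U x - \<alpha>) \<in> Hs0 s D" using U H_alpha_iff[OF s] by (auto simp: solves_ineq_def)
  have fU: "finite_energy s U" by (rule shift_finite_energy[OF Hs0_D(1)[OF UH]])
  have [measurable]: "U \<in> borel_measurable borel" by (rule finite_energyD[OF fU])
  have \<phi>H: "\<phi> \<in> Hs s" by (rule Hs0_D(1)[OF \<phi>(1)])
  have "\<exists>\<psi>. (\<forall>j. \<psi> j \<in> test_functions D \<and> True) \<and> energy_tendsto s \<psi> \<phi>"
    by (rule ex_energy_tendsto[where P="\<lambda>_. True"]) (use dense \<phi>(1) in \<open>auto simp: test_functions_dense_def\<close>)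
  then obtain \<psi> where \<psi>: "\<And>j. \<psi> j \<in> test_functions D" "energy_tendsto s \<psi> \<phi>" by blast
  have \<psi>H: "\<psi> j \<in> Hs s" for j by (rule test_function_Hs[OF s \<psi>(1)])
  let ?p = "\<lambda>j x. max (\<psi> j x) 0" and ?n = "\<lambda>j x. max (- \<psi> j x) 0"
  have p: "?p j \<in> Hs s" for j by (rule Hs_pos_part[OF \<psi>H])
  have n: "?n j \<in> Hs s" for j by (rule Hs_pos_part[OF Hs_minus[OF \<psi>H]])
  have fr: "- frac_lap s U (\<psi> j) = - frac_lap s U (?p j) - (- frac_lap s U (?n j))" for j
    using frac_lap_diff_right[OF Hs_finite_energy[OF p] Hs_finite_energy[OF n] fU, of j j]
    by (simp only: max_minus_neg)
  have K: "compact (closure {x. \<psi> j x \<noteq> 0})" "closure {x. \<psi> j x \<noteq> 0} \<subseteq> D" for j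
    using \<psi>(1)[of j] by (auto simp: test_functions_def)
  have z: "\<psi> j x = 0" if "x \<notin> closure {x. \<psi> j x \<noteq> 0}" for x j
    using closure_subset[of "{x. \<psi> j x \<noteq> 0}"] that by auto
  let ?i = "\<lambda>x. indicator {x. U x > 0} x :: real" and ?k = "\<lambda>x. indicator {x. U x \<ge> 0} x :: real"
  have cp1: "(LINT x:D|lborel. ?i x * ?p j x) \<le> - frac_lap s U (?p j)" for j
    by (rule solves_ineq_compact_support(1)[OF s D U p _ K[of j]]; (rule max.cobounded2 | (drule z, simp)))
  have cp2: "- frac_lap s U (?p j) \<le> (LINT x:D|lborel. ?k x * ?p j x)" for j
    by (rule solves_ineq_compact_support(2)[OF s D U p _ K[of j]]; (rule max.cobounded2 | (drule z, simp)))
  have cn1: "(LINT x:D|lborel. ?i x * ?n j x) \<le> - frac_lap s U (?n j)" for j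
    by (rule solves_ineq_compact_support(1)[OF s D U n _ K[of j]]; (rule max.cobounded2 | (drule z, simp)))
  have cn2: "- frac_lap s U (?n j) \<le> (LINT x:D|lborel. ?k x * ?n j x)" for j
    by (rule solves_ineq_compact_support(2)[OF s D U n _ K[of j]]; (rule max.cobounded2 | (drule z, simp)))
  have im: "?i \<in> borel_measurable borel" "?k \<in> borel_measurable borel" by simp_all
  have b: "AE x in lborel. x \<in> D \<longrightarrow> \<bar>?i x\<bar> \<le> 1" "AE x in lborel. x \<in> D \<longrightarrow> \<bar>?k x\<bar> \<le> 1"
    by (auto simp: indicator_def)
  have lim_p: "(\<lambda>j. LINT x:D|lborel. g x * ?p j x) \<longlonglongrightarrow> (LINT x:D|lborel. g x * \<phi> x)"
    and lim_n: "(\<lambda>j. LINT x:D|lborel. g x * ?n j x) \<longlonglongrightarrow> 0"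
    if g: "g \<in> borel_measurable borel" "AE x in lborel. x \<in> D \<longrightarrow> \<bar>g x\<bar> \<le> 1" for g
  proof -
    show "(\<lambda>j. LINT x:D|lborel. g x * ?p j x) \<longlonglongrightarrow> (LINT x:D|lborel. g x * \<phi> x)"
    proof (rule set_integral_tendsto[OF Db D(2) \<phi>H \<psi>H \<psi>(2)])
      show "AE x in lborel. x \<in> D \<longrightarrow> \<bar>g x * ?p j x - g x * \<phi> x\<bar> \<le> \<bar>\<phi> x - \<psi> j x\<bar>" for j
        using g(2)
      proof (eventually_elim, intro impI)
        fix x assume "x \<in> D \<longrightarrow> \<bar>g x\<bar> \<le> 1" "x \<in> D"
        moreover have "\<bar>?p j x - \<phi> x\<bar> \<le> \<bar>\<phi> x - \<psi> j x\<bar>" using \<phi>(2)[of x] by (auto simp: max_def)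
        ultimately have "\<bar>g x\<bar> * \<bar>?p j x - \<phi> x\<bar> \<le> 1 * \<bar>\<phi> x - \<psi> j x\<bar>" by (intro mult_mono) auto
        then show "\<bar>g x * ?p j x - g x * \<phi> x\<bar> \<le> \<bar>\<phi> x - \<psi> j x\<bar>"
          by (simp only: abs_mult[symmetric] right_diff_distrib[symmetric] mult_1_left)
      qed
      show "set_integrable lborel D (\<lambda>x. g x * \<phi> x)" by (rule Hs_set_integrable[OF Db D(2) \<phi>H g])
      show "set_integrable lborel D (\<lambda>x. g x * ?p j x)" for j by (rule Hs_set_integrable[OF Db D(2) p g])
    qed
    have "(\<lambda>j. LINT x:D|lborel. g x * ?n j x) \<longlonglongrightarrow> (LINT x:D|(lborel :: 'a measure). (0::real))"
    proof (rule set_integral_tendsto[OF Db D(2) \<phi>H \<psi>H \<psi>(2)])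
      show "AE x in lborel. x \<in> D \<longrightarrow> \<bar>g x * ?n j x - 0\<bar> \<le> \<bar>\<phi> x - \<psi> j x\<bar>" for j
        using g(2)
      proof (eventually_elim, intro impI)
        fix x assume "x \<in> D \<longrightarrow> \<bar>g x\<bar> \<le> 1" "x \<in> D"
        moreover have "\<bar>?n j x\<bar> \<le> \<bar>\<phi> x - \<psi> j x\<bar>" using \<phi>(2)[of x] by (auto simp: max_def)
        ultimately have "\<bar>g x\<bar> * \<bar>?n j x\<bar> \<le> 1 * \<bar>\<phi> x - \<psi> j x\<bar>" by (intro mult_mono) auto
        then show "\<bar>g x * ?n j x - 0\<bar> \<le> \<bar>\<phi> x - \<psi> j x\<bar>" by (simp add: abs_mult)
      qed
      show "set_integrable lborel D (\<lambda>x. 0::real)" by (simp add: set_integrable_def)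
      show "set_integrable lborel D (\<lambda>x. g x * ?n j x)" for j by (rule Hs_set_integrable[OF Db D(2) n g])
    qed
    then show "(\<lambda>j. LINT x:D|lborel. g x * ?n j x) \<longlonglongrightarrow> 0" by (simp add: set_lebesgue_integral_def)
  qed
  have lim: "(\<lambda>j. - frac_lap s U (\<psi> j)) \<longlonglongrightarrow> - frac_lap s U \<phi>"
    by (intro tendsto_minus frac_lap_tendsto[OF fU \<phi>H \<psi>H \<psi>(2)])
  have "(\<lambda>j. (LINT x:D|lborel. ?i x * ?p j x) - (LINT x:D|lborel. ?k x * ?n j x)) \<longlonglongrightarrow> (LINT x:D|lborel. ?i x * \<phi> x) - 0"
    by (intro tendsto_diff lim_p lim_n im b)
  from LIMSEQ_le[OF this lim[unfolded fr]] have "(LINT x:D|lborel. ?i x * \<phi> x) - 0 \<le> - frac_lap s U \<phi>"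
    unfolding fr using diff_mono[OF cp1 cn2] by blast
  then show "(LINT x:D|lborel. ?i x * \<phi> x) \<le> - frac_lap s U \<phi>" by simp
  have "(\<lambda>j. (LINT x:D|lborel. ?k x * ?p j x) - (LINT x:D|lborel. ?i x * ?n j x)) \<longlonglongrightarrow> (LINT x:D|lborel. ?k x * \<phi> x) - 0"
    by (intro tendsto_diff lim_p lim_n im b)
  from LIMSEQ_le[OF lim[unfolded fr] this] have "- frac_lap s U \<phi> \<le> (LINT x:D|lborel. ?k x * \<phi> x) - 0"
    unfolding fr using diff_mono[OF cp2 cn1] by blast
  then show "- frac_lap s U \<phi> \<le> (LINT x:D|lborel. ?k x * \<phi> x)" by simp
qed

lemma solves_ineq_nonneg:
  fixes U :: "'a::euclidean_space \<Rightarrow> real"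
  assumes s: "0 < s" "s < 1" and D: "open D" "emeasure lborel D < \<infinity>" and \<alpha>: "0 < \<alpha>"
    and dense: "test_functions_dense s D" and U: "solves_ineq s D \<alpha> U"
  shows "AE x in lborel. 0 \<le> U x"
proof -
  have UH: "(\<lambda>x. U x - \<alpha>) \<in> Hs0 s D" using U H_alpha_iff[OF s] by (auto simp: solves_ineq_def)
  show ?thesis
  proof (rule nonneg_of_neg_part_test[OF \<alpha> UH])
    let ?n = "\<lambda>x. max (- U x) 0"
    have "- frac_lap s U ?n \<le> (LINT x:D|lborel. indicator {x. U x \<ge> 0} x * ?n x)"
      by (rule solves_ineq_extend(2)[OF s D dense U neg_part_Hs0[OF \<alpha> UH]]) simp
    also have "\<dots> = (LINT x:D|(lborel :: 'a measure). (0::real))"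
      using D by (intro set_lebesgue_integral_cong) (auto simp: indicator_def max_def)
    also have "\<dots> = 0" by (simp add: set_lebesgue_integral_def)
    also have "0 \<le> - frac_lap s (\<lambda>x. max (U x) 0) ?n"
      using frac_lap_nonpos_of_disjoint[of "\<lambda>x. max (U x) 0" ?n s] by (simp add: max_def)
    finally show "- frac_lap s U ?n \<le> - frac_lap s (\<lambda>x. max (U x) 0) ?n" .
  qed
qed

section \<open>Uniqueness\<close>

text \<open>\<open>f\<close> stands for a Borel representative of the minimizer with values between
  0 and 1 at every point of the whole space.\<close>

locale obstacle_state =
  fixes s \<alpha> :: real and D :: "'a::euclidean_space set" and f u :: "'a \<Rightarrow> real"
  assumes s: "0 < s" "s < 1" and D: "open D" "emeasure lborel D < \<infinity>" and \<alpha>: "0 < \<alpha>"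
    and f [measurable]: "f \<in> borel_measurable borel" and f01: "\<And>x. 0 \<le> f x" "\<And>x. f x \<le> 1"
    and state: "is_state s D f u"
    and contact: "AE x in lborel. x \<in> D \<longrightarrow> (u x < \<alpha> \<longrightarrow> f x = 1) \<and> 0 \<le> u x \<and> u x \<le> \<alpha>"
begin

lemma Db [measurable]: "D \<in> sets borel" using D(1) by simp

lemma u: "u \<in> Hs0 s D" "\<And>v. v \<in> Hs0 s D \<Longrightarrow> frac_lap s u v = (LINT x:D|lborel. f x * v x)"
  using state by (auto simp: is_state_def)

lemma fe_u: "finite_energy s u" by (rule Hs_finite_energy[OF Hs0_D(1)[OF u(1)]])

lemma u_measurable [measurable]: "u \<in> borel_measurable borel" by (rule finite_energyD[OF fe_u])

lemma fb: "AE x in lborel. x \<in> D \<longrightarrow> \<bar>f x\<bar> \<le> 1" using f01 by (intro AE_I2) (auto simp: abs_le_iff intro: order_trans[of _ 0])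

lemma optimal_H_alpha: "(\<lambda>x. \<alpha> - u x) \<in> H_alpha s D \<alpha>"
  unfolding H_alpha_iff[OF s] using Hs0_minus[OF u(1)] by simp

lemma difference_Hs0:
  assumes "U \<in> H_alpha s D \<alpha>" shows "(\<lambda>x. U x - (\<alpha> - u x)) \<in> Hs0 s D"
proof -
  have "(\<lambda>x. U x - \<alpha>) \<in> Hs0 s D" using assms H_alpha_iff[OF s] by blast
  from Hs0_diff[OF this Hs0_minus[OF u(1)]] show ?thesis by (simp add: algebra_simps)
qed

lemma H_alpha_finite_energy: "U \<in> H_alpha s D \<alpha> \<Longrightarrow> finite_energy s U"
  using H_alpha_iff[OF s] shift_finite_energy Hs0_D(1) by blast

lemma optimal_nonneg: "AE x in lborel. 0 \<le> \<alpha> - u x"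
  using contact Hs0_D(2)[OF u(1)] by eventually_elim (use \<alpha> in auto)

lemma frac_lap_eq_AE:
  assumes U: "U \<in> H_alpha s D \<alpha>" "AE x in lborel. U x = \<alpha> - u x" and \<phi>: "\<phi> \<in> Hs0 s D"
  shows "- frac_lap s U \<phi> = (LINT x:D|lborel. f x * \<phi> x)"
proof -
  note finite_energyD[OF H_alpha_finite_energy[OF U(1)], measurable] Hs_measurable[OF Hs0_D(1)[OF \<phi>], measurable]
  have "frac_lap s U \<phi> = frac_lap s (\<lambda>x. \<alpha> - u x) \<phi>"
    by (rule frac_lap_cong_AE) (use U(2) in auto)
  also have "\<dots> = - frac_lap s u \<phi>"
    by (rule frac_lap_const_diff_left[OF fe_u Hs_finite_energy[OF Hs0_D(1)[OF \<phi>]]])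
  finally show ?thesis by (simp add: u(2)[OF \<phi>])
qed

text \<open>The left-hand side of \<open>le\<close> is the equation of \<open>\<alpha> - u\<close>
  tested with the difference. Subtracting the two equations therefore makes the energy of the
  difference nonpositive.\<close>

lemma eq_of_test:
  assumes U: "U \<in> H_alpha s D \<alpha>"
    and le: "(LINT x:D|lborel. f x * (U x - (\<alpha> - u x))) \<le> - frac_lap s U (\<lambda>x. U x - (\<alpha> - u x))"
  shows "AE x in lborel. U x = \<alpha> - u x"
proof -
  let ?w = "\<lambda>x. U x - (\<alpha> - u x)"
  have w: "?w \<in> Hs0 s D" by (rule difference_Hs0[OF U])
  have fw: "finite_energy s ?w" by (rule Hs_finite_energy[OF Hs0_D(1)[OF w]])
  have fa: "finite_energy s (\<lambda>x. \<alpha> - u x)" by (rule H_alpha_finite_energy[OF optimal_H_alpha])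
  have "frac_lap s ?w ?w = frac_lap s U ?w - frac_lap s (\<lambda>x. \<alpha> - u x) ?w"
    by (rule frac_lap_diff_left[OF H_alpha_finite_energy[OF U] fa fw])
  then have "frac_lap s ?w ?w \<le> 0"
    using le frac_lap_eq_AE[OF optimal_H_alpha _ w] by simp
  with Hs0_D(1)[OF w] have "AE x in lborel. ?w x = 0" by (rule energy_zero)
  then show ?thesis by eventually_elim simp
qed

lemma solves_P_unique:
  assumes U: "solves_P s D \<alpha> U"
  shows "AE x in lborel. U x = \<alpha> - u x"
proof -
  obtain m where UH: "U \<in> H_alpha s D \<alpha>" and m: "min_neg_frac_lap_one s D (\<lambda>x. max (U x) 0) m"
    and eq: "\<And>\<phi>. \<phi> \<in> Hs0 s D \<Longrightarrow> - frac_lap s U \<phi> =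
           (LINT x:D|lborel. (indicator {x. U x \<le> 0} x * m x + indicator {x. U x > 0} x) * \<phi> x)"
    using U by (auto simp: solves_P_def)
  note finite_energyD[OF H_alpha_finite_energy[OF UH], measurable]
  have m1 [measurable]: "m \<in> borel_measurable borel" and mb: "AE x in lborel. x \<in> D \<longrightarrow> \<bar>m x\<bar> \<le> 1"
    using m min_neg_frac_lap_one_le_one[OF Db D(2) m] by (auto simp: min_neg_frac_lap_one_def)
  have nn: "AE x in lborel. 0 \<le> U x"
    by (rule solves_P_nonneg[OF s D \<alpha> _ m eq]) (use UH H_alpha_iff[OF s] in blast)+
  let ?w = "\<lambda>x. U x - (\<alpha> - u x)"
  let ?g = "\<lambda>x. indicator {x. U x \<le> 0} x * m x + indicator {x. U x > 0} x"
  have w: "?w \<in> Hs0 s D" by (rule difference_Hs0[OF UH])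
  show ?thesis
  proof (rule eq_of_test[OF UH], subst eq[OF w])
    show "(LINT x:D|lborel. f x * ?w x) \<le> (LINT x:D|lborel. ?g x * ?w x)"
    proof (rule set_integral_mono_AE)
      show "set_integrable lborel D (\<lambda>x. f x * ?w x)"
        by (rule Hs_set_integrable[OF Db D(2) Hs0_D(1)[OF w] f fb])
      have "AE x in lborel. x \<in> D \<longrightarrow> \<bar>?g x\<bar> \<le> 1"
        using mb by eventually_elim (auto simp: indicator_def)
      then show "set_integrable lborel D (\<lambda>x. ?g x * ?w x)"
        by (intro Hs_set_integrable[OF Db D(2) Hs0_D(1)[OF w]]) measurable
      show "AE x \<in> D in lborel. f x * ?w x \<le> ?g x * ?w x"
        using nn mb contact
      proof (eventually_elim, intro impI)
        fix x assume x: "0 \<le> U x" "x \<in> D \<longrightarrow> \<bar>m x\<bar> \<le> 1" "x \<in> D"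
          "x \<in> D \<longrightarrow> (u x < \<alpha> \<longrightarrow> f x = 1) \<and> 0 \<le> u x \<and> u x \<le> \<alpha>"
        show "f x * ?w x \<le> ?g x * ?w x"
        proof (cases "0 \<le> ?w x")
          case True
          show ?thesis
          \<comment> \<open>Here \<open>U\<close> is at least the nonnegative
            \<open>\<alpha> - u x\<close>: if it is zero the difference is zero, otherwise
            \<open>U\<close> is positive and the coefficient \<open>?g x\<close> is 1, the largest
            value \<open>f\<close> can take.\<close>
          proof (cases "U x = 0")
            case True
            with \<open>0 \<le> ?w x\<close> x have "?w x = 0" by simp
            then show ?thesis by simp
          next
            case False
            then have "?g x = 1" using x by (simp add: indicator_def)
            moreover have "f x * ?w x \<le> 1 * ?w x" by (rule mult_right_mono[OF f01(2) True])
            ultimately show ?thesis by (simp only:)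
          qed
        next
          case False
          \<comment> \<open>Now \<open>U x < \<alpha> - u x\<close>, and nonnegativity of
            \<open>U\<close> gives \<open>u x < \<alpha>\<close>, where the contact condition
            applies.\<close>
          then have "f x = 1" using x by auto
          moreover have "?g x \<le> 1" using x by (auto simp: indicator_def)
          ultimately show ?thesis using False by (simp add: mult_right_mono_neg)
        qed
      qed
    qed
  qed
qed

lemma solves_ineq_unique:
  assumes dense: "test_functions_dense s D" and U: "solves_ineq s D \<alpha> U"
  shows "AE x in lborel. U x = \<alpha> - u x"
proof -
  have UH: "U \<in> H_alpha s D \<alpha>" using U by (simp add: solves_ineq_def)
  have fU: "finite_energy s U" by (rule H_alpha_finite_energy[OF UH])
  note finite_energyD[OF fU, measurable]
  have nn: "AE x in lborel. 0 \<le> U x" by (rule solves_ineq_nonneg[OF s D \<alpha> dense U])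
  let ?w = "\<lambda>x. U x - (\<alpha> - u x)" and ?p = "\<lambda>x. max (U x - (\<alpha> - u x)) 0" and ?n = "\<lambda>x. max (- (U x - (\<alpha> - u x))) 0"
  let ?i = "\<lambda>x. indicator {x. U x > 0} x :: real" and ?k = "\<lambda>x. indicator {x. U x \<ge> 0} x :: real"
  have w: "?w \<in> Hs0 s D" by (rule difference_Hs0[OF UH])
  have p: "?p \<in> Hs0 s D" by (rule Hs0_pos_part[OF w])
  have n: "?n \<in> Hs0 s D" by (rule Hs0_pos_part[OF Hs0_minus[OF w]])
  have i: "set_integrable lborel D (\<lambda>x. ?i x * ?p x)"
    by (rule Hs_set_integrable[OF Db D(2) Hs0_D(1)[OF p]]) (auto simp: indicator_def)
  have k: "set_integrable lborel D (\<lambda>x. ?k x * ?n x)"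
    by (rule Hs_set_integrable[OF Db D(2) Hs0_D(1)[OF n]]) (auto simp: indicator_def)
  show ?thesis
  proof (rule eq_of_test[OF UH])
    \<comment> \<open>The inequalities accept nonnegative functions only, so the lower one is
      applied to the positive part of the difference and the upper one to its negative part.\<close>
    have "(LINT x:D|lborel. f x * ?w x) \<le> (LINT x:D|lborel. ?i x * ?p x - ?k x * ?n x)"
    proof (rule set_integral_mono_AE)
      show "set_integrable lborel D (\<lambda>x. f x * ?w x)"
        by (rule Hs_set_integrable[OF Db D(2) Hs0_D(1)[OF w] f fb])
      show "set_integrable lborel D (\<lambda>x. ?i x * ?p x - ?k x * ?n x)" by (rule set_integral_diff(1)[OF i k])
      show "AE x \<in> D in lborel. f x * ?w x \<le> ?i x * ?p x - ?k x * ?n x"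
        using nn contact
      proof (eventually_elim, intro impI)
        fix x assume x: "0 \<le> U x" "x \<in> D"
          "x \<in> D \<longrightarrow> (u x < \<alpha> \<longrightarrow> f x = 1) \<and> 0 \<le> u x \<and> u x \<le> \<alpha>"
        show "f x * ?w x \<le> ?i x * ?p x - ?k x * ?n x"
        proof (cases "0 < ?w x")
          case True
          then have "?i x = 1" "?n x = 0" "?p x = ?w x" using x by (auto simp: indicator_def)
          then show ?thesis using True f01(2)[of x] by (simp add: mult_left_le_one_le f01(1))
        next
          case False
          then have "f x = 1 \<or> ?w x = 0" using x by auto
          moreover have "?k x = 1" "?p x = 0" "?n x = - ?w x" using False x by (auto simp: indicator_def)
          ultimately show ?thesis by auto
        qed
      qed
    qed
    also have "\<dots> = (LINT x:D|lborel. ?i x * ?p x) - (LINT x:D|lborel. ?k x * ?n x)"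
      by (rule set_integral_diff(2)[OF i k])
    also have "\<dots> \<le> - frac_lap s U ?p - (- frac_lap s U ?n)"
      by (intro diff_mono solves_ineq_extend[OF s D dense U] p n) auto
    also have "\<dots> = - frac_lap s U (\<lambda>x. ?p x - ?n x)"
      using frac_lap_diff_right[OF Hs_finite_energy[OF Hs0_D(1)[OF p]] Hs_finite_energy[OF Hs0_D(1)[OF n]] fU] by simp
    also have "(\<lambda>x. ?p x - ?n x) = ?w" by (simp only: max_minus_neg)
    finally show "(LINT x:D|lborel. f x * ?w x) \<le> - frac_lap s U ?w" .
  qed
qed

end

context obstacle_state
begin

section \<open>Existence and the variational characterization\<close>

text \<open>Since \<open>U\<close> agrees with its positive part, \<open>f\<close> is the density of
  the measure of that part; being at most 1, it is its own minimum with 1. So \<open>f\<close>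
  serves as \<open>m\<close>, and where \<open>U\<close> is positive the contact condition makes it
  1.\<close>

lemma solves_P_of_eq:
  assumes U: "U \<in> H_alpha s D \<alpha>" "AE x in lborel. U x = \<alpha> - u x"
  shows "solves_P s D \<alpha> U"
proof -
  let ?L = "restrict_space lborel D :: 'a measure"
  let ?\<mu> = "density ?L (\<lambda>x. ennreal (f x))"
  note finite_energyD[OF H_alpha_finite_energy[OF U(1)], measurable]
  have fL [measurable]: "f \<in> borel_measurable ?L" by (intro measurable_restrict_space1) simp
  have sL: "sets ?L = sets (restrict_space borel D)" by (rule sets_restrict_space_cong) simp
  have max_eq: "AE x in lborel. max (U x) 0 = U x"
    using U(2) optimal_nonneg by eventually_elim simp
  have "frac_subharmonic s D U"
    unfolding frac_subharmonic_def
  proof (intro ballI impI)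
    fix \<phi> :: "'a \<Rightarrow> real" assume \<phi>: "\<phi> \<in> test_functions D" "\<forall>x. 0 \<le> \<phi> x"
    have "0 \<le> (LINT x:D|lborel. f x * \<phi> x)"
      unfolding set_lebesgue_integral_def using f01(1) \<phi>(2)
      by (intro Bochner_Integration.integral_nonneg) (simp add: indicator_def)
    then show "frac_lap s U \<phi> \<le> 0"
      using frac_lap_eq_AE[OF U test_function_Hs0[OF s \<phi>(1)]] by linarith
  qed
  moreover have "min_neg_frac_lap_one s D (\<lambda>x. max (U x) 0) f"
    unfolding min_neg_frac_lap_one_def
  proof (intro conjI exI[of _ 1] exI[of _ ?\<mu>])
    show "AE x in lborel. x \<in> D \<longrightarrow> 0 \<le> f x \<and> f x \<le> 1" using f01 by simp
    have le: "emeasure ?\<mu> A \<le> emeasure ?L A" for A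
    proof (cases "A \<in> sets ?L")
      case True
      then have "emeasure ?\<mu> A = (\<integral>\<^sup>+x. ennreal (f x) * indicator A x \<partial>?L)"
        by (intro emeasure_density) auto
      also have "\<dots> \<le> (\<integral>\<^sup>+x. indicator A x \<partial>?L)"
        using f01(2) by (intro nn_integral_mono) (auto split: split_indicator simp: ennreal_le_1)
      also have "\<dots> = emeasure ?L A" using True by simp
      finally show ?thesis .
    next
      case False
      then show ?thesis by (simp add: emeasure_notin_sets)
    qed
    show "neg_frac_lap_measure s D (\<lambda>x. max (U x) 0) ?\<mu>"
      unfolding neg_frac_lap_measure_def
    proof (intro conjI allI impI ballI)
      show "sets ?\<mu> = sets (restrict_space borel D)" using sL by simp
      fix K :: "'a set" assume K: "compact K \<and> K \<subseteq> D"
      have "emeasure ?\<mu> K \<le> emeasure ?L K" by (rule le)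
      also have "\<dots> = emeasure lborel K" using K by (intro emeasure_restrict_space) auto
      also have "\<dots> < \<infinity>" using K by (intro emeasure_compact_finite) simp
      finally show "emeasure ?\<mu> K < \<infinity>" .
    next
      fix \<phi> :: "'a \<Rightarrow> real" assume \<phi>: "\<phi> \<in> test_functions D"
      have \<phi>0: "\<phi> \<in> Hs0 s D" by (rule test_function_Hs0[OF s \<phi>])
      note Hs_measurable[OF Hs0_D(1)[OF \<phi>0], measurable]
      have [measurable]: "\<phi> \<in> borel_measurable ?L" by (intro measurable_restrict_space1) simp
      have "(LINT x|?\<mu>. \<phi> x) = (LINT x|?L. f x *\<^sub>R \<phi> x)"
        using f01(1) by (intro integral_density) auto
      also have "\<dots> = (LINT x:D|lborel. f x * \<phi> x)"
        by (subst integral_restrict_space) (auto simp: set_lebesgue_integral_def)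
      also have "\<dots> = - frac_lap s U \<phi>" by (rule frac_lap_eq_AE[OF U \<phi>0, symmetric])
      also have "frac_lap s U \<phi> = frac_lap s (\<lambda>x. max (U x) 0) \<phi>"
        by (rule frac_lap_cong_AE) (use max_eq in auto)
      finally show "(LINT x|?\<mu>. \<phi> x) = - frac_lap s (\<lambda>x. max (U x) 0) \<phi>" .
    qed
    have "?\<mu> \<le> ?L"
      by (subst le_measure) (auto intro: le)
    then show "?\<mu> = inf ?\<mu> ?L" by (simp add: inf_absorb1)
  qed simp
  moreover have "- frac_lap s U \<phi> =
      (LINT x:D|lborel. (indicator {x. U x \<le> 0} x * f x + indicator {x. U x > 0} x) * \<phi> x)"
    if \<phi>: "\<phi> \<in> Hs0 s D" for \<phi>
  proof -
    note Hs_measurable[OF Hs0_D(1)[OF \<phi>], measurable]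
    have "AE x \<in> D in lborel. f x * \<phi> x = (indicator {x. U x \<le> 0} x * f x + indicator {x. U x > 0} x) * \<phi> x"
      using contact U(2) by eventually_elim (auto simp: indicator_def)
    then show ?thesis unfolding frac_lap_eq_AE[OF U \<phi>] by (intro set_lebesgue_integral_cong_AE) auto
  qed
  ultimately show ?thesis using U(1) unfolding solves_P_def by blast
qed

text \<open>Almost everywhere in \<open>D\<close>, \<open>f\<close> is squeezed between the two
  indicators: it is 1 where \<open>U\<close> is positive, lies between 0 and 1 where
  \<open>U\<close> is zero, and \<open>U\<close> is not negative.\<close>

lemma solves_ineq_of_eq:
  assumes U: "U \<in> H_alpha s D \<alpha>" "AE x in lborel. U x = \<alpha> - u x"
  shows "solves_ineq s D \<alpha> U"
  unfolding solves_ineq_def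
proof (intro conjI ballI impI U(1))
  fix \<phi> :: "'a \<Rightarrow> real" assume \<phi>: "\<phi> \<in> test_functions D" "\<forall>x. 0 \<le> \<phi> x"
  have \<phi>0: "\<phi> \<in> Hs0 s D" by (rule test_function_Hs0[OF s \<phi>(1)])
  note finite_energyD[OF H_alpha_finite_energy[OF U(1)], measurable]
  have i: "set_integrable lborel D (\<lambda>x. g x * \<phi> x)"
    if "g \<in> borel_measurable borel" "\<And>x. \<bar>g x\<bar> \<le> 1" for g
    by (rule Hs_set_integrable[OF Db D(2) Hs0_D(1)[OF \<phi>0] that(1)]) (simp add: that(2))
  have fb': "\<bar>f x\<bar> \<le> 1" for x using f01[of x] by simp
  show "(LINT x:D|lborel. indicator {x. U x > 0} x * \<phi> x) \<le> - frac_lap s U \<phi>"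
    unfolding frac_lap_eq_AE[OF U \<phi>0]
  proof (rule set_integral_mono_AE[OF i i[OF f fb']])
    show "AE x \<in> D in lborel. indicator {x. U x > 0} x * \<phi> x \<le> f x * \<phi> x"
      using contact U(2) by eventually_elim (use f01(1) \<phi>(2) in \<open>auto simp: indicator_def\<close>)
  qed (auto simp: indicator_def)
  show "- frac_lap s U \<phi> \<le> (LINT x:D|lborel. indicator {x. U x \<ge> 0} x * \<phi> x)"
    unfolding frac_lap_eq_AE[OF U \<phi>0]
  proof (rule set_integral_mono_AE[OF i[OF f fb'] i])
    show "AE x \<in> D in lborel. f x * \<phi> x \<le> indicator {x. U x \<ge> 0} x * \<phi> x"
      using contact U(2)
      by eventually_elim (use f01(2) \<phi>(2) in \<open>auto simp: indicator_def intro!: mult_left_le_one_le f01(1)\<close>)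
  qed (auto simp: indicator_def)
qed

text \<open>The real value of \<open>J\<close> on \<open>H_alpha s D \<alpha>\<close>: as
  \<open>gagliardo_sq s v\<close> is twice \<open>frac_lap s v v\<close>, the factor 1/4 of
  \<open>J\<close> becomes 1/2.\<close>

definition energy :: "('a \<Rightarrow> real) \<Rightarrow> real" where
  "energy v = frac_lap s v v / 2 + (LINT x:D|lborel. max (v x) 0)"

lemma set_integrable_pos_part:
  assumes v: "v \<in> H_alpha s D \<alpha>"
  shows "set_integrable lborel D (\<lambda>x. max (v x) 0)"
proof -
  have w: "(\<lambda>x. v x - \<alpha>) \<in> Hs s" using v H_alpha_iff[OF s] Hs0_D(1) by blast
  have c: "set_integrable lborel D (\<lambda>x. \<alpha>)"
    unfolding set_integrable_def using D(2) by (intro integrable_scaleR_left integrable_real_indicator) auto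
  have "set_integrable lborel D v"
    using set_integral_add(1)[OF Hs_set_integrable_self[OF Db D(2) w] c] by simp
  then have "integrable lborel (\<lambda>x. max (indicator D x *\<^sub>R v x) 0)"
    unfolding set_integrable_def by (intro integrable_max) auto
  moreover have "max (indicator D x *\<^sub>R v x) 0 = indicator D x *\<^sub>R max (v x) 0" for x
    by (simp add: indicator_def)
  ultimately show ?thesis by (simp add: set_integrable_def)
qed

lemma J_energy:
  assumes v: "v \<in> H_alpha s D \<alpha>"
  shows "J s D v = ennreal (energy v)" "0 \<le> energy v"
proof -
  have p0: "0 \<le> (LINT x:D|lborel. max (v x) 0)"
    unfolding set_lebesgue_integral_def by (intro Bochner_Integration.integral_nonneg) simp
  have "(\<integral>\<^sup>+x\<in>D. ennreal (max (v x) 0) \<partial>lborel) = (\<integral>\<^sup>+x. ennreal (indicator D x *\<^sub>R max (v x) 0) \<partial>lborel)"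
    by (intro nn_integral_cong) (simp split: split_indicator)
  also have "\<dots> = ennreal (LINT x:D|lborel. max (v x) 0)"
    using set_integrable_pos_part[OF v] unfolding set_integrable_def set_lebesgue_integral_def
    by (intro nn_integral_eq_integral) auto
  finally have "J s D v = ennreal (2 * frac_lap s v v) / ennreal 4 + ennreal (LINT x:D|lborel. max (v x) 0)"
    unfolding J_def by (simp add: gagliardo_sq_frac_lap[OF H_alpha_finite_energy[OF v]])
  also have "\<dots> = ennreal (2 * frac_lap s v v / 4 + (LINT x:D|lborel. max (v x) 0))"
    using p0 frac_lap_self_nonneg[of s v] by (subst divide_ennreal) auto
  finally show "J s D v = ennreal (energy v)" by (simp add: energy_def)
  show "0 \<le> energy v" using p0 frac_lap_self_nonneg[of s v] by (simp add: energy_def)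
qed

text \<open>The pointwise inequality behind the estimate is the convexity of the positive part:
  \<open>f\<close> is a subgradient of it at \<open>\<alpha> - u\<close>.\<close>

lemma energy_gap:
  assumes v: "v \<in> H_alpha s D \<alpha>"
  defines "w \<equiv> \<lambda>x. v x - (\<alpha> - u x)"
  shows "energy (\<lambda>x. \<alpha> - u x) + frac_lap s w w / 2 \<le> energy v"
proof -
  let ?U = "\<lambda>x. \<alpha> - u x"
  have w: "w \<in> Hs0 s D" unfolding w_def by (rule difference_Hs0[OF v])
  have fw: "finite_energy s w" by (rule Hs_finite_energy[OF Hs0_D(1)[OF w]])
  have fU: "finite_energy s ?U" by (rule H_alpha_finite_energy[OF optimal_H_alpha])
  have fv: "finite_energy s v" by (rule H_alpha_finite_energy[OF v])
  have v_eq: "(\<lambda>x. ?U x + w x) = v" by (simp add: w_def)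
  have add: "frac_lap s v z = frac_lap s ?U z + frac_lap s w z" if "finite_energy s z" for z
    using frac_lap_add_left[OF fU fw that] unfolding v_eq .
  \<comment> \<open>Half of the cross term is minus the integral of \<open>f * w\<close>, which is
    exactly the gain from the convexity of the positive part; only the energy of \<open>w\<close> is
    left over.\<close>
  have quad: "frac_lap s v v = frac_lap s ?U ?U + 2 * frac_lap s ?U w + frac_lap s w w"
    using add[OF fv] add[OF fU] add[OF fw] frac_lap_commute[of s ?U v] frac_lap_commute[of s w v]
      frac_lap_commute[of s w ?U] by linarith
  have lin: "- frac_lap s ?U w = (LINT x:D|lborel. f x * w x)"
    by (rule frac_lap_eq_AE[OF optimal_H_alpha _ w]) simp
  have iw: "set_integrable lborel D (\<lambda>x. f x * w x)"
    by (rule Hs_set_integrable[OF Db D(2) Hs0_D(1)[OF w] f fb])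
  have iU: "set_integrable lborel D (\<lambda>x. max (?U x) 0)" by (rule set_integrable_pos_part[OF optimal_H_alpha])
  have "(LINT x:D|lborel. max (?U x) 0 + f x * w x) \<le> (LINT x:D|lborel. max (v x) 0)"
  proof (rule set_integral_mono_AE[OF set_integral_add(1)[OF iU iw] set_integrable_pos_part[OF v]])
    show "AE x \<in> D in lborel. max (?U x) 0 + f x * w x \<le> max (v x) 0"
      using contact
    proof (eventually_elim, intro impI)
      fix x assume x: "x \<in> D" "x \<in> D \<longrightarrow> (u x < \<alpha> \<longrightarrow> f x = 1) \<and> 0 \<le> u x \<and> u x \<le> \<alpha>"
      show "max (?U x) 0 + f x * w x \<le> max (v x) 0"
      proof (cases "u x < \<alpha>")
        case True
        then show ?thesis using x by (simp add: w_def)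
      next
        case False
        then have "u x = \<alpha>" using x by simp
        moreover have "f x * v x \<le> max (v x) 0"
          using f01[of x] by (cases "0 \<le> v x") (auto simp: mult_left_le_one_le mult_nonneg_nonpos)
        ultimately show ?thesis by (simp add: w_def)
      qed
    qed
  qed
  then have "(LINT x:D|lborel. max (?U x) 0) + (LINT x:D|lborel. f x * w x) \<le> (LINT x:D|lborel. max (v x) 0)"
    by (simp only: set_integral_add(2)[OF iU iw])
  then show ?thesis unfolding energy_def using quad lin by (simp add: field_simps)
qed

lemma J_cong_AE:
  assumes "AE x in lborel. v x = w x"
  shows "J s D v = J s D w"
proof -
  have "gagliardo_sq s v = gagliardo_sq s w"
    unfolding gagliardo_sq_quot using AE_quot_cong[OF assms, of s] by (intro nn_integral_cong_AE) auto
  moreover have "(\<integral>\<^sup>+x\<in>D. ennreal (max (v x) 0) \<partial>lborel) = (\<integral>\<^sup>+x\<in>D. ennreal (max (w x) 0) \<partial>lborel)"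
    using assms by (intro nn_integral_cong_AE) auto
  ultimately show ?thesis by (simp add: J_def)
qed

lemma is_min_on_J_iff:
  "is_min_on (J s D) (H_alpha s D \<alpha>) U \<longleftrightarrow> U \<in> H_alpha s D \<alpha> \<and> (AE x in lborel. U x = \<alpha> - u x)"
proof (intro iffI conjI)
  assume min: "is_min_on (J s D) (H_alpha s D \<alpha>) U"
  then show UH: "U \<in> H_alpha s D \<alpha>" by (simp add: is_min_on_def)
  let ?w = "\<lambda>x. U x - (\<alpha> - u x)"
  have "J s D U \<le> J s D (\<lambda>x. \<alpha> - u x)" using min optimal_H_alpha by (simp add: is_min_on_def)
  then have "energy U \<le> energy (\<lambda>x. \<alpha> - u x)"
    using J_energy[OF UH] J_energy[OF optimal_H_alpha] by simp
  with energy_gap[OF UH] have "frac_lap s ?w ?w \<le> 0" by linarith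
  with Hs0_D(1)[OF difference_Hs0[OF UH]] have "AE x in lborel. ?w x = 0" by (rule energy_zero)
  then show "AE x in lborel. U x = \<alpha> - u x" by eventually_elim simp
next
  assume U: "U \<in> H_alpha s D \<alpha> \<and> (AE x in lborel. U x = \<alpha> - u x)"
  show "is_min_on (J s D) (H_alpha s D \<alpha>) U"
    unfolding is_min_on_def
  proof (intro conjI ballI)
    show "U \<in> H_alpha s D \<alpha>" using U by simp
    fix v assume v: "v \<in> H_alpha s D \<alpha>"
    have "J s D U = J s D (\<lambda>x. \<alpha> - u x)" using U by (intro J_cong_AE) simp
    also have "\<dots> \<le> J s D v"
      using energy_gap[OF v] frac_lap_self_nonneg[of s "\<lambda>x. v x - (\<alpha> - u x)"]
      by (simp add: J_energy[OF v] J_energy[OF optimal_H_alpha] ennreal_leI)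
    finally show "J s D U \<le> J s D v" .
  qed
qed

lemma solves_P_iff:
  "solves_P s D \<alpha> U \<longleftrightarrow> U \<in> H_alpha s D \<alpha> \<and> (AE x in lborel. U x = \<alpha> - u x)"
  using solves_P_unique solves_P_of_eq by (auto simp: solves_P_def)

end

text \<open>Off \<open>{fhat = 1}\<close> the state equals \<open>\<alpha> > 0\<close>, and the state is square integrable; together with the
  integrability of \<open>fhat\<close> this forces \<open>D\<close> to have finite measure.\<close>

lemma finite_measure_of_contact:
  fixes D :: "'a::euclidean_space set" and f u :: "'a \<Rightarrow> real"
  assumes D: "D \<in> sets borel" and f: "set_integrable lborel D f" and u: "integrable lborel (\<lambda>x. (u x)\<^sup>2)"
    and \<alpha>: "0 < (\<alpha>::real)" and contact: "AE x in lborel. x \<in> D \<longrightarrow> (f x < 1 \<longrightarrow> u x = \<alpha>)"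
  shows "emeasure lborel D < \<infinity>"
proof -
  have "integrable lborel (indicator D :: 'a \<Rightarrow> real)"
  proof (rule Bochner_Integration.integrable_bound)
    show "integrable lborel (\<lambda>x. \<bar>indicator D x *\<^sub>R f x\<bar> + (u x)\<^sup>2 / \<alpha>\<^sup>2)"
      using f u unfolding set_integrable_def by (intro Bochner_Integration.integrable_add integrable_abs) auto
    show "AE x in lborel. norm (indicator D x :: real) \<le> norm (\<bar>indicator D x *\<^sub>R f x\<bar> + (u x)\<^sup>2 / \<alpha>\<^sup>2)"
      using contact
    proof eventually_elim
      case (elim x)
      show ?case
      proof (cases "x \<in> D \<and> 1 \<le> f x")
        case True
        then have "1 \<le> \<bar>f x\<bar> + (u x)\<^sup>2 / \<alpha>\<^sup>2" by (simp add: add_increasing2)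
        then show ?thesis using True by simp
      next
        case False
        then have "x \<in> D \<longrightarrow> (u x)\<^sup>2 / \<alpha>\<^sup>2 = 1" using elim \<alpha> by auto
        then show ?thesis by (cases "x \<in> D") auto
      qed
    qed
  qed (use D in auto)
  then show ?thesis using D by (simp add: integrable_indicator_iff)
qed

theorem theorem5p3:
  fixes s \<beta> \<alpha> :: real and D :: "'a::euclidean_space set" and fhat uhat :: "'a \<Rightarrow> real"
  assumes "0 < s" "s < 1"
    and "open D" "connected D"
    and "0 < \<beta>" "ennreal \<beta> < emeasure lborel D"
    and "unique_Phi_minimizer s D \<beta> fhat"
    and "is_state s D fhat uhat"
    and "0 < \<alpha>"
    and "AE x in lborel. x \<in> D \<longrightarrow>
           (fhat x < 1 \<longrightarrow> uhat x = \<alpha>) \<and> (uhat x < \<alpha> \<longrightarrow> fhat x = 1) \<and>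
           0 < fhat x \<and> 0 \<le> uhat x \<and> uhat x \<le> \<alpha>"
  shows "solves_P s D \<alpha> (\<lambda>x. \<alpha> - uhat x) \<and>
    (\<forall>U. solves_P s D \<alpha> U \<longrightarrow> solves_ineq s D \<alpha> U) \<and>
    (test_functions_dense s D \<longrightarrow> (\<forall>U. solves_ineq s D \<alpha> U \<longrightarrow> solves_P s D \<alpha> U)) \<and>
    (\<forall>U. solves_P s D \<alpha> U \<longleftrightarrow> is_min_on (J s D) (H_alpha s D \<alpha>) U)"
proof -
  have Db [measurable]: "D \<in> sets borel" using assms(3) by simp
  have fR: "set_integrable lborel D fhat" "AE x in lborel. x \<in> D \<longrightarrow> 0 \<le> fhat x \<and> fhat x \<le> 1"
    using assms(7) by (auto simp: unique_Phi_minimizer_def is_min_on_def R_bar_def)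
  have uH: "uhat \<in> Hs0 s D" using assms(8) by (simp add: is_state_def)
  have fin: "emeasure lborel D < \<infinity>"
    using assms(10) by (intro finite_measure_of_contact[OF Db fR(1) Hs_integrable_power2[OF Hs0_D(1)[OF uH]] assms(9)])
      (auto elim!: eventually_mono)
  \<comment> \<open>Integrability over \<open>D\<close> makes only the product of
    \<open>fhat\<close> with the indicator measurable. Clamping this product gives a Borel function
    on the whole space with values between 0 and 1 that agrees with \<open>fhat\<close> almost
    everywhere in \<open>D\<close>.\<close>
  define f where "f x = max 0 (min 1 (indicator D x *\<^sub>R fhat x))" for x
  have "(\<lambda>x. indicator D x *\<^sub>R fhat x) \<in> borel_measurable lborel"
    using fR(1) unfolding set_integrable_def by (rule borel_measurable_integrable)
  then have [measurable]: "f \<in> borel_measurable borel" unfolding f_def by simp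
  have ff: "AE x in lborel. x \<in> D \<longrightarrow> f x = fhat x"
    using fR(2) by eventually_elim (simp add: f_def)
  interpret obstacle_state s \<alpha> D f uhat
  proof
    have "(LINT x:D|lborel. fhat x * v x) = (LINT x:D|lborel. f x * v x)" if "v \<in> Hs0 s D" for v
    proof -
      note Hs_measurable[OF Hs0_D(1)[OF that], measurable]
      show ?thesis unfolding set_lebesgue_integral_def
      proof (rule integral_cong_AE)
        have "(\<lambda>x. (indicator D x *\<^sub>R fhat x) * v x) \<in> borel_measurable lborel"
          using \<open>(\<lambda>x. indicator D x *\<^sub>R fhat x) \<in> borel_measurable lborel\<close> by measurable
        then show "(\<lambda>x. indicator D x *\<^sub>R (fhat x * v x)) \<in> borel_measurable lborel"
          by (simp add: mult.assoc)
        show "AE x in lborel. indicator D x *\<^sub>R (fhat x * v x) = indicator D x *\<^sub>R (f x * v x)"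
          using ff by eventually_elim (simp add: indicator_def)
      qed measurable
    qed
    then show "is_state s D f uhat" using assms(8) by (auto simp: is_state_def)
    show "AE x in lborel. x \<in> D \<longrightarrow> (uhat x < \<alpha> \<longrightarrow> f x = 1) \<and> 0 \<le> uhat x \<and> uhat x \<le> \<alpha>"
      using assms(10) ff by eventually_elim auto
  qed (use assms fin in \<open>auto simp: f_def\<close>)
  show ?thesis
  proof (intro conjI allI impI)
    show "solves_P s D \<alpha> (\<lambda>x. \<alpha> - uhat x)" using optimal_H_alpha by (simp add: solves_P_iff)
    show "solves_ineq s D \<alpha> U" if "solves_P s D \<alpha> U" for U
      using that solves_ineq_of_eq by (simp add: solves_P_iff)
    show "solves_P s D \<alpha> U" if "test_functions_dense s D" "solves_ineq s D \<alpha> U" for U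
      using solves_ineq_unique[OF that] that(2) by (simp add: solves_P_iff solves_ineq_def)
    show "solves_P s D \<alpha> U \<longleftrightarrow> is_min_on (J s D) (H_alpha s D \<alpha>) U" for U
      by (simp only: solves_P_iff is_min_on_J_iff)
  qed
qed

end
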